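(* Let $A$ be a $2\times 2$ integer matrix with eigenvalues $\lambda_1,\lambda_2$ satisfying $0<|\lambda_1|<1<|\lambda_2|$, and put $l_j=\log|\lambda_j|$ for $j=1,2$. Let $T\colon\mathbb{T}^2\to\mathbb{T}^2$, $T(x)=Ax \bmod 1$, let $(z_n)_{n\in\mathbb{N}}$ be any sequence of points in $\mathbb{T}^2$, let $\tau>0$ with $\tau\neq -l_1$, and let $$W_\tau=\{x\in\mathbb{T}^2 : T^n(x)\in B(z_n,e^{-n\tau})\text{ for infinitely many } n\in\mathbb{N}\}.$$ Then $$\dim_{\mathrm H} W_\tau = s_\tau := \begin{cases}\dfrac{2l_2}{\tau+l_2}, & 0<\tau<-l_1,\\[2ex] \min\left\{\dfrac{l_1+l_2}{\tau+l_1},\ \dfrac{2l_2}{\tau+l_2}\right\}, & \tau>-l_1.\end{cases}$$ Moreover, $W_\tau\in\mathscr{G}^{s_\tau}$.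
   Context: $\mathbb{T}^d=\mathbb{R}^d/\mathbb{Z}^d$ with the metric induced by the Euclidean metric; $B(z,r)$ is the open ball with centre $z$ and radius $r$. $\dim_{\mathrm H}$ denotes Hausdorff dimension, with the convention $\dim_{\mathrm H}\emptyset=0$. The large intersection class $\mathscr{G}^s=\mathscr{G}^s(\mathbb{T}^d)$ (Falconer's class on the torus): a dyadic cube in $\mathbb{T}^d$ is the image of a half-open cube $\prod_{i=1}^d[m_i2^{-k},(m_i+1)2^{-k})$ with integers $k\ge 0$, $0\le m_i<2^k$; its side length is $|D|=2^{-k}$. For $t>0$ and $E\subset\mathbb{T}^d$ let $\mathcal{M}^t_\infty(E)=\inf\{\sum_i|D_i|^t : E\subset\bigcup_i D_i,\ D_i \text{ dyadic cubes}\}$, the infimum being over countable covers. Then $\mathscr{G}^s$ is the class of all $G_\delta$ sets $E\subset\mathbb{T}^d$ such that $\mathcal{M}^t_\infty(E\cap D)=\mathcal{M}^t_\infty(D)$ for every $t$ with $0<t<s$ and every dyadic cube $D$ (for $s\le 0$ the condition is vacuous). *)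

theory Defs
  imports "HOL-Analysis.Analysis"
begin

definition lattice_rel :: "real^'n \<Rightarrow> real^'n \<Rightarrow> bool" where
  "lattice_rel x y \<longleftrightarrow> (\<forall>i. (x - y) $ i \<in> \<int>)"

lemma equivp_lattice_rel: "equivp (lattice_rel :: real^'n \<Rightarrow> _)"
proof (rule equivpI)
  show "reflp (lattice_rel :: real^'n \<Rightarrow> _)"
    by (rule reflpI) (simp add: lattice_rel_def)
  show "symp (lattice_rel :: real^'n \<Rightarrow> _)"
  proof (rule sympI)
    fix x y :: "real^'n"
    assume "lattice_rel x y"
    then have "- ((x - y) $ i) \<in> \<int>" for i
      unfolding lattice_rel_def by (intro Ints_minus) simp
    then show "lattice_rel y x"
      by (simp add: lattice_rel_def)
  qed
  show "transp (lattice_rel :: real^'n \<Rightarrow> _)"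
  proof (rule transpI)
    fix x y z :: "real^'n"
    assume "lattice_rel x y" "lattice_rel y z"
    then have "(x - y) $ i + (y - z) $ i \<in> \<int>" for i
      unfolding lattice_rel_def by (intro Ints_add) simp_all
    then show "lattice_rel x z"
      by (simp add: lattice_rel_def)
  qed
qed

quotient_type 'n torus = "(real, 'n::finite) vec" / lattice_rel
  morphisms rep_torus to_torus
  by (rule equivp_lattice_rel)

lemma to_torus_eq_iff: "to_torus x = to_torus y \<longleftrightarrow> lattice_rel x y"
  by (simp add: torus.abs_eq_iff)

lemma to_torus_surj: "\<exists>x. to_torus x = p"
  by (induction p rule: torus.abs_induct) blast

text \<open>The quotient metric: the distance of two points is the distance of their fibres in
  Euclidean space.\<close>

instantiation torus :: (finite) metric_space
begin

definition dist_torus :: "'a torus \<Rightarrow> 'a torus \<Rightarrow> real" where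
  "dist_torus p q = setdist (to_torus -` {p}) (to_torus -` {q})"

definition uniformity_torus :: "('a torus \<times> 'a torus) filter" where
  "uniformity_torus = (INF e\<in>{0<..}. principal {(x, y). dist x y < e})"

definition open_torus :: "'a torus set \<Rightarrow> bool" where
  "open_torus U \<longleftrightarrow> (\<forall>x\<in>U. eventually (\<lambda>(x', y). x' = x \<longrightarrow> y \<in> U) uniformity)"

instance
proof
  have ltE: "\<exists>y. to_torus y = q \<and> dist a y < e" if ap: "to_torus a = p" and lt: "dist p q < e"
    for p q :: "'a torus" and a e
  proof -
    have "to_torus -` {p} \<noteq> {}" "to_torus -` {q} \<noteq> {}"
      using to_torus_surj[of p] to_torus_surj[of q] by auto
    then obtain x y where xy: "x \<in> to_torus -` {p}" "y \<in> to_torus -` {q}" "dist x y < e"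
      using lt setdist_ltE[of "to_torus -` {p}" "to_torus -` {q}" e] unfolding dist_torus_def by blast
    have "lattice_rel a x"
      using xy(1) ap by (simp flip: to_torus_eq_iff)
    then have "to_torus (a + (y - x)) = to_torus y"
      by (simp add: to_torus_eq_iff lattice_rel_def)
    then have "to_torus (a + (y - x)) = q"
      using xy(2) by simp
    moreover have "dist a (a + (y - x)) = dist x y"
      by (simp add: dist_norm norm_minus_commute)
    ultimately show ?thesis using xy(3) by metis
  qed
  have dist_le: "dist (to_torus x) (to_torus y) \<le> dist x y" for x y :: "real^'a"
    unfolding dist_torus_def by (rule setdist_le_dist) simp_all
  have commute: "dist p q = dist q p" for p q :: "'a torus"
    unfolding dist_torus_def by (rule setdist_sym)
  fix p q r :: "'a torus"
  obtain a where a: "to_torus a = p" using to_torus_surj by blast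
  show "dist p q = 0 \<longleftrightarrow> p = q"
  proof
    assume 0: "dist p q = 0"
    obtain b where b: "to_torus b = q" "dist a b < 1/2"
      using ltE[OF a, of q "1/2"] 0 by auto
    show "p = q"
    proof (rule ccontr)
      assume "p \<noteq> q"
      then have "dist a b > 0" using a b(1) by auto
      then obtain c where c: "to_torus c = q" "dist a c < min (1/2) (dist a b)"
        using ltE[OF a, of q "min (1/2) (dist a b)"] 0 by auto
      have "lattice_rel b c"
        using b(1) c(1) by (simp flip: to_torus_eq_iff)
      then have int: "(b - c) $ i \<in> \<int>" for i
        by (simp only: lattice_rel_def)
      have "norm (b - c) < 1"
        using dist_triangle2[of b c a] b(2) c(2) dist_triangle_half_l[of b a 1 c]
        by (simp add: dist_norm norm_minus_commute)
      then have "\<bar>(b - c) $ i\<bar> < 1" for i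
        using component_le_norm_cart[of "b - c" i] by linarith
      then have "(b - c) $ i = 0" for i
        using int Ints_nonzero_abs_less1 by blast
      then have "b = c"
        by (simp add: vec_eq_iff)
      with c show False by simp
    qed
  next
    assume "p = q"
    then show "dist p q = 0" by (simp add: dist_torus_def setdist_refl)
  qed
  show "dist p q \<le> dist p r + dist q r"
  proof (rule field_le_epsilon)
    fix e :: real assume "e > 0"
    obtain c where c: "to_torus c = r" "dist a c < dist p r + e/2"
      using ltE[OF a, of r "dist p r + e/2"] \<open>e > 0\<close> by auto
    obtain b where b: "to_torus b = q" "dist c b < dist r q + e/2"
      using ltE[OF c(1), of q "dist r q + e/2"] \<open>e > 0\<close> by auto
    have "dist p q \<le> dist a b"
      using dist_le[of a b] a b(1) by simp
    also have "\<dots> \<le> dist a c + dist c b"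
      by (rule dist_triangle)
    also have "\<dots> \<le> dist p r + dist q r + e"
      using b(2) c(2) commute[of r q] by linarith
    finally show "dist p q \<le> dist p r + dist q r + e" .
  qed
qed (rule uniformity_torus_def open_torus_def)+

end

lemma lattice_rel_matrix:
  fixes A :: "int^'n^'n"
  assumes "lattice_rel x y"
  shows "lattice_rel (map_matrix real_of_int A *v x) (map_matrix real_of_int A *v y)"
  unfolding lattice_rel_def
proof
  fix i
  have "(map_matrix real_of_int A *v x - map_matrix real_of_int A *v y) $ i
    = (\<Sum>j\<in>UNIV. real_of_int (A $ i $ j) * (x - y) $ j)"
    by (simp add: matrix_vector_mult_def sum_subtractf right_diff_distrib)
  also have "\<dots> \<in> \<int>"
    using assms unfolding lattice_rel_def by (intro Ints_sum Ints_mult) auto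
  finally show "(map_matrix real_of_int A *v x - map_matrix real_of_int A *v y) $ i \<in> \<int>" .
qed

lift_definition torus_map :: "int^'n^'n \<Rightarrow> 'n torus \<Rightarrow> 'n torus" is
  "\<lambda>A x. map_matrix real_of_int A *v x"
  by (rule lattice_rel_matrix)

definition eigenvalue_of :: "int^'n^'n \<Rightarrow> complex \<Rightarrow> bool" where
  "eigenvalue_of A c \<longleftrightarrow> (\<exists>v. v \<noteq> 0 \<and> map_matrix of_int A *v v = c *s v)"

definition shrinking_target_set ::
    "int^'n^'n \<Rightarrow> (nat \<Rightarrow> 'n torus) \<Rightarrow> real \<Rightarrow> 'n torus set" where
  "shrinking_target_set A z \<tau> =
    {x. \<exists>\<^sub>\<infinity>n. (torus_map A ^^ n) x \<in> ball (z n) (exp (- real n * \<tau>))}"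


subsection \<open>Hausdorff measure and dimension\<close>

text \<open>Only exponents \<open>s > 0\<close> are used below: then empty sets and singletons contribute \<open>0\<close> to the sums,
  so that sequences also account for finite covers. Boundedness is required because the library's
  \<open>diameter\<close> is real-valued and meaningless on unbounded sets.\<close>

definition hausdorff_premeasure :: "real \<Rightarrow> real \<Rightarrow> 'a::metric_space set \<Rightarrow> ennreal" where
  "hausdorff_premeasure s \<delta> E =
    (INF U \<in> {U :: nat \<Rightarrow> 'a set. E \<subseteq> (\<Union>i. U i) \<and> (\<forall>i. bounded (U i) \<and> diameter (U i) \<le> \<delta>)}.
      (\<Sum>i. ennreal (diameter (U i) powr s)))"

definition hausdorff_measure :: "real \<Rightarrow> 'a::metric_space set \<Rightarrow> ennreal" where
  "hausdorff_measure s E = (SUP \<delta> \<in> {0<..}. hausdorff_premeasure s \<delta> E)"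

definition hausdorff_dim :: "'a::metric_space set \<Rightarrow> ereal" where
  "hausdorff_dim E = (INF s \<in> {s. 0 < s \<and> hausdorff_measure s E = 0}. ereal s)"


subsection \<open>The large intersection classes\<close>

text \<open>A dyadic cube is given by its generation \<open>k\<close> and its position \<open>m\<close>; distinct pairs from
  \<open>dyadic_indices\<close> give distinct cubes. Since there are only countably many such pairs, every
  family of cubes is countable.\<close>

definition dyadic_indices :: "(nat \<times> ('n::finite \<Rightarrow> nat)) set" where
  "dyadic_indices = {(k, m). \<forall>i. m i < 2 ^ k}"

definition dyadic_cube :: "nat \<times> ('n::finite \<Rightarrow> nat) \<Rightarrow> 'n torus set" where
  "dyadic_cube = (\<lambda>(k, m).
    to_torus ` {x. \<forall>i. real (m i) / 2 ^ k \<le> x $ i \<and> x $ i < (real (m i) + 1) / 2 ^ k})"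

definition side_length :: "nat \<times> ('n::finite \<Rightarrow> nat) \<Rightarrow> real" where
  "side_length = (\<lambda>(k, m). 1 / 2 ^ k)"

definition net_content :: "real \<Rightarrow> 'n::finite torus set \<Rightarrow> ennreal" where
  "net_content t E =
    (INF C \<in> {C. C \<subseteq> dyadic_indices \<and> E \<subseteq> (\<Union>D\<in>C. dyadic_cube D)}.
      (\<Sum>\<^sub>\<infinity>D\<in>C. ennreal (side_length D powr t)))"

definition large_intersection_class :: "real \<Rightarrow> 'n::finite torus set set" where
  "large_intersection_class s = {E. gdelta E \<and>
    (\<forall>t. 0 < t \<and> t < s \<longrightarrow> (\<forall>D\<in>dyadic_indices.
      net_content t (E \<inter> dyadic_cube D) = net_content t (dyadic_cube D)))}"

definition shrinking_target_dim :: "real \<Rightarrow> real \<Rightarrow> real \<Rightarrow> real" where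
  "shrinking_target_dim l1 l2 \<tau> =
    (if \<tau> < - l1 then 2 * l2 / (\<tau> + l2)
     else min ((l1 + l2) / (\<tau> + l1)) (2 * l2 / (\<tau> + l2)))"

end

theory Submission
  imports Defs
begin

text \<open>Write \<open>\<mu>\<close> and \<open>\<nu>\<close> for the contracting and the expanding eigenvalue; they are real, irrational and conjugate. The left
eigenvectors \<open>u\<close> and \<open>v\<close> of the matrix serve as coordinates in the plane. Their product is, on integer points, an integral
quadratic form without nontrivial zeros. So \<open>\<bar>u k * v k\<bar> \<ge> 1\<close> for every integer point \<open>k \<noteq> 0\<close>, and a box with sides
\<open>U\<close> and \<open>V\<close> along the eigendirections contains at most about \<open>1 + U * V\<close> integer points, however long and thin it
is (\<open>lattice_box_finite_card\<close>); by Dirichlet's theorem it contains a number of integer points comparable to \<open>U * V\<close> if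
\<open>U \<le> 1\<close> and \<open>U * V\<close> is large (\<open>lattice_box_card_lower\<close>). These two counts replace any equidistribution or mixing argument.

Let \<open>r = exp (- n * \<tau>)\<close>, \<open>a = \<bar>\<mu>\<bar> ^ n\<close> and \<open>b = \<bar>\<nu>\<bar> ^ n\<close>. The points that are in the \<open>n\<close>-th target at time \<open>n\<close>
form pieces of size \<open>r / a\<close> by \<open>r / b\<close>, cut off at the size of the torus. For the upper bound of the dimension, they are
covered by about \<open>b\<^sup>2\<close> sets of diameter \<open>r / b\<close>, or, if \<open>\<tau> > - l1\<close>, by about \<open>a * b\<close> sets of diameter \<open>r / a\<close>.
The two critical exponents are \<open>2 * l2 / (\<tau> + l2)\<close> and \<open>(l1 + l2) / (\<tau> + l1)\<close> (\<open>hausdorff_measure_target_null\<close>).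

For the large intersection property and the lower bound, let \<open>0 < t < s\<close> and cover the part of that set in a dyadic cube by dyadic
cubes. Comparing areas after applying the \<open>n\<close>-th power of the matrix (\<open>mass_estimate\<close>) and interpolating between trivial bounds
for the area near one cube (\<open>decay\<close>) shows that for large \<open>n\<close> the cost of the cover is at least a constant times the
cost of the given cube (\<open>hits_content_lower_bound\<close>). The constant is the same for all cubes, so a subdivision
argument improves it to \<open>1\<close> (\<open>content_lower_bound_improve\<close>), and a Baire-type construction of nested cubes carries the bound
over to the set of points that hit infinitely many targets (\<open>cost_ge_Inter_of_open\<close>). That is membership in the large
intersection class. Finally, a set of Hausdorff measure \<open>0\<close> has net content \<open>0\<close>
(\<open>hausdorff_null_imp_net_content_null\<close>), so the Hausdorff measures of the shrinking target set are positive for all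
exponents below \<open>s\<close>.\<close>

section \<open>Sums of extended nonnegative reals over arbitrary index sets\<close>

text \<open>The rules for sums over disjoint unions and for sums of functions have summability as a premise; this instance discharges it.\<close>

lemma ennreal_summable_on:
  fixes f :: "'a \<Rightarrow> ennreal"
  shows "f summable_on A"
  by (rule nonneg_summable_on_complete) simp

lemma infsum_ennreal_eq_SUP:
  fixes f :: "'a \<Rightarrow> ennreal"
  shows "infsum f A = (SUP F\<in>{F. finite F \<and> F \<subseteq> A}. sum f F)"
  by (rule nonneg_infsum_complete) simp

lemma sum_le_infsum_ennreal:
  fixes f :: "'a \<Rightarrow> ennreal"
  assumes "finite F" "F \<subseteq> A"
  shows "sum f F \<le> infsum f A"
  unfolding infsum_ennreal_eq_SUP using assms by (intro SUP_upper) auto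

lemma infsum_ennreal_least:
  fixes f :: "'a \<Rightarrow> ennreal"
  assumes "\<And>F. finite F \<Longrightarrow> F \<subseteq> A \<Longrightarrow> sum f F \<le> b"
  shows "infsum f A \<le> b"
  unfolding infsum_ennreal_eq_SUP using assms by (intro SUP_least) auto

lemma infsum_ennreal_mono_set:
  fixes f :: "'a \<Rightarrow> ennreal"
  assumes "A \<subseteq> B"
  shows "infsum f A \<le> infsum f B"
  by (rule infsum_ennreal_least) (use assms in \<open>auto intro!: sum_le_infsum_ennreal\<close>)

lemma infsum_ennreal_cmult:
  fixes f :: "'a \<Rightarrow> ennreal"
  shows "infsum (\<lambda>x. c * f x) A = c * infsum f A"
proof -
  have "{} \<in> {F. finite F \<and> F \<subseteq> A}" by simp
  then have ne: "{F. finite F \<and> F \<subseteq> A} \<noteq> {}" by blast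
  show ?thesis
    unfolding infsum_ennreal_eq_SUP SUP_mult_left_ennreal
    by (simp add: sum_distrib_left)
qed

lemma infsum_ennreal_finite_swap:
  fixes f :: "'a \<Rightarrow> 'b \<Rightarrow> ennreal"
  assumes "finite F"
  shows "(\<Sum>i\<in>F. infsum (f i) A) = infsum (\<lambda>x. \<Sum>i\<in>F. f i x) A"
  using assms
proof (induction F)
  case (insert i F)
  then show ?case by (simp add: infsum_add ennreal_summable_on)
qed simp

lemma infsum_ennreal_UN_disjoint_le:
  fixes f :: "'a \<Rightarrow> ennreal"
  assumes "finite F" "\<And>i j. i \<in> F \<Longrightarrow> j \<in> F \<Longrightarrow> i \<noteq> j \<Longrightarrow> B i \<inter> B j = {}"
    and "\<And>i. i \<in> F \<Longrightarrow> B i \<subseteq> A"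
  shows "(\<Sum>i\<in>F. infsum f (B i)) \<le> infsum f A"
proof -
  have "(\<Sum>i\<in>F. infsum f (B i)) = infsum f (\<Union>i\<in>F. B i)"
    using assms(1,2)
  proof (induction F)
    case (insert i F)
    have "B i \<inter> (\<Union>j\<in>F. B j) = {}"
      using insert.prems[of i] insert.hyps by fastforce
    then have "infsum f (B i \<union> (\<Union>j\<in>F. B j)) = infsum f (B i) + infsum f (\<Union>j\<in>F. B j)"
      by (intro infsum_Un_disjoint ennreal_summable_on)
    then show ?case using insert by simp
  qed simp
  also have "\<dots> \<le> infsum f A"
    using assms(3) by (intro infsum_ennreal_mono_set) auto
  finally show ?thesis .
qed

lemma infsum_ennreal_UN_le:
  fixes f :: "'a \<Rightarrow> ennreal" and B :: "nat \<Rightarrow> 'a set"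
  shows "infsum f (\<Union>i. B i) \<le> (\<Sum>i. infsum f (B i))"
proof (rule infsum_ennreal_least)
  fix F assume F: "finite F" "F \<subseteq> (\<Union>i. B i)"
  then have "\<forall>x\<in>F. \<exists>i. x \<in> B i" by auto
  then obtain g where g: "\<forall>x\<in>F. x \<in> B (g x)" by metis
  have "sum f F = (\<Sum>i\<in>g ` F. sum f {x\<in>F. g x = i})"
    by (rule sum.image_gen[OF F(1)])
  also have "\<dots> \<le> (\<Sum>i\<in>g ` F. infsum f (B i))"
    using F g by (intro sum_mono sum_le_infsum_ennreal) auto
  also have "\<dots> \<le> (\<Sum>i. infsum f (B i))"
    using F(1) by (intro sum_le_suminf) auto
  finally show "sum f F \<le> (\<Sum>i. infsum f (B i))" .
qed

text \<open>Covers are indexed by arbitrary countable sets of cubes, so countable subadditivity is transported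
along an enumeration of the index set.\<close>

lemma emeasure_le_infsum_Int:
  assumes "countable C" "R \<in> sets M" "\<And>D. D \<in> C \<Longrightarrow> B D \<in> sets M" "R \<subseteq> (\<Union>D\<in>C. B D)"
  shows "emeasure M R \<le> infsum (\<lambda>D. emeasure M (R \<inter> B D)) C"
proof (cases "C = {}")
  case True
  then show ?thesis using assms by simp
next
  case False
  show ?thesis
  proof (cases "finite C")
    case True
    have "emeasure M R \<le> emeasure M (\<Union>D\<in>C. R \<inter> B D)"
      using assms True by (intro emeasure_mono) auto
    also have "\<dots> \<le> (\<Sum>D\<in>C. emeasure M (R \<inter> B D))"
      using assms True by (intro emeasure_subadditive_finite) auto
    finally show ?thesis using True by simp
  next
    case inf: False
    define g where "g = from_nat_into C"
    have g: "bij_betw g UNIV C"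
      unfolding g_def using assms(1) inf by (rule bij_betw_from_nat_into)
    have "emeasure M R \<le> emeasure M (\<Union>i. R \<inter> B (g i))"
      using assms g by (intro emeasure_mono) (auto simp: bij_betw_def)
    also have "\<dots> \<le> (\<Sum>i. emeasure M (R \<inter> B (g i)))"
      using assms g by (intro emeasure_subadditive_countably) (auto simp: bij_betw_def)
    also have "\<dots> \<le> infsum (\<lambda>D. emeasure M (R \<inter> B D)) C"
    proof (rule suminf_le_const)
      fix n
      have "(\<Sum>i<n. emeasure M (R \<inter> B (g i))) = (\<Sum>D\<in>g ` {..<n}. emeasure M (R \<inter> B D))"
        using g by (subst sum.reindex) (auto simp: bij_betw_def inj_on_def)
      also have "\<dots> \<le> infsum (\<lambda>D. emeasure M (R \<inter> B D)) C"
        using g by (intro sum_le_infsum_ennreal) (auto simp: bij_betw_def)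
      finally show "(\<Sum>i<n. emeasure M (R \<inter> B (g i))) \<le> infsum (\<lambda>D. emeasure M (R \<inter> B D)) C" .
    qed simp
    finally show ?thesis .
  qed
qed

section \<open>Dyadic cubes in Euclidean space\<close>

text \<open>Dyadic cubes are studied through their representatives in the unit cube of Euclidean space. The
half-open cubes of one generation are disjoint and give the nested structure; the open and the
closed ones provide neighbourhoods and compactness.\<close>

definition half_open_cube :: "nat \<times> ('n::finite \<Rightarrow> nat) \<Rightarrow> (real^'n) set" where
  "half_open_cube = (\<lambda>(k, m). {x. \<forall>i. real (m i) / 2 ^ k \<le> x $ i \<and> x $ i < (real (m i) + 1) / 2 ^ k})"

definition open_cube :: "nat \<times> ('n::finite \<Rightarrow> nat) \<Rightarrow> (real^'n) set" where
  "open_cube = (\<lambda>(k, m). {x. \<forall>i. real (m i) / 2 ^ k < x $ i \<and> x $ i < (real (m i) + 1) / 2 ^ k})"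

definition closed_cube :: "nat \<times> ('n::finite \<Rightarrow> nat) \<Rightarrow> (real^'n) set" where
  "closed_cube = (\<lambda>(k, m). {x. \<forall>i. real (m i) / 2 ^ k \<le> x $ i \<and> x $ i \<le> (real (m i) + 1) / 2 ^ k})"

lemma open_cube_subset: "open_cube D \<subseteq> half_open_cube D"
  by (auto simp: open_cube_def half_open_cube_def less_imp_le split: prod.splits)

lemma half_open_cube_subset: "half_open_cube D \<subseteq> closed_cube D"
  by (auto simp: closed_cube_def half_open_cube_def less_imp_le split: prod.splits)

lemma closed_cube_eq_cbox:
  "closed_cube (k, m) = cbox (\<chi> i. real (m i) / 2 ^ k) (\<chi> i. (real (m i) + 1) / 2 ^ k)"
  by (auto simp: closed_cube_def mem_box_cart)

lemma open_cube_eq_box: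
  "open_cube (k, m) = box (\<chi> i. real (m i) / 2 ^ k) (\<chi> i. (real (m i) + 1) / 2 ^ k)"
  by (auto simp: open_cube_def mem_box_cart)

lemma compact_closed_cube: "compact (closed_cube D)"
  by (cases D) (simp add: closed_cube_eq_cbox compact_cbox)

lemma open_open_cube: "open (open_cube D)"
  by (cases D) (simp add: open_cube_eq_box open_box)

lemma half_open_cube_nonempty: "(\<chi> i. real (m i) / 2 ^ k) \<in> half_open_cube (k, m)"
  by (auto simp: half_open_cube_def divide_simps)

lemma half_open_cube_iff_floor:
  "x \<in> half_open_cube (k, m) \<longleftrightarrow> (\<forall>i. \<lfloor>2 ^ k * x $ i\<rfloor> = int (m i))"
  by (auto simp: half_open_cube_def floor_eq_iff field_simps)

lemma half_open_cube_unique_position: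
  assumes "x \<in> half_open_cube (k, m)" "x \<in> half_open_cube (k, m')"
  shows "m = m'"
proof
  fix i
  have "int (m i) = int (m' i)" using assms unfolding half_open_cube_iff_floor by metis
  then show "m i = m' i" by simp
qed

text \<open>The position at generation \<open>k\<close> is read off from the position at a finer generation by integer
division; this is what makes dyadic cubes nested.\<close>

lemma floor_dyadic_coarsen:
  fixes y :: real
  assumes "k \<le> k'"
  shows "\<lfloor>2 ^ k * y\<rfloor> = \<lfloor>2 ^ k' * y\<rfloor> div 2 ^ (k' - k)"
proof -
  have "2 ^ k * y = (2 ^ k' * y) / real_of_int (2 ^ (k' - k))"
    using assms by (simp add: field_simps flip: power_add)
  then show ?thesis by (simp only: floor_divide_real_eq_div zero_le_power zero_le_numeral)
qed



lemma half_open_cube_nested: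
  assumes "x \<in> half_open_cube D" "x \<in> half_open_cube D'" "fst D \<le> fst D'"
  shows "half_open_cube D' \<subseteq> half_open_cube D"
proof
  fix y assume y: "y \<in> half_open_cube D'"
  obtain k m k' m' where [simp]: "D = (k, m)" "D' = (k', m')" by (cases D, cases D')
  have "\<lfloor>2 ^ k * y $ i\<rfloor> = \<lfloor>2 ^ k * x $ i\<rfloor>" for i
    using y assms by (simp add: floor_dyadic_coarsen[of k k'] half_open_cube_iff_floor)
  then show "y \<in> half_open_cube D"
    using assms(1) by (simp add: half_open_cube_iff_floor)
qed

text \<open>Requiring the generations to be ordered as well makes cubes of the same generation comparable only
if they are equal.\<close>

definition subcube :: "nat \<times> ('n::finite \<Rightarrow> nat) \<Rightarrow> nat \<times> ('n \<Rightarrow> nat) \<Rightarrow> bool" where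
  "subcube D' D \<longleftrightarrow> fst D \<le> fst D' \<and> half_open_cube D' \<subseteq> half_open_cube D"

lemma subcube_refl: "subcube D D" and subcube_trans: "subcube A B \<Longrightarrow> subcube B C \<Longrightarrow> subcube A C"
  by (auto simp: subcube_def)

lemma subcube_meet:
  assumes "x \<in> half_open_cube D" "x \<in> half_open_cube D'"
  shows "fst D \<le> fst D' \<Longrightarrow> subcube D' D"
  using half_open_cube_nested[OF assms] by (simp add: subcube_def)

lemma subcube_nonempty: obtains x where "x \<in> half_open_cube D"
  using half_open_cube_nonempty by (cases D) blast

lemma subcube_same_level: 
  assumes "subcube D' D" "fst D = fst D'" shows "D = D'"
proof -
  obtain x where "x \<in> half_open_cube D'" by (rule subcube_nonempty)
  moreover from this have "x \<in> half_open_cube D" using assms by (auto simp: subcube_def)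
  ultimately show ?thesis using assms(2) half_open_cube_unique_position
    by (cases D, cases D') auto
qed

lemma subcube_comparable:
  assumes "subcube A B" "subcube A C" shows "fst B \<le> fst C \<Longrightarrow> subcube C B"
proof -
  obtain x where "x \<in> half_open_cube A" by (rule subcube_nonempty)
  then have "x \<in> half_open_cube B" "x \<in> half_open_cube C" using assms by (auto simp: subcube_def)
  then show "fst B \<le> fst C \<Longrightarrow> subcube C B" by (rule subcube_meet)
qed

lemma dyadic_cube_containing:
  assumes "\<forall>i. 0 \<le> x $ i \<and> x $ i < 1"
  obtains m where "(k, m) \<in> dyadic_indices" "x \<in> half_open_cube (k, m)"
proof
  let ?m = "\<lambda>i. nat \<lfloor>2 ^ k * x $ i\<rfloor>"
  have nn: "0 \<le> \<lfloor>2 ^ k * x $ i\<rfloor>" for i using assms by simp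
  have lt: "\<lfloor>2 ^ k * x $ i\<rfloor> < 2 ^ k" for i
  proof -
    have "2 ^ k * x $ i < 2 ^ k * 1" using assms by (intro mult_strict_left_mono) auto
    then have "2 ^ k * x $ i < real_of_int (2 ^ k)" by simp
    then show ?thesis by (simp only: floor_less_iff)
  qed
  show "(k, ?m) \<in> dyadic_indices"
    using nn lt by (auto simp: dyadic_indices_def nat_less_iff)
  show "x \<in> half_open_cube (k, ?m)"
    using nn by (simp add: half_open_cube_iff_floor)
qed

lemma half_open_cube_unit:
  assumes "D \<in> dyadic_indices" "x \<in> half_open_cube D"
  shows "0 \<le> x $ i" "x $ i < 1"
proof -
  obtain k m where [simp]: "D = (k, m)" by (cases D)
  have "m i < 2 ^ k" using assms by (auto simp: dyadic_indices_def)
  then have "real (m i) + 1 \<le> 2 ^ k"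
    by (metis Suc_leI of_nat_1 of_nat_Suc of_nat_le_iff of_nat_numeral of_nat_power add.commute)
  then have "(real (m i) + 1) / 2 ^ k \<le> 1" by simp
  moreover have "0 \<le> real (m i) / 2 ^ k" by simp
  moreover have "real (m i) / 2 ^ k \<le> x $ i" "x $ i < (real (m i) + 1) / 2 ^ k"
    using assms by (auto simp: half_open_cube_def)
  ultimately show "0 \<le> x $ i" "x $ i < 1" by linarith+
qed

lemma side_length_pos: "0 < side_length D"
  by (auto simp: side_length_def split: prod.splits)

lemma side_length_eq: "side_length D = 1 / 2 ^ fst D"
  by (auto simp: side_length_def split: prod.splits)

lemma closed_cube_dist:
  assumes "x \<in> closed_cube D" "y \<in> closed_cube D"
  shows "\<bar>x $ i - y $ i\<bar> \<le> side_length D"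
proof -
  obtain k m where [simp]: "D = (k, m)" by (cases D)
  have "real (m i) / 2 ^ k \<le> x $ i" "x $ i \<le> (real (m i) + 1) / 2 ^ k"
     "real (m i) / 2 ^ k \<le> y $ i" "y $ i \<le> (real (m i) + 1) / 2 ^ k"
    using assms by (auto simp: closed_cube_def)
  then show ?thesis by (simp add: side_length_eq add_divide_distrib)
qed

lemma closed_cube_norm_dist:
  fixes x :: "real^'n"
  assumes "x \<in> closed_cube D" "y \<in> closed_cube D"
  shows "dist x y \<le> CARD('n) * side_length D"
proof -
  have "dist x y \<le> (\<Sum>i\<in>UNIV. \<bar>(x - y) $ i\<bar>)"
    unfolding dist_norm by (rule norm_le_l1_cart)
  also have "\<dots> \<le> (\<Sum>i\<in>(UNIV::'n set). side_length D)"
    using closed_cube_dist[OF assms] by (intro sum_mono) simp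
  finally show ?thesis by simp
qed

definition children :: "nat \<times> ('n::finite \<Rightarrow> nat) \<Rightarrow> (nat \<times> ('n \<Rightarrow> nat)) set" where
  "children D = Pair (Suc (fst D)) ` (PiE UNIV (\<lambda>i. {2 * snd D i, 2 * snd D i + 1}))"

lemma card_children: "card (children (D :: nat \<times> ('n::finite \<Rightarrow> nat))) = 2 ^ CARD('n)"
  and finite_children: "finite (children D)"
proof -
  let ?P = "\<lambda>i. {2 * snd D i, 2 * snd D i + 1}"
  have "card (PiE UNIV ?P) = (\<Prod>i\<in>(UNIV::'n set). card (?P i))"
    by (rule card_PiE) simp
  also have "\<dots> = (\<Prod>i\<in>(UNIV::'n set). 2)"
    by (rule prod.cong) auto
  also have "\<dots> = 2 ^ CARD('n)" by (rule prod_constant)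
  finally have "card (PiE UNIV ?P) = 2 ^ CARD('n)" .
  moreover have "card (children D) = card (PiE UNIV ?P)"
    unfolding children_def by (rule card_image) (simp add: inj_on_def)
  ultimately show "card (children D) = 2 ^ CARD('n)" by (simp only:)
  show "finite (children D)" unfolding children_def by (intro finite_imageI finite_PiE) auto
qed

lemma children_props:
  assumes "D' \<in> children D"
  shows "fst D' = Suc (fst D)" "open_cube D' \<subseteq> open_cube D" "D \<in> dyadic_indices \<Longrightarrow> D' \<in> dyadic_indices"
proof -
  obtain k m where [simp]: "D = (k, m)" by (cases D)
  obtain m' where [simp]: "D' = (Suc k, m')" and m': "\<And>i. m' i = 2 * m i \<or> m' i = 2 * m i + 1"
    using assms by (auto simp: children_def PiE_def Pi_def)
  show "fst D' = Suc (fst D)" by simp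
  show "open_cube D' \<subseteq> open_cube D"
  proof
    fix x assume x: "x \<in> open_cube D'"
    have "real (m i) / 2 ^ k < x $ i \<and> x $ i < (real (m i) + 1) / 2 ^ k" for i
    proof -
      have "real (m' i) < 2 * 2 ^ k * x $ i" "2 * 2 ^ k * x $ i < real (m' i) + 1"
        using x by (auto simp: open_cube_def field_simps)
      then show ?thesis using m'[of i] by (auto simp: field_simps)
    qed
    then show "x \<in> open_cube D" by (simp add: open_cube_def)
  qed
  show "D' \<in> dyadic_indices" if "D \<in> dyadic_indices"
  proof -
    have "m' i < 2 * 2 ^ k" for i
    proof -
      have "m i < 2 ^ k" using that by (simp add: dyadic_indices_def)
      then show ?thesis using m'[of i] by linarith
    qed
    then show ?thesis by (simp add: dyadic_indices_def)
  qed
qed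

section \<open>Dyadic covers of countable intersections of open sets\<close>

abbreviation cost :: "real \<Rightarrow> (nat \<times> ('n::finite \<Rightarrow> nat)) set \<Rightarrow> ennreal" where
  "cost t C \<equiv> infsum (\<lambda>D. ennreal (side_length D powr t)) C"

lemma cost_element:
  assumes "D \<in> C" shows "ennreal (side_length D powr t) \<le> cost t C"
  using sum_le_infsum_ennreal[of "{D}" C "\<lambda>D. ennreal (side_length D powr t)"] assms by simp

lemma side_length_antimono: "fst D \<le> fst D' \<Longrightarrow> side_length D' \<le> side_length D"
  by (simp add: side_length_eq divide_simps power_increasing)

lemma cost_ge_larger_cube:
  assumes "D' \<in> C" "fst D' \<le> fst D" "0 < t"
  shows "ennreal (side_length D powr t) \<le> cost t C"
proof -
  have "side_length D powr t \<le> side_length D' powr t"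
    using assms side_length_pos[of D] by (intro powr_mono2 side_length_antimono) auto
  then show ?thesis using cost_element[OF assms(1), of t] order_trans ennreal_leI by meson
qed

text \<open>Every dyadic cover of the part of \<open>G\<close> in the interior of a dyadic cube \<open>D\<close> costs at least \<open>c\<close>
times what \<open>D\<close> itself costs, uniformly in \<open>D\<close>. Interiors are used because the construction of nested
cubes below has to stay away from the boundary.\<close>

definition content_lower_bound :: "real \<Rightarrow> (real^'n) set \<Rightarrow> real \<Rightarrow> bool" where
  "content_lower_bound t G c \<longleftrightarrow> (\<forall>D\<in>dyadic_indices. \<forall>C\<subseteq>dyadic_indices.
     G \<inter> open_cube D \<subseteq> (\<Union>D\<in>C. half_open_cube D) \<longrightarrow> ennreal (c * side_length D powr t) \<le> cost t C)"

lemma content_lower_boundD: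
  assumes "content_lower_bound t G c" "D \<in> dyadic_indices" "C \<subseteq> dyadic_indices"
    and "G \<inter> open_cube D \<subseteq> (\<Union>D\<in>C. half_open_cube D)"
  shows "ennreal (c * side_length D powr t) \<le> cost t C"
  using assms unfolding content_lower_bound_def by blast

text \<open>A cover either uses a cube at least as large as \<open>D\<close>, or it splits into covers of the
\<open>2 ^ CARD('n)\<close> children, each of which costs at least \<open>c\<close> times \<open>2 powr (- t)\<close> times the cost
of \<open>D\<close>. So the constant grows by the factor \<open>2 powr (CARD('n) - t)\<close> unless it is capped at \<open>1\<close>.\<close>

lemma content_lower_bound_step:
  fixes G :: "(real^'n) set" and t :: real
  assumes t: "0 < t" and c: "0 < c" and low: "content_lower_bound t G c"
  shows "content_lower_bound t G (min 1 (2 powr (real CARD('n) - t) * c))"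
  unfolding content_lower_bound_def
proof (intro ballI allI impI)
  fix D :: "nat \<times> ('n \<Rightarrow> nat)" and C
  assume D: "D \<in> dyadic_indices" and C: "C \<subseteq> dyadic_indices"
    and cover: "G \<inter> open_cube D \<subseteq> (\<Union>D\<in>C. half_open_cube D)"
  let ?s = "side_length D"
  show "ennreal (min 1 (2 powr (real CARD('n) - t) * c) * ?s powr t) \<le> cost t C"
  proof (cases "\<exists>D'\<in>C. fst D' \<le> fst D")
    case True
    then obtain D' where "D' \<in> C" "fst D' \<le> fst D" by blast
    then have "ennreal (?s powr t) \<le> cost t C"
      using t by (intro cost_ge_larger_cube)
    moreover have "min 1 (2 powr (real CARD('n) - t) * c) * ?s powr t \<le> ?s powr t"
      using mult_right_mono[of "min 1 (2 powr (real CARD('n) - t) * c)" 1 "?s powr t"] by simp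
    ultimately show ?thesis by (meson ennreal_leI order_trans)
  next
    case False
    define B where "B D' = {E\<in>C. subcube E D'}" for D'
    have lowB: "ennreal (c * (?s / 2) powr t) \<le> cost t (B D')" if D': "D' \<in> children D" for D'
    proof -
      have "G \<inter> open_cube D' \<subseteq> (\<Union>D\<in>B D'. half_open_cube D)"
      proof
        fix x assume x: "x \<in> G \<inter> open_cube D'"
        then obtain E where E: "E \<in> C" "x \<in> half_open_cube E"
          using cover children_props(2)[OF D'] by blast
        moreover have "x \<in> half_open_cube D'" using x open_cube_subset by blast
        moreover have "fst D' \<le> fst E" using False E(1) children_props(1)[OF D'] by fastforce
        ultimately show "x \<in> (\<Union>D\<in>B D'. half_open_cube D)"
          unfolding B_def using subcube_meet by blast
      qed
      then have "ennreal (c * side_length D' powr t) \<le> cost t (B D')"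
        using C by (intro content_lower_boundD[OF low children_props(3)[OF D' D]]) (auto simp: B_def)
      moreover have "side_length D' = ?s / 2"
        using children_props(1)[OF D'] by (simp add: side_length_eq)
      ultimately show ?thesis by simp
    qed
    have disj: "B D1 \<inter> B D2 = {}" if "D1 \<in> children D" "D2 \<in> children D" "D1 \<noteq> D2" for D1 D2
    proof (rule ccontr)
      assume "B D1 \<inter> B D2 \<noteq> {}"
      then obtain E where "subcube E D1" "subcube E D2" unfolding B_def by blast
      moreover have level: "fst D1 = fst D2"
        using children_props(1)[OF that(1)] children_props(1)[OF that(2)] by simp
      ultimately have "subcube D2 D1"
        by (metis subcube_comparable order_refl)
      then show False
        using that level subcube_same_level by blast
    qed
    have "ennreal (2 powr (real CARD('n) - t) * c * ?s powr t)
        = ennreal (2 ^ CARD('n) * (c * (?s / 2) powr t))"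
      using side_length_pos[of D]
      by (simp add: powr_divide powr_diff powr_realpow field_simps)
    also have "\<dots> = (\<Sum>D'\<in>children D. ennreal (c * (?s / 2) powr t))"
      using c by (simp add: card_children ennreal_mult ennreal_power ennreal_of_nat_eq_real_of_nat)
    also have "\<dots> \<le> (\<Sum>D'\<in>children D. cost t (B D'))"
      by (intro sum_mono lowB)
    also have "\<dots> \<le> cost t C"
      by (intro infsum_ennreal_UN_disjoint_le finite_children disj) (auto simp: B_def)
    finally have "ennreal (2 powr (real CARD('n) - t) * c * ?s powr t) \<le> cost t C" .
    moreover have "min 1 (2 powr (real CARD('n) - t) * c) * ?s powr t \<le> 2 powr (real CARD('n) - t) * c * ?s powr t"
      by (intro mult_right_mono) auto
    ultimately show ?thesis by (meson ennreal_leI order_trans)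
  qed
qed

lemma content_lower_bound_mono:
  assumes "content_lower_bound t G c" "c' \<le> c"
  shows "content_lower_bound t G c'"
proof -
  have "ennreal (c' * side_length D powr t) \<le> ennreal (c * side_length D powr t)" for D :: "nat \<times> ('a \<Rightarrow> nat)"
    using assms(2) by (intro ennreal_leI mult_right_mono) auto
  then show ?thesis using assms(1) unfolding content_lower_bound_def by (meson order_trans)
qed

text \<open>For \<open>t < CARD('n)\<close> the growth factor of the previous lemma exceeds \<open>1\<close>, so iterating it
turns any positive constant into \<open>1\<close>.\<close>

lemma content_lower_bound_improve:
  fixes G :: "(real^'n) set" and t :: real
  assumes t: "0 < t" "t < CARD('n)" and c: "0 < c" and low: "content_lower_bound t G c"
  shows "content_lower_bound t G 1"
proof -
  let ?b = "2 powr (real CARD('n) - t)"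
  have b: "1 < ?b" using t by simp
  have iter: "content_lower_bound t G (min 1 (?b ^ j * c))" for j
  proof (induction j)
    case 0
    then show ?case using low content_lower_bound_mono[of t G c "min 1 c"] by simp
  next
    case (Suc j)
    have "0 < min 1 (?b ^ j * c)" using c b by simp
    then have "content_lower_bound t G (min 1 (?b * min 1 (?b ^ j * c)))"
      using content_lower_bound_step[OF t(1) _ Suc] by blast
    moreover have "min 1 (?b ^ Suc j * c) \<le> min 1 (?b * min 1 (?b ^ j * c))"
      using b c by (auto simp: min_def)
    ultimately show ?case by (rule content_lower_bound_mono)
  qed
  obtain j where "1 / c < ?b ^ j" using real_arch_pow[OF b] by blast
  then have "1 \<le> ?b ^ j * c" using c by (simp add: field_simps)
  then show ?thesis using iter[of j] by simp
qed

lemma small_closed_cube_inside_open: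
  fixes x :: "real^'n"
  assumes "open U" "x \<in> U"
  obtains N where "\<And>E. N \<le> fst E \<Longrightarrow> x \<in> closed_cube E \<Longrightarrow> closed_cube E \<subseteq> U"
proof -
  obtain e where e: "e > 0" "ball x e \<subseteq> U" using assms openE by blast
  obtain N where N: "CARD('n) / e < 2 ^ N" using real_arch_pow[of 2] by auto
  show ?thesis
  proof (rule that[of N])
    fix E :: "nat \<times> ('n \<Rightarrow> nat)" assume E: "N \<le> fst E" "x \<in> closed_cube E"
    have "CARD('n) < e * 2 ^ N" using N e(1) by (simp add: field_simps)
    also have "\<dots> \<le> e * 2 ^ fst E" using E(1) e(1) by (intro mult_left_mono power_increasing) auto
    finally have "CARD('n) * side_length E < e"
      by (simp add: side_length_eq field_simps)
    then show "closed_cube E \<subseteq> U"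
      using closed_cube_norm_dist[OF E(2)] e(2) by force
  qed
qed

text \<open>A place where a cover \<open>C\<close> is cheaper than it should be. The nested cubes of the Baire-type argument are of
this kind, which guarantees that \<open>C\<close> misses their common point.\<close>

definition light_cube :: "real \<Rightarrow> (nat \<times> ('n::finite \<Rightarrow> nat)) set \<Rightarrow> nat \<times> ('n \<Rightarrow> nat) \<Rightarrow> bool" where
  "light_cube t C D \<longleftrightarrow> D \<in> dyadic_indices \<and> (\<forall>E\<in>C. \<not> subcube D E) \<and>
     cost t {E\<in>C. subcube E D} < ennreal (side_length D powr t)"

text \<open>If every cube well inside \<open>U \<inter> open_cube D\<close> failed to be light, then among the cubes of
\<open>C\<close> inside \<open>D\<close> one could replace, for each maximal such cube that is not contained in a cube of \<open>C\<close>, the cubes of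
\<open>C\<close> inside it by that single cube, without raising the cost. The outcome would cover
\<open>U \<inter> open_cube D\<close> and be cheaper than \<open>D\<close>, against the lower bound for \<open>U\<close>.\<close>

lemma light_subcube_exists:
  fixes U :: "(real^'n) set"
  assumes low: "content_lower_bound t U 1" and "open U" and C: "C \<subseteq> dyadic_indices"
    and D: "light_cube t C D"
  obtains D' where "light_cube t C D'" "fst D < fst D'" "closed_cube D' \<subseteq> U \<inter> open_cube D"
proof (rule ccontr)
  assume "\<not> thesis"
  with that have none: "\<not> light_cube t C D'" if "fst D < fst D'" "closed_cube D' \<subseteq> U \<inter> open_cube D" for D'
    using that by blast
  define F where "F = {D'\<in>dyadic_indices. fst D < fst D' \<and> closed_cube D' \<subseteq> U \<inter> open_cube D}"
  \<comment> \<open>maximal cubes well inside that are not swallowed by a cube of the cover, and the cubes of the cover that survive the replacement\<close>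
  define F0 where "F0 = {D'\<in>F. (\<forall>E\<in>F. subcube D' E \<longrightarrow> E = D') \<and> (\<forall>E\<in>C. \<not> subcube D' E)}"
  define R where "R = {E\<in>C. subcube E D \<and> (\<forall>D'\<in>F0. \<not> subcube E D')}"
  have Dd: "D \<in> dyadic_indices" using D by (simp add: light_cube_def)
  have cover: "U \<inter> open_cube D \<subseteq> (\<Union>E\<in>F0 \<union> R. half_open_cube E)"
  proof
    fix x assume x: "x \<in> U \<inter> open_cube D"
    then have xD: "x \<in> half_open_cube D" using open_cube_subset by blast
    then have unit: "\<forall>i. 0 \<le> x $ i \<and> x $ i < 1" using half_open_cube_unit[OF Dd] by blast
    obtain N where N: "\<And>E. N \<le> fst E \<Longrightarrow> x \<in> closed_cube E \<Longrightarrow> closed_cube E \<subseteq> U \<inter> open_cube D"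
      using small_closed_cube_inside_open[of "U \<inter> open_cube D" x] x \<open>open U\<close> open_open_cube by blast
    obtain m where m: "(max N (Suc (fst D)), m) \<in> dyadic_indices" "x \<in> half_open_cube (max N (Suc (fst D)), m)"
      using dyadic_cube_containing[OF unit] by blast
    have "\<exists>E\<in>F. x \<in> half_open_cube E"
    proof (intro bexI[of _ "(max N (Suc (fst D)), m)"])
      have "x \<in> closed_cube (max N (Suc (fst D)), m)" using m(2) half_open_cube_subset by blast
      then have "closed_cube (max N (Suc (fst D)), m) \<subseteq> U \<inter> open_cube D" by (intro N) auto
      then show "(max N (Suc (fst D)), m) \<in> F" using m(1) unfolding F_def by simp
    qed (rule m(2))
    then obtain E where E: "E \<in> F" "x \<in> half_open_cube E"
      and Emin: "\<And>E'. E' \<in> F \<Longrightarrow> x \<in> half_open_cube E' \<Longrightarrow> fst E \<le> fst E'"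
      using exists_least_iff[of "\<lambda>k. \<exists>E\<in>F. x \<in> half_open_cube E \<and> fst E = k"]
      by (metis linorder_le_less_linear)
    have E_max: "E' = E" if "E' \<in> F" "subcube E E'" for E'
    proof -
      have "x \<in> half_open_cube E'" using that(2) E(2) by (auto simp: subcube_def)
      then have "fst E \<le> fst E'" using Emin that(1) by blast
      then have "fst E' = fst E" using that(2) by (simp add: subcube_def)
      then show ?thesis using subcube_same_level[OF that(2)] by simp
    qed
    show "x \<in> (\<Union>E\<in>F0 \<union> R. half_open_cube E)"
    proof (cases "\<exists>E'\<in>C. subcube E E'")
      case False
      then have "E \<in> F0" using E(1) E_max unfolding F0_def by blast
      then show ?thesis using E(2) by blast
    next
      case True
      then obtain E' where E': "E' \<in> C" "subcube E E'" by blast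
      then have xE': "x \<in> half_open_cube E'" using E(2) by (auto simp: subcube_def)
      have "\<not> subcube D E'" using D E'(1) by (simp add: light_cube_def)
      then have "subcube E' D"
        using subcube_meet[OF xD xE'] subcube_meet[OF xE' xD] by linarith
      then have "E' \<in> R \<or> (\<exists>D'\<in>F0. subcube E' D')" using E'(1) unfolding R_def by blast
      then show ?thesis using xE' by (auto simp: subcube_def)
    qed
  qed
  have heavy: "ennreal (side_length D' powr t) \<le> cost t {E\<in>C. subcube E D'}" if "D' \<in> F0" for D'
  proof -
    have "D' \<in> dyadic_indices" "\<forall>E\<in>C. \<not> subcube D' E" "fst D < fst D'" "closed_cube D' \<subseteq> U \<inter> open_cube D"
      using that by (auto simp: F0_def F_def)
    then show ?thesis using none[of D'] unfolding light_cube_def by (meson not_le)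
  qed
  have F0_sub: "subcube D' D" if "D' \<in> F0" for D'
  proof -
    have "closed_cube D' \<subseteq> open_cube D" "fst D \<le> fst D'" using that by (auto simp: F0_def F_def)
    then show ?thesis using half_open_cube_subset open_cube_subset unfolding subcube_def by blast
  qed
  have F0_disj: "{E\<in>C. subcube E D1} \<inter> {E\<in>C. subcube E D2} = {}"
    if "D1 \<in> F0" "D2 \<in> F0" "D1 \<noteq> D2" for D1 D2
  proof (rule ccontr)
    assume "{E\<in>C. subcube E D1} \<inter> {E\<in>C. subcube E D2} \<noteq> {}"
    then obtain E where "subcube E D1" "subcube E D2" by blast
    then have "subcube D1 D2 \<or> subcube D2 D1" using subcube_comparable by (metis linear)
    then show False using that unfolding F0_def by blast
  qed
  have F0R: "F0 \<inter> R = {}" unfolding R_def using subcube_refl by blast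
  let ?CD = "{E\<in>C. subcube E D}"
  have F0_le: "cost t F0 \<le> cost t (?CD - R)"
  proof (rule infsum_ennreal_least)
    fix H assume H: "finite H" "H \<subseteq> F0"
    have "(\<Sum>D'\<in>H. ennreal (side_length D' powr t)) \<le> (\<Sum>D'\<in>H. cost t {E\<in>C. subcube E D'})"
      using H heavy by (intro sum_mono) blast
    also have "\<dots> \<le> cost t (?CD - R)"
    proof (rule infsum_ennreal_UN_disjoint_le)
      show "{E\<in>C. subcube E i} \<subseteq> ?CD - R" if "i \<in> H" for i
        using that H F0_sub subcube_trans unfolding R_def by blast
      show "{E\<in>C. subcube E i} \<inter> {E\<in>C. subcube E j} = {}" if "i \<in> H" "j \<in> H" "i \<noteq> j" for i j
        using that H by (intro F0_disj) auto
    qed (rule H(1))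
    finally show "(\<Sum>D'\<in>H. ennreal (side_length D' powr t)) \<le> cost t (?CD - R)" .
  qed
  have "cost t (F0 \<union> R) = cost t F0 + cost t R"
    using F0R by (intro infsum_Un_disjoint ennreal_summable_on)
  also have "\<dots> \<le> cost t (?CD - R) + cost t R"
    by (intro add_right_mono F0_le)
  also have "\<dots> = cost t ((?CD - R) \<union> R)"
    by (rule infsum_Un_disjoint[symmetric]) (auto intro: ennreal_summable_on)
  also have "(?CD - R) \<union> R = ?CD" unfolding R_def by blast
  also have "cost t ?CD < ennreal (side_length D powr t)"
    using D by (simp add: light_cube_def)
  finally have "cost t (F0 \<union> R) < ennreal (side_length D powr t)" .
  moreover have "F0 \<union> R \<subseteq> dyadic_indices" using C by (auto simp: F0_def F_def R_def)
  ultimately show False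
    using content_lower_boundD[OF low Dd _ cover] by (simp add: not_le)
qed

text \<open>If the cover were cheaper than \<open>D\<close>, then \<open>D\<close> would be light, and the preceding lemma, applied to
\<open>G 0\<close>, \<open>G 1\<close>, and so on, would give a decreasing sequence of light cubes whose closures lie in these open
sets. Their common point lies in the intersection and in \<open>D\<close>, hence in a cube of the cover; that cube
contains all sufficiently small cubes of the sequence, which contradicts their lightness.\<close>

theorem cost_ge_Inter_of_open:
  fixes G :: "nat \<Rightarrow> (real^'n) set" and t :: real
  assumes t: "0 < t" "t < CARD('n)" and c: "0 < c"
    and open_G: "\<And>j. open (G j)" and low: "\<And>j. content_lower_bound t (G j) c"
    and D: "D \<in> dyadic_indices" and C: "C \<subseteq> dyadic_indices"
    and cover: "(\<Inter>j. G j) \<inter> half_open_cube D \<subseteq> (\<Union>E\<in>C. half_open_cube E)"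
  shows "ennreal (side_length D powr t) \<le> cost t C"
proof (rule ccontr)
  assume "\<not> ?thesis"
  then have small: "cost t C < ennreal (side_length D powr t)" by simp
  have "cost t {E\<in>C. subcube E D} \<le> cost t C" by (intro infsum_ennreal_mono_set) auto
  moreover have "\<not> subcube D E" if "E \<in> C" for E
    using cost_ge_larger_cube[of E C D t] that t(1) small by (auto simp: subcube_def)
  ultimately have light_D: "light_cube t C D"
    using D small by (simp add: light_cube_def)
  have low1: "content_lower_bound t (G j) 1" for j
    using content_lower_bound_improve[OF t c low] .
  have "\<exists>D'. light_cube t C D' \<and> fst E < fst D' \<and> closed_cube D' \<subseteq> G j \<inter> open_cube E" if "light_cube t C E" for E j
    using light_subcube_exists[OF low1 open_G C that] by metis
  then obtain next_cube where next_cube: "\<And>E j. light_cube t C E \<Longrightarrow> light_cube t C (next_cube E j) \<and>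
      fst E < fst (next_cube E j) \<and> closed_cube (next_cube E j) \<subseteq> G j \<inter> open_cube E"
    by metis
  define Q where "Q = rec_nat D (\<lambda>j E. next_cube E j)"
  have Q0: "Q 0 = D" and QSuc: "Q (Suc j) = next_cube (Q j) j" for j by (simp_all add: Q_def)
  have light: "light_cube t C (Q j)" for j
    by (induction j) (use light_D next_cube in \<open>auto simp: Q0 QSuc\<close>)
  have level: "fst (Q j) < fst (Q (Suc j))" and inside: "closed_cube (Q (Suc j)) \<subseteq> G j \<inter> open_cube (Q j)" for j
    using next_cube[OF light, of j j] by (auto simp: QSuc)
  have nested: "closed_cube (Q (Suc j)) \<subseteq> closed_cube (Q j)" for j
    using inside[of j] open_cube_subset half_open_cube_subset by blast
  have "closed_cube E \<noteq> {}" for E :: "nat \<times> ('n \<Rightarrow> nat)"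
    using subcube_nonempty half_open_cube_subset by blast
  moreover have "closed_cube (Q n) \<subseteq> closed_cube (Q m)" if "m \<le> n" for m n
    using that nested by (rule lift_Suc_antimono_le[of "\<lambda>j. closed_cube (Q j)", rotated])
  ultimately have "(\<Inter>j. closed_cube (Q j)) \<noteq> {}"
    by (intro compact_nest compact_closed_cube)
  then obtain x where x: "\<And>j. x \<in> closed_cube (Q j)" by auto
  have xG: "x \<in> G j" and xQ: "x \<in> half_open_cube (Q j)" for j
    using x[of "Suc j"] inside[of j] open_cube_subset by blast+
  have "x \<in> (\<Inter>j. G j) \<inter> half_open_cube D" using xG xQ[of 0] Q0 by auto
  then obtain E where E: "E \<in> C" "x \<in> half_open_cube E" using cover by blast
  have "j \<le> fst (Q j)" for j
  proof (induction j)
    case (Suc j)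
    then show ?case using level[of j] by linarith
  qed simp
  then have "subcube (Q (fst E)) E" using subcube_meet[OF E(2) xQ] by blast
  then show False using light E(1) by (auto simp: light_cube_def)
qed

section \<open>Integer points in boxes along the eigendirections\<close>

definition integer_points :: "(real^'n) set" where
  "integer_points = {x. \<forall>i. x $ i \<in> \<int>}"

text \<open>The two real eigenvalues enter through trace and determinant of the integer matrix only.\<close>

locale hyperbolic_matrix =
  fixes A :: "int^2^2" and \<mu> \<nu> :: real
  assumes trace: "\<mu> + \<nu> = real_of_int (A $ 1 $ 1 + A $ 2 $ 2)"
    and determinant: "\<mu> * \<nu> = real_of_int (A $ 1 $ 1 * A $ 2 $ 2 - A $ 1 $ 2 * A $ 2 $ 1)"
    and contracting: "\<mu> \<noteq> 0" "\<bar>\<mu>\<bar> < 1" and expanding: "1 < \<bar>\<nu>\<bar>"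
begin

text \<open>The linear forms \<open>u\<close> and \<open>v\<close> are left eigenvectors of the matrix for \<open>\<mu>\<close> and \<open>\<nu>\<close>. Used as
coordinates of the plane, they turn the matrix into a diagonal one: \<open>u\<close> is the coordinate that is
contracted, \<open>v\<close> the one that is expanded.\<close>

definition u :: "real^2 \<Rightarrow> real" where
  "u x = real_of_int (A $ 2 $ 1) * x $ 1 + (\<mu> - real_of_int (A $ 1 $ 1)) * x $ 2"

definition v :: "real^2 \<Rightarrow> real" where
  "v x = real_of_int (A $ 2 $ 1) * x $ 1 + (\<nu> - real_of_int (A $ 1 $ 1)) * x $ 2"

abbreviation A_real :: "real^2 \<Rightarrow> real^2" where
  "A_real x \<equiv> map_matrix real_of_int A *v x"

lemma u_diff: "u (x - y) = u x - u y" and v_diff: "v (x - y) = v x - v y"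
  and u_add: "u (x + y) = u x + u y" and v_add: "v (x + y) = v x + v y"
  and u_scale: "u (r *\<^sub>R x) = r * u x" and v_scale: "v (r *\<^sub>R x) = r * v x"
  by (simp_all add: u_def v_def algebra_simps)

lemma eigenvalue_quadratic:
  "\<mu> * \<mu> = real_of_int (A $ 1 $ 1 + A $ 2 $ 2) * \<mu> - real_of_int (A $ 1 $ 1 * A $ 2 $ 2 - A $ 1 $ 2 * A $ 2 $ 1)"
  "\<nu> * \<nu> = real_of_int (A $ 1 $ 1 + A $ 2 $ 2) * \<nu> - real_of_int (A $ 1 $ 1 * A $ 2 $ 2 - A $ 1 $ 2 * A $ 2 $ 1)"
  unfolding trace[symmetric] determinant[symmetric] by (simp_all add: algebra_simps)

lemma u_A: "u (A_real x) = \<mu> * u x"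
proof -
  have "u (A_real x) - \<mu> * u x = (real_of_int (A $ 1 $ 1 + A $ 2 $ 2) * \<mu>
      - real_of_int (A $ 1 $ 1 * A $ 2 $ 2 - A $ 1 $ 2 * A $ 2 $ 1) - \<mu> * \<mu>) * x $ 2"
    by (simp add: u_def matrix_vector_mult_def sum_2 algebra_simps)
  then show ?thesis using eigenvalue_quadratic(1) by simp
qed

lemma v_A: "v (A_real x) = \<nu> * v x"
proof -
  have "v (A_real x) - \<nu> * v x = (real_of_int (A $ 1 $ 1 + A $ 2 $ 2) * \<nu>
      - real_of_int (A $ 1 $ 1 * A $ 2 $ 2 - A $ 1 $ 2 * A $ 2 $ 1) - \<nu> * \<nu>) * x $ 2"
    by (simp add: v_def matrix_vector_mult_def sum_2 algebra_simps)
  then show ?thesis using eigenvalue_quadratic(2) by simp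
qed

lemma u_A_power: "u ((A_real ^^ n) x) = \<mu> ^ n * u x" and v_A_power: "v ((A_real ^^ n) x) = \<nu> ^ n * v x"
  by (induction n) (simp_all add: u_A v_A)

lemma det_ge_1: "1 \<le> \<bar>\<mu> * \<nu>\<bar>"
proof -
  have "\<mu> * \<nu> \<noteq> 0" using contracting expanding by auto
  then have "A $ 1 $ 1 * A $ 2 $ 2 - A $ 1 $ 2 * A $ 2 $ 1 \<noteq> 0" unfolding determinant of_int_eq_0_iff .
  then show ?thesis unfolding determinant by linarith
qed

text \<open>A rational eigenvalue of an integer matrix is an integer, but no integer has absolute value strictly
between \<open>0\<close> and \<open>1\<close>.\<close>

lemma eigenvalues_irrational: "\<mu> \<notin> \<rat>" "\<nu> \<notin> \<rat>"
proof -
  show mu: "\<mu> \<notin> \<rat>"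
  proof
    assume "\<mu> \<in> \<rat>"
    then obtain p q :: int where q: "q > 0" and cop: "coprime p q" and mu: "\<mu> = of_int p / of_int q"
      by (auto elim: Rats_cases')
    let ?t = "A $ 1 $ 1 + A $ 2 $ 2" and ?d = "A $ 1 $ 1 * A $ 2 $ 2 - A $ 1 $ 2 * A $ 2 $ 1"
    have "(of_int p / of_int q) * (of_int p / of_int q) = real_of_int ?t * (of_int p / of_int q) - real_of_int ?d"
      using eigenvalue_quadratic(1) unfolding mu .
    then have "real_of_int (p * p) = real_of_int (q * (?t * p - ?d * q))"
      using q by (simp add: field_simps)
    then have "p * p = q * (?t * p - ?d * q)" by linarith
    then have "q dvd p * p" by simp
    moreover have "coprime q (p * p)" using cop by (simp add: ac_simps)
    ultimately have "q dvd 1" by (meson coprime_common_divisor dvd_refl)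
    then have "\<mu> = of_int p" using q mu by simp
    then have "p \<noteq> 0" "\<bar>real_of_int p\<bar> < 1" using contracting by auto
    then show False by linarith
  qed
  show "\<nu> \<notin> \<rat>"
  proof
    assume "\<nu> \<in> \<rat>"
    moreover have "\<mu> = real_of_int (A $ 1 $ 1 + A $ 2 $ 2) - \<nu>" using trace by linarith
    ultimately show False using mu by simp
  qed
qed

lemma lower_left_nonzero: "A $ 2 $ 1 \<noteq> 0"
proof
  assume "A $ 2 $ 1 = 0"
  then have "(\<mu> - real_of_int (A $ 1 $ 1)) * (\<mu> - real_of_int (A $ 2 $ 2)) = 0"
    using eigenvalue_quadratic(1) by (simp add: algebra_simps)
  then have "\<mu> = real_of_int (A $ 1 $ 1) \<or> \<mu> = real_of_int (A $ 2 $ 2)" by auto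
  then show False using eigenvalues_irrational(1) Rats_of_int by metis
qed

lemma forms_nonzero:
  assumes k: "k \<in> integer_points" "k \<noteq> 0"
  shows "u k \<noteq> 0" "v k \<noteq> 0"
proof -
  have int: "k $ 1 \<in> \<int>" "k $ 2 \<in> \<int>" using k by (auto simp: integer_points_def)
  have *: "real_of_int (A $ 2 $ 1) * k $ 1 + (e - real_of_int (A $ 1 $ 1)) * k $ 2 \<noteq> 0" if e: "e \<notin> \<rat>" for e
  proof
    assume 0: "real_of_int (A $ 2 $ 1) * k $ 1 + (e - real_of_int (A $ 1 $ 1)) * k $ 2 = 0"
    show False
    proof (cases "k $ 2 = 0")
      case True
      then have "k $ 1 = 0" using 0 lower_left_nonzero by simp
      then show False using k(2) True by (simp add: vec_eq_iff forall_2)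
    next
      case False
      then have "e = real_of_int (A $ 1 $ 1) - real_of_int (A $ 2 $ 1) * k $ 1 / k $ 2"
        using 0 by (simp add: field_simps)
      moreover have "\<dots> \<in> \<rat>" using int by (auto elim!: Ints_cases)
      ultimately show False using e by simp
    qed
  qed
  show "u k \<noteq> 0" "v k \<noteq> 0" using *[OF eigenvalues_irrational(1)] *[OF eigenvalues_irrational(2)]
    by (auto simp: u_def v_def)
qed

text \<open>The product of the two forms is a quadratic form with integer coefficients, since its coefficients are
symmetric in the eigenvalues; it vanishes at no other integer point than \<open>0\<close> by irrationality. In other words, the
eigendirections are badly approximable, which makes the integer points evenly spread at every aspect
ratio along these directions.\<close>

lemma form_product_ge_1:
  assumes k: "k \<in> integer_points" "k \<noteq> 0"
  shows "1 \<le> \<bar>u k\<bar> * \<bar>v k\<bar>"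
proof -
  obtain p q where pq: "k $ 1 = real_of_int p" "k $ 2 = real_of_int q"
    using k(1) unfolding integer_points_def by (metis Ints_cases mem_Collect_eq)
  let ?a = "A $ 1 $ 1" and ?b = "A $ 1 $ 2" and ?c = "A $ 2 $ 1" and ?d = "A $ 2 $ 2"
  have "u k * v k = (?c * p) * (?c * p) + (\<mu> + \<nu> - 2 * ?a) * (?c * p) * q
      + (\<mu> * \<nu> - ?a * (\<mu> + \<nu>) + ?a * ?a) * (q * q)"
    unfolding u_def v_def pq by (simp add: algebra_simps)
  also have "\<dots> = real_of_int ((?c * p) * (?c * p) + (?d - ?a) * (?c * p) * q - ?b * ?c * (q * q))"
    unfolding trace determinant by (simp add: algebra_simps)
  finally obtain m where m: "u k * v k = real_of_int m" by blast
  moreover have "u k * v k \<noteq> 0" using forms_nonzero[OF k] by simp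
  ultimately have "m \<noteq> 0" by simp
  then have "1 \<le> \<bar>real_of_int m\<bar>" by linarith
  then show ?thesis by (simp add: m flip: abs_mult)
qed

text \<open>A common bound for the norms of \<open>u\<close> and \<open>v\<close> with respect to the maximum norm.\<close>

definition K :: real where
  "K = 1 + \<bar>real_of_int (A $ 2 $ 1)\<bar> + \<bar>\<mu> - real_of_int (A $ 1 $ 1)\<bar> + \<bar>\<nu> - real_of_int (A $ 1 $ 1)\<bar>"

lemma K_ge_1: "1 \<le> K" by (simp add: K_def)

lemma forms_le:
  assumes "\<And>i. \<bar>x $ i\<bar> \<le> e"
  shows "\<bar>u x\<bar> \<le> K * e" "\<bar>v x\<bar> \<le> K * e"
proof -
  have e: "0 \<le> e" using assms[of 1] by linarith
  have "\<bar>real_of_int (A $ 2 $ 1) * x $ 1 + g * x $ 2\<bar> \<le> (\<bar>real_of_int (A $ 2 $ 1)\<bar> + \<bar>g\<bar>) * e" for g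
  proof -
    have "\<bar>real_of_int (A $ 2 $ 1) * x $ 1 + g * x $ 2\<bar> \<le> \<bar>real_of_int (A $ 2 $ 1)\<bar> * \<bar>x $ 1\<bar> + \<bar>g\<bar> * \<bar>x $ 2\<bar>"
      by (metis abs_mult abs_triangle_ineq)
    also have "\<dots> \<le> \<bar>real_of_int (A $ 2 $ 1)\<bar> * e + \<bar>g\<bar> * e"
      by (intro add_mono mult_left_mono assms) auto
    finally show ?thesis by (simp add: algebra_simps)
  qed
  moreover have "(\<bar>real_of_int (A $ 2 $ 1)\<bar> + \<bar>\<mu> - real_of_int (A $ 1 $ 1)\<bar>) * e \<le> K * e"
      "(\<bar>real_of_int (A $ 2 $ 1)\<bar> + \<bar>\<nu> - real_of_int (A $ 1 $ 1)\<bar>) * e \<le> K * e"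
    using e by (auto intro!: mult_right_mono simp: K_def)
  ultimately show "\<bar>u x\<bar> \<le> K * e" "\<bar>v x\<bar> \<le> K * e"
    unfolding u_def v_def by (meson order_trans)+
qed

lemma eigenvalues_distinct: "\<nu> - \<mu> \<noteq> 0"
  using contracting expanding by auto

lemma coordinates_from_forms:
  "x $ 2 = (v x - u x) / (\<nu> - \<mu>)"
  "x $ 1 = (u x - (\<mu> - real_of_int (A $ 1 $ 1)) * x $ 2) / real_of_int (A $ 2 $ 1)"
proof -
  have "v x - u x = (\<nu> - \<mu>) * x $ 2" by (simp add: u_def v_def algebra_simps)
  then show "x $ 2 = (v x - u x) / (\<nu> - \<mu>)" using eigenvalues_distinct by simp
  show "x $ 1 = (u x - (\<mu> - real_of_int (A $ 1 $ 1)) * x $ 2) / real_of_int (A $ 2 $ 1)"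
    using lower_left_nonzero by (simp add: u_def)
qed

lemma forms_surjective: "\<exists>x. u x = p \<and> v x = q"
proof
  let ?y = "(q - p) / (\<nu> - \<mu>)"
  let ?x = "vector [(p - (\<mu> - real_of_int (A $ 1 $ 1)) * ?y) / real_of_int (A $ 2 $ 1), ?y] :: real^2"
  have c: "real_of_int (A $ 2 $ 1) \<noteq> 0" using lower_left_nonzero by simp
  have u: "u ?x = p" using c by (simp add: u_def)
  have "v z - u z = (\<nu> - \<mu>) * z $ 2" for z by (simp add: u_def v_def algebra_simps)
  from this[of ?x] have "v ?x - u ?x = (\<nu> - \<mu>) * ?y" by simp
  then have "v ?x = q" using u eigenvalues_distinct by simp
  then show "u ?x = p \<and> v ?x = q" using u by simp
qed

lemma coordinates_le_forms:
  obtains L where "1 \<le> L" "\<And>x e i. \<bar>u x\<bar> \<le> e \<Longrightarrow> \<bar>v x\<bar> \<le> e \<Longrightarrow> \<bar>x $ i\<bar> \<le> L * e"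
proof -
  define L2 where "L2 = 2 / \<bar>\<nu> - \<mu>\<bar>"
  define L1 where "L1 = (1 + \<bar>\<mu> - real_of_int (A $ 1 $ 1)\<bar> * L2) / \<bar>real_of_int (A $ 2 $ 1)\<bar>"
  have L2: "0 \<le> L2" by (simp add: L2_def)
  have L1: "0 \<le> L1" using L2 by (simp add: L1_def)
  show thesis
  proof (rule that[of "1 + L1 + L2"])
    show "1 \<le> 1 + L1 + L2" using L1 L2 by simp
    fix x e and i :: 2 assume *: "\<bar>u x\<bar> \<le> e" "\<bar>v x\<bar> \<le> e"
    then have e: "0 \<le> e" by linarith
    have "\<bar>x $ 2\<bar> = \<bar>v x - u x\<bar> / \<bar>\<nu> - \<mu>\<bar>" by (subst coordinates_from_forms(1)) (simp add: abs_divide)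
    also have "\<dots> \<le> (2 * e) / \<bar>\<nu> - \<mu>\<bar>" using * by (intro divide_right_mono) auto
    finally have x2: "\<bar>x $ 2\<bar> \<le> L2 * e" by (simp add: L2_def)
    have "\<bar>x $ 1\<bar> = \<bar>u x - (\<mu> - real_of_int (A $ 1 $ 1)) * x $ 2\<bar> / \<bar>real_of_int (A $ 2 $ 1)\<bar>"
      by (subst coordinates_from_forms(2)) (simp add: abs_divide)
    also have "\<dots> \<le> (e + \<bar>\<mu> - real_of_int (A $ 1 $ 1)\<bar> * (L2 * e)) / \<bar>real_of_int (A $ 2 $ 1)\<bar>"
    proof (intro divide_right_mono)
      have "\<bar>u x - (\<mu> - real_of_int (A $ 1 $ 1)) * x $ 2\<bar> \<le> \<bar>u x\<bar> + \<bar>\<mu> - real_of_int (A $ 1 $ 1)\<bar> * \<bar>x $ 2\<bar>"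
        by (metis abs_mult abs_triangle_ineq4)
      also have "\<dots> \<le> e + \<bar>\<mu> - real_of_int (A $ 1 $ 1)\<bar> * (L2 * e)"
        using * x2 by (intro add_mono mult_left_mono) auto
      finally show "\<bar>u x - (\<mu> - real_of_int (A $ 1 $ 1)) * x $ 2\<bar> \<le> \<dots>" .
    qed simp
    finally have x1: "\<bar>x $ 1\<bar> \<le> L1 * e" by (simp add: L1_def algebra_simps)
    have "L1 * e \<le> (1 + L1 + L2) * e" "L2 * e \<le> (1 + L1 + L2) * e"
      using L1 L2 e by (auto intro!: mult_right_mono)
    then show "\<bar>x $ i\<bar> \<le> (1 + L1 + L2) * e"
      using x1 x2 exhaust_2[of i] by (meson order_trans)
  qed
qed


definition lattice_box :: "real \<Rightarrow> real \<Rightarrow> real \<Rightarrow> real \<Rightarrow> (real^2) set" where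
  "lattice_box p U q V = {k \<in> integer_points. \<bar>u k - p\<bar> \<le> U \<and> \<bar>v k - q\<bar> \<le> V}"

lemma integer_points_diff: "x \<in> integer_points \<Longrightarrow> y \<in> integer_points \<Longrightarrow> x - y \<in> integer_points"
  by (auto simp: integer_points_def)

text \<open>Cut the box into slightly more than \<open>4 * U * V\<close> congruent boxes of the same shape. Two integer points in one of
them would differ by a vector on which the product of the forms is below \<open>1\<close>.\<close>

lemma lattice_box_finite_card:
  fixes U V :: real
  assumes U: "0 < U" and V: "0 < V"
  shows "finite (lattice_box p U q V)" "real (card (lattice_box p U q V)) \<le> 18 * (1 + U * V)"
proof -
  define s where "s = sqrt (U * V)"
  have s: "0 < s" "s * s = U * V" using U V by (auto simp: s_def)
  \<comment> \<open>the cells have sides \<open>2 * U / m\<close> and \<open>2 * V / m\<close>; their product is below \<open>1\<close> as \<open>2 * s < m\<close>\<close>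
  define m where "m = nat \<lfloor>2 * s\<rfloor> + 1"
  have m: "2 * s < real m" "real m \<le> 2 * s + 1" using s by (auto simp: m_def) linarith+
  define g where "g k = (nat \<lfloor>(u k - p + U) * m / (2 * U)\<rfloor>, nat \<lfloor>(v k - q + V) * m / (2 * V)\<rfloor>)" for k
  let ?S = "lattice_box p U q V"
  have cell: "0 \<le> (w - c + W) * m / (2 * W)" "(w - c + W) * m / (2 * W) \<le> m" if "\<bar>w - c\<bar> \<le> W" "0 < W" for w c W :: real
  proof -
    have "0 \<le> w - c + W" "w - c + W \<le> 2 * W" using that by auto
    then have "0 \<le> (w - c + W) * m" "(w - c + W) * m \<le> 2 * W * m" by (auto intro: mult_right_mono)
    then show "0 \<le> (w - c + W) * m / (2 * W)" "(w - c + W) * m / (2 * W) \<le> m"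
      using that(2) by (auto simp: pos_divide_le_eq mult.commute)
  qed
  have close: "\<bar>w - w'\<bar> < 2 * W / m"
    if eq: "nat \<lfloor>(w - c + W) * m / (2 * W)\<rfloor> = nat \<lfloor>(w' - c + W) * m / (2 * W)\<rfloor>"
      and le: "\<bar>w - c\<bar> \<le> W" "\<bar>w' - c\<bar> \<le> W" "0 < W" for w w' c W :: real
  proof -
    have "\<lfloor>(w - c + W) * m / (2 * W)\<rfloor> = \<lfloor>(w' - c + W) * m / (2 * W)\<rfloor>"
      using eq cell(1)[OF le(1,3)] cell(1)[OF le(2,3)] by (simp add: eq_nat_nat_iff)
    then have "\<bar>(w - c + W) * m / (2 * W) - (w' - c + W) * m / (2 * W)\<bar> < 1" by linarith
    also have "(w - c + W) * m / (2 * W) - (w' - c + W) * m / (2 * W) = (w - w') * (m / (2 * W))"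
      by (simp add: algebra_simps flip: diff_divide_distrib)
    finally have "\<bar>w - w'\<bar> * (m / (2 * W)) < 1" using le(3) by (simp add: abs_mult)
    then show ?thesis using le(3) m s by (simp add: field_simps)
  qed
  have inj: "inj_on g ?S"
  proof (rule inj_onI)
    fix k k' assume k: "k \<in> ?S" "k' \<in> ?S" "g k = g k'"
    then have "\<bar>u k - u k'\<bar> < 2 * U / m" "\<bar>v k - v k'\<bar> < 2 * V / m"
      using close[of "u k" p U "u k'"] close[of "v k" q V "v k'"] U V by (auto simp: g_def lattice_box_def)
    then have "\<bar>u (k - k')\<bar> * \<bar>v (k - k')\<bar> < (2 * U / m) * (2 * V / m)"
      unfolding u_diff v_diff by (intro mult_strict_mono') auto
    also have "\<dots> = (2 * s) * (2 * s) / (real m * real m)" using s by simp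
    also have "\<dots> < 1"
    proof -
      have "(2 * s) * (2 * s) < real m * real m" using m s by (intro mult_strict_mono) auto
      moreover have "0 < real m" using m s by linarith
      ultimately show ?thesis by simp
    qed
    finally have "k - k' = 0"
      using form_product_ge_1[of "k - k'"] k integer_points_diff by (fastforce simp: lattice_box_def)
    then show "k = k'" by simp
  qed
  have img: "g ` ?S \<subseteq> {..m} \<times> {..m}"
    using cell U V by (fastforce simp: g_def lattice_box_def le_floor_iff nat_le_iff floor_le_iff)
  show fin: "finite ?S" using inj_on_finite[OF inj img] by simp
  have "card ?S \<le> card ({..m} \<times> {..m})" by (rule card_inj_on_le[OF inj img]) simp
  then have "card ?S \<le> (m + 1) * (m + 1)" by (simp add: card_cartesian_product)
  then have "real (card ?S) \<le> real ((m + 1) * (m + 1))" by (rule of_nat_mono)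
  also have "\<dots> = (real m + 1) * (real m + 1)" by (simp add: algebra_simps)
  also have "\<dots> \<le> (2 * s + 2) * (2 * s + 2)" using m s by (intro mult_mono) auto
  also have "\<dots> \<le> 18 * (1 + s * s)"
    using sum_squares_ge_zero[of "s - 1" 0] s by (simp add: algebra_simps)
  finally show "card ?S \<le> 18 * (1 + U * V)" using s by simp
qed

text \<open>Dirichlet's approximation theorem for the slope of the line \<open>u = 0\<close>.\<close>

lemma short_lattice_vector:
  obtains C where "1 \<le> C"
    "\<And>e. 0 < e \<Longrightarrow> e \<le> 1 \<Longrightarrow> \<exists>w\<in>integer_points. w \<noteq> 0 \<and> \<bar>u w\<bar> \<le> e \<and> \<bar>v w\<bar> \<le> C / e"
proof -
  let ?c = "real_of_int (A $ 2 $ 1)"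
  have c: "1 \<le> \<bar>?c\<bar>" using lower_left_nonzero by linarith
  define C where "C = 1 + \<bar>\<nu> - \<mu>\<bar> * (\<bar>?c\<bar> + 1)"
  show thesis
  proof (rule that[of C])
    show "1 \<le> C" by (simp add: C_def)
    fix e :: real assume e: "0 < e" "e \<le> 1"
    define N where "N = nat \<lceil>\<bar>?c\<bar> / e\<rceil>"
    have pos: "0 < \<bar>?c\<bar> / e" using c e by simp
    have N: "\<bar>?c\<bar> / e \<le> N" "N \<le> \<bar>?c\<bar> / e + 1" using pos by (auto simp: N_def)
    have N0: "N > 0" using N pos by linarith
    obtain h k where k: "0 < k" "k \<le> int N"
      and approx: "\<bar>of_int k * ((\<mu> - real_of_int (A $ 1 $ 1)) / ?c) - of_int h\<bar> < 1 / N"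
      using Dirichlet_approx[OF N0] by blast
    let ?w = "vector [- of_int h, of_int k] :: real^2"
    have "u ?w = ?c * (of_int k * ((\<mu> - real_of_int (A $ 1 $ 1)) / ?c) - of_int h)"
      using c by (auto simp: u_def field_simps)
    then have "\<bar>u ?w\<bar> \<le> \<bar>?c\<bar> * (1 / N)"
      using mult_left_mono[OF less_imp_le[OF approx], of "\<bar>?c\<bar>"] by (simp only: abs_mult abs_ge_zero)
    also have "\<dots> \<le> e" using N N0 e by (simp add: field_simps)
    finally have uw: "\<bar>u ?w\<bar> \<le> e" .
    have "v z = u z + (\<nu> - \<mu>) * z $ 2" for z by (simp add: u_def v_def algebra_simps)
    from this[of ?w] have "\<bar>v ?w\<bar> \<le> \<bar>u ?w\<bar> + \<bar>\<nu> - \<mu>\<bar> * \<bar>of_int k\<bar>"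
      using abs_triangle_ineq[of "u ?w" "(\<nu> - \<mu>) * of_int k"] by (simp add: abs_mult)
    also have "\<dots> \<le> 1 + \<bar>\<nu> - \<mu>\<bar> * (\<bar>?c\<bar> / e + 1)"
      using uw e N k by (intro add_mono mult_left_mono) auto
    also have "\<dots> \<le> 1 / e + \<bar>\<nu> - \<mu>\<bar> * (\<bar>?c\<bar> / e + 1 / e)"
      using e by (intro add_mono mult_left_mono) auto
    also have "\<dots> = C / e" by (simp add: C_def add_divide_distrib algebra_simps)
    finally have vw: "\<bar>v ?w\<bar> \<le> C / e" .
    have "?w $ 2 \<noteq> 0" using k by simp
    then have "?w \<noteq> 0" by (metis zero_index)
    moreover have "?w \<in> integer_points" by (auto simp: integer_points_def forall_2)
    ultimately show "\<exists>w\<in>integer_points. w \<noteq> 0 \<and> \<bar>u w\<bar> \<le> e \<and> \<bar>v w\<bar> \<le> C / e"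
      using uw vw by blast
  qed
qed

text \<open>Take a vector \<open>w\<close> with \<open>\<bar>u w\<bar> \<le> U\<close> and \<open>\<bar>v w\<bar> \<le> B / U\<close> and a vector \<open>w'\<close> with the much stronger bound
\<open>\<bar>u w'\<bar> \<le> U / (2 * B)\<close>. They cannot be parallel: otherwise \<open>\<bar>u w * v w'\<bar> = \<bar>u w' * v w\<bar> \<le> 1/2\<close>, and then the product of
the forms would be below \<open>1\<close> in modulus at one of them. So they span a lattice, and rounding the coordinates of any point
with respect to this basis moves it by at most half the sum of the two vectors.\<close>

lemma lattice_point_in_box:
  obtains C where "1 \<le> C"
    "\<And>U p q. 0 < U \<Longrightarrow> U \<le> 1 \<Longrightarrow> lattice_box p U q (C / U) \<noteq> {}"
proof -
  obtain B where B: "1 \<le> B"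
    "\<And>e. 0 < e \<Longrightarrow> e \<le> 1 \<Longrightarrow> \<exists>w\<in>integer_points. w \<noteq> 0 \<and> \<bar>u w\<bar> \<le> e \<and> \<bar>v w\<bar> \<le> B / e"
    by (rule short_lattice_vector) blast
  show thesis
  proof (rule that[of "2 * B\<^sup>2"])
    have "1 \<le> B\<^sup>2" using B(1) by (simp add: one_le_power)
    then show "1 \<le> 2 * B\<^sup>2" by simp
  next
    fix U p q :: real assume U: "0 < U" "U \<le> 1"
    obtain w where w: "w \<in> integer_points" "w \<noteq> 0" "\<bar>u w\<bar> \<le> U" "\<bar>v w\<bar> \<le> B / U"
      using B(2)[OF U] by blast
    have "U / (2 * B) \<le> U / 1" using U B(1) by (intro divide_left_mono) auto
    then have "U / (2 * B) \<le> 1" "0 < U / (2 * B)" using U B(1) by auto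
    then obtain w' where w': "w' \<in> integer_points" "w' \<noteq> 0" "\<bar>u w'\<bar> \<le> U / (2 * B)"
      "\<bar>v w'\<bar> \<le> B / (U / (2 * B))" using B(2)[of "U / (2 * B)"] by blast
    have vw': "\<bar>v w'\<bar> \<le> 2 * B\<^sup>2 / U" using w'(4) by (simp add: power2_eq_square ac_simps)
    have uw': "\<bar>u w'\<bar> \<le> U" using w'(3) \<open>U / (2 * B) \<le> U / 1\<close> by simp
    have "B / U \<le> 2 * B\<^sup>2 / U"
    proof (intro divide_right_mono)
      have "B * 1 \<le> B * B" using B(1) by (intro mult_left_mono) auto
      then show "B \<le> 2 * B\<^sup>2" using B(1) by (simp add: power2_eq_square)
    qed (use U in simp)
    then have vw: "\<bar>v w\<bar> \<le> 2 * B\<^sup>2 / U" using w(4) by linarith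
    define \<Delta> where "\<Delta> = u w * v w' - u w' * v w"
    have "\<Delta> \<noteq> 0"
    proof
      assume "\<Delta> = 0"
      then have eq: "\<bar>u w\<bar> * \<bar>v w'\<bar> = \<bar>u w'\<bar> * \<bar>v w\<bar>" by (simp add: \<Delta>_def flip: abs_mult)
      have "1 * 1 \<le> (\<bar>u w\<bar> * \<bar>v w\<bar>) * (\<bar>u w'\<bar> * \<bar>v w'\<bar>)"
        using form_product_ge_1 w w' by (intro mult_mono) auto
      also have "\<dots> = (\<bar>u w'\<bar> * \<bar>v w\<bar>) * (\<bar>u w\<bar> * \<bar>v w'\<bar>)" by simp
      also have "\<dots> = (\<bar>u w'\<bar> * \<bar>v w\<bar>) * (\<bar>u w'\<bar> * \<bar>v w\<bar>)" using eq by simp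
      also have "\<dots> \<le> (1/2) * (1/2)"
      proof -
        have "\<bar>u w'\<bar> * \<bar>v w\<bar> \<le> (U / (2 * B)) * (B / U)" using w(4) w'(3) U B(1) by (intro mult_mono) auto
        also have "\<dots> = 1/2" using U B(1) by simp
        finally show ?thesis by (intro mult_mono) auto
      qed
      finally show False by simp
    qed
    define s where "s = (p * v w' - q * u w') / \<Delta>"
    define t where "t = (q * u w - p * v w) / \<Delta>"
    have st: "s * u w + t * u w' = p" "s * v w + t * v w' = q"
    proof -
      have "s * u w + t * u w' = (p * \<Delta>) / \<Delta>" "s * v w + t * v w' = (q * \<Delta>) / \<Delta>"
        unfolding s_def t_def times_divide_eq_left add_divide_distrib[symmetric] by (simp_all add: \<Delta>_def algebra_simps)
      then show "s * u w + t * u w' = p" "s * v w + t * v w' = q" using \<open>\<Delta> \<noteq> 0\<close> by simp_all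
    qed
    let ?k = "of_int (round s) *\<^sub>R w + of_int (round t) *\<^sub>R w'"
    have round: "\<bar>of_int (round r) - r\<bar> \<le> 1/2" for r :: real by (rule of_int_round_abs_le)
    have near: "\<bar>of_int (round s) * a + of_int (round t) * b - (s * a + t * b)\<bar> \<le> M"
      if "\<bar>a\<bar> \<le> M" "\<bar>b\<bar> \<le> M" for a b M
    proof -
      have "of_int (round s) * a + of_int (round t) * b - (s * a + t * b)
         = (of_int (round s) - s) * a + (of_int (round t) - t) * b" by (simp add: algebra_simps)
      moreover have "\<bar>(of_int (round s) - s) * a\<bar> \<le> 1/2 * M" "\<bar>(of_int (round t) - t) * b\<bar> \<le> 1/2 * M"
        unfolding abs_mult using mult_mono[OF round that(1)] mult_mono[OF round that(2)] by auto
      ultimately show ?thesis by linarith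
    qed
    have "\<bar>u ?k - p\<bar> \<le> U" using near[OF w(3) uw'] unfolding st(1) u_add u_scale .
    moreover have "\<bar>v ?k - q\<bar> \<le> 2 * B\<^sup>2 / U" using near[OF vw vw'] unfolding st(2) v_add v_scale .
    moreover have "?k \<in> integer_points" using w(1) w'(1) by (auto simp: integer_points_def)
    ultimately show "lattice_box p U q (2 * B\<^sup>2 / U) \<noteq> {}" unfolding lattice_box_def by blast
  qed
qed

text \<open>A box that is long in the \<open>v\<close>-direction contains about \<open>U * V / C\<close> disjoint boxes with the proportions of the
preceding lemma, stacked in that direction.\<close>

lemma lattice_box_card_lower:
  obtains C where "1 \<le> C"
    "\<And>U V p q. 0 < U \<Longrightarrow> U \<le> 1 \<Longrightarrow> C \<le> U * V \<Longrightarrow> U * V \<le> C * card (lattice_box p U q V)"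
proof -
  obtain B where B: "1 \<le> B" "\<And>U p q. 0 < U \<Longrightarrow> U \<le> 1 \<Longrightarrow> lattice_box p U q (B / U) \<noteq> {}"
    by (rule lattice_point_in_box) blast
  show thesis
  proof (rule that[of "6 * B"])
    show "1 \<le> 6 * B" using B by simp
    fix U V p q :: real assume U: "0 < U" "U \<le> 1" and UV: "6 * B \<le> U * V"
    define h where "h = B / U"
    have h: "0 < h" using B U by (simp add: h_def)
    have V: "6 * h \<le> V" using UV U by (simp add: h_def field_simps)
    \<comment> \<open>centres at distance \<open>3 * h\<close> keep closed boxes of half height \<open>h\<close> disjoint\<close>
    define m where "m = nat \<lfloor>V / (3 * h)\<rfloor>"
    have "2 \<le> V / (3 * h)" using V h by (simp add: field_simps)
    then have m: "real m \<le> V / (3 * h)" "V / (6 * h) \<le> m" unfolding m_def by (simp, linarith)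
    have mh: "3 * real m * h \<le> V" using m(1) h by (simp add: field_simps)
    have "\<forall>j. \<exists>k. k \<in> lattice_box p U (q + 3 * real j * h) h" using B(2)[OF U] unfolding h_def by blast
    then obtain k where k: "\<And>j. k j \<in> lattice_box p U (q + 3 * real j * h) h" by metis
    have "inj_on k {..<m}"
    proof (rule inj_onI)
      fix i j assume "k i = k j"
      then have "\<bar>v (k i) - (q + 3 * real i * h)\<bar> \<le> h" "\<bar>v (k i) - (q + 3 * real j * h)\<bar> \<le> h"
        using k[of i] k[of j] by (auto simp: lattice_box_def)
      then have "\<bar>(3 * real i * h) - (3 * real j * h)\<bar> \<le> 2 * h" by linarith
      moreover have "(3 * real i * h) - (3 * real j * h) = (3 * (real i - real j)) * h" by (simp add: algebra_simps)
      ultimately have "\<bar>3 * (real i - real j)\<bar> * h \<le> 2 * h" using h by (simp add: abs_mult)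
      then have "\<bar>3 * (real i - real j)\<bar> \<le> 2" using h by simp
      then have "3 * (real i - real j) < 3" "- 3 < 3 * (real i - real j)" unfolding abs_le_iff by linarith+
      then have "real i < real (Suc j)" "real j < real (Suc i)" by auto
      then show "i = j" by linarith
    qed
    moreover have "k ` {..<m} \<subseteq> lattice_box p U q V"
    proof clarify
      fix j assume "j < m"
      then have "(real j + 1) * h \<le> real m * h" using h by (intro mult_right_mono) auto
      then have "3 * real j * h + 3 * h \<le> V" using mh by (simp add: algebra_simps)
      moreover have "0 \<le> 3 * real j * h" using h by simp
      moreover have "\<bar>v (k j) - (q + 3 * real j * h)\<bar> \<le> h" using k[of j] by (simp add: lattice_box_def)
      ultimately have "\<bar>v (k j) - q\<bar> \<le> V" using h by linarith
      then show "k j \<in> lattice_box p U q V" using k[of j] by (simp add: lattice_box_def)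
    qed
    moreover have "0 < V" using V h by linarith
    ultimately have "m \<le> card (lattice_box p U q V)"
      using lattice_box_finite_card(1)[OF U(1), of V p q] card_inj_on_le[of k "{..<m}"] by simp
    then have "V / (6 * h) \<le> card (lattice_box p U q V)" using m(2) by linarith
    then show "U * V \<le> 6 * B * card (lattice_box p U q V)"
      using B(1) U by (simp add: h_def field_simps)
  qed
qed

end

section \<open>The cost of covering thickened lattice points\<close>

abbreviation rectangle :: "real \<Rightarrow> real \<Rightarrow> real \<Rightarrow> real \<Rightarrow> (real \<times> real) set" where
  "rectangle p U q V \<equiv> {p - U..p + U} \<times> {q - V..q + V}"

text \<open>If the centres of two intervals are no further apart than the larger of the two radii, then the overlap
is at least as long as half the shorter interval.\<close>

lemma interval_overlap:
  fixes x y \<alpha> \<beta> :: real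
  assumes "\<bar>x - y\<bar> \<le> max \<alpha> \<beta>" "0 \<le> \<alpha>" "0 \<le> \<beta>"
  shows "\<exists>s. {s..s + min \<alpha> \<beta>} \<subseteq> {x - \<alpha>..x + \<alpha>} \<inter> {y - \<beta>..y + \<beta>}"
proof (cases "\<alpha> \<le> \<beta>")
  case True
  then show ?thesis using assms
    by (intro exI[of _ "if y \<le> x then x - \<alpha> else x"]) (auto simp: abs_le_iff)
next
  case False
  then show ?thesis using assms
    by (intro exI[of _ "if x \<le> y then y - \<beta> else y"]) (auto simp: abs_le_iff)
qed

lemma emeasure_box_Int_le:
  fixes s s' \<alpha> \<beta> p U q V :: real
  assumes "0 \<le> \<alpha>" "0 \<le> \<beta>" "0 \<le> U" "0 \<le> V"
  shows "emeasure (lborel \<Otimes>\<^sub>M lborel) (({s..s + \<alpha>} \<times> {s'..s' + \<beta>}) \<inter> rectangle p U q V)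
    \<le> ennreal (min \<alpha> (2 * U) * min \<beta> (2 * V))"
proof -
  have one: "emeasure lborel ({s..s + a} \<inter> {p - W..p + W}) \<le> ennreal (min a (2 * W))"
    if "0 \<le> a" "0 \<le> W" for s a p W :: real
  proof -
    have "emeasure lborel ({s..s + a} \<inter> {p - W..p + W}) \<le> emeasure lborel {s..s + a}"
      "emeasure lborel ({s..s + a} \<inter> {p - W..p + W}) \<le> emeasure lborel {p - W..p + W}"
      by (auto intro!: emeasure_mono)
    then show ?thesis using that by (auto simp: min_def)
  qed
  have "emeasure (lborel \<Otimes>\<^sub>M lborel) (({s..s + \<alpha>} \<times> {s'..s' + \<beta>}) \<inter> rectangle p U q V)
    = emeasure lborel ({s..s + \<alpha>} \<inter> {p - U..p + U}) * emeasure lborel ({s'..s' + \<beta>} \<inter> {q - V..q + V})"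
    by (simp add: Times_Int_Times lborel.emeasure_pair_measure_Times)
  also have "\<dots> \<le> ennreal (min \<alpha> (2 * U)) * ennreal (min \<beta> (2 * V))"
    using assms by (intro mult_mono one) auto
  finally show ?thesis using assms by (simp add: ennreal_mult)
qed

lemma count_times_overlap_le:
  fixes r g h :: real
  assumes "0 < r" "0 < g" "0 < h"
  shows "(18 * (1 + (g + r) * (h + r))) * (min r (2 * g) * min r (2 * h))
    \<le> 288 * (min g r * min h r + g * h * r\<^sup>2)"
proof -
  have one: "min r (2 * a) \<le> 2 * min a r" "(a + r) * min a r \<le> 2 * (a * r)" if "0 < a" for a
    using that assms by (auto simp: min_def algebra_simps)
  have "(18 * (1 + (g + r) * (h + r))) * (min r (2 * g) * min r (2 * h))
    \<le> (18 * (1 + (g + r) * (h + r))) * ((2 * min g r) * (2 * min h r))"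
    using assms one by (intro mult_left_mono mult_mono) auto
  also have "\<dots> = 72 * (min g r * min h r + ((g + r) * min g r) * ((h + r) * min h r))"
    by (simp add: algebra_simps)
  also have "\<dots> \<le> 72 * (min g r * min h r + (2 * (g * r)) * (2 * (h * r)))"
  proof -
    have "((g + r) * min g r) * ((h + r) * min h r) \<le> (2 * (g * r)) * (2 * (h * r))"
      using assms by (intro mult_mono[OF one(2) one(2)]) auto
    then show ?thesis by (rule mult_left_mono[OF add_left_mono]) simp
  qed
  also have "\<dots> \<le> 288 * (min g r * min h r + g * h * r\<^sup>2)"
    using assms by (simp add: power2_eq_square algebra_simps)
  finally show ?thesis .
qed

context hyperbolic_matrix
begin

text \<open>Let rectangles with side ratio \<open>a : b\<close> cover all points of a fixed rectangle of that shape that are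
within \<open>r\<close>, in both coordinates, of a translate of the integer points. Choose for each nearby integer point a box of sides
\<open>min r (\<delta> * a)\<close> and \<open>r\<close> inside the covered set. There are at least about
\<open>max r (\<delta> * a) * (\<delta> * b)\<close> such boxes, so their areas add up to a multiple of \<open>\<delta>\<^sup>2 * a * b * r\<^sup>2\<close>.
A rectangle of the cover meets a number of boxes that is controlled by the upper count for integer points, and
meets each of them in a set of area at most \<open>4 * min (\<rho> * a) r * min (\<rho> * b) r\<close>. Adding up the areas box by box, and not
the area of their union, avoids any discussion of overlaps.\<close>

lemma mass_estimate:
  obtains c C0 where "0 < c" "1 \<le> C0"
    "\<And>r \<delta> a b p q p' q' \<rho> P R (I :: 'i::countable set).
      0 < r \<Longrightarrow> 0 < \<delta> \<Longrightarrow> 0 < a \<Longrightarrow> 0 < b \<Longrightarrow> max r (\<delta> * a) \<le> 1 \<Longrightarrow> r \<le> \<delta> * b \<Longrightarrow>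
      C0 \<le> max r (\<delta> * a) * (\<delta> * b) \<Longrightarrow> (\<And>i. i \<in> I \<Longrightarrow> 0 < \<rho> i) \<Longrightarrow>
      {w. \<exists>k\<in>integer_points. w \<in> rectangle (p + u k) r (q + v k) r} \<inter> rectangle p' (\<delta> * a) q' (\<delta> * b)
        \<subseteq> (\<Union>i\<in>I. rectangle (P i) (\<rho> i * a) (R i) (\<rho> i * b)) \<Longrightarrow>
      ennreal (c * \<delta>\<^sup>2 * (a * b * r\<^sup>2)) \<le>
        infsum (\<lambda>i. ennreal (min (\<rho> i * a) r * min (\<rho> i * b) r + (\<rho> i)\<^sup>2 * (a * b * r\<^sup>2))) I"
proof -
  obtain C0 where C0: "1 \<le> C0"
    "\<And>U V p q. 0 < U \<Longrightarrow> U \<le> 1 \<Longrightarrow> C0 \<le> U * V \<Longrightarrow> U * V \<le> C0 * card (lattice_box p U q V)"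
    by (rule lattice_box_card_lower) blast
  let ?c = "1 / (288 * C0)"
  show thesis
  proof (rule that[of ?c C0])
    show "0 < ?c" "1 \<le> C0" using C0(1) by auto
    fix r \<delta> a b p q p' q' :: real and \<rho> P R and I :: "'i::countable set"
    assume r: "0 < r" and \<delta>: "0 < \<delta>" and a: "0 < a" and b: "0 < b" and U1: "max r (\<delta> * a) \<le> 1"
      and rb: "r \<le> \<delta> * b" and UV: "C0 \<le> max r (\<delta> * a) * (\<delta> * b)"
      and \<rho>: "\<And>i. i \<in> I \<Longrightarrow> 0 < \<rho> i"
      and cover: "{w. \<exists>k\<in>integer_points. w \<in> rectangle (p + u k) r (q + v k) r} \<inter> rectangle p' (\<delta> * a) q' (\<delta> * b)
        \<subseteq> (\<Union>i\<in>I. rectangle (P i) (\<rho> i * a) (R i) (\<rho> i * b))"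
    let ?M = "lborel \<Otimes>\<^sub>M lborel :: (real \<times> real) measure"
    define U where "U = max r (\<delta> * a)"
    define V where "V = \<delta> * b"
    define \<alpha> where "\<alpha> = min r (\<delta> * a)"
    have pos: "0 < U" "0 < V" "0 < \<alpha>" using r \<delta> a b by (auto simp: U_def V_def \<alpha>_def less_max_iff_disj)
    have \<alpha>U: "\<alpha> * U = r * (\<delta> * a)" by (auto simp: \<alpha>_def U_def min_def max_def)
    have \<alpha>r: "\<alpha> \<le> r" by (simp add: \<alpha>_def)
    define J where "J = lattice_box (p' - p) U (q' - q) V"
    have J: "finite J" using lattice_box_finite_card(1)[OF pos(1,2)] by (simp add: J_def)
    have card_J: "U * V \<le> C0 * card J"
      unfolding J_def using C0(2)[OF pos(1)] U1 UV by (simp add: U_def V_def)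
    have "\<forall>k\<in>J. \<exists>s. {s..s + \<alpha>} \<subseteq> {p + u k - r..p + u k + r} \<inter> {p' - \<delta> * a..p' + \<delta> * a}"
    proof
      fix k assume "k \<in> J"
      then have "\<bar>p + u k - p'\<bar> \<le> max r (\<delta> * a)" by (auto simp: J_def lattice_box_def U_def algebra_simps)
      then show "\<exists>s. {s..s + \<alpha>} \<subseteq> {p + u k - r..p + u k + r} \<inter> {p' - \<delta> * a..p' + \<delta> * a}"
        unfolding \<alpha>_def using r \<delta> a by (intro interval_overlap) auto
    qed
    then obtain s where s: "\<And>k. k \<in> J \<Longrightarrow> {s k..s k + \<alpha>} \<subseteq> {p + u k - r..p + u k + r} \<inter> {p' - \<delta> * a..p' + \<delta> * a}"
      by metis
    have "\<forall>k\<in>J. \<exists>s. {s..s + r} \<subseteq> {q + v k - r..q + v k + r} \<inter> {q' - V..q' + V}"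
    proof
      fix k assume "k \<in> J"
      then have "\<bar>q + v k - q'\<bar> \<le> max r V" by (auto simp: J_def lattice_box_def algebra_simps)
      moreover have "min r V = r" using rb by (simp add: V_def)
      ultimately show "\<exists>s. {s..s + r} \<subseteq> {q + v k - r..q + v k + r} \<inter> {q' - V..q' + V}"
        using interval_overlap[of "q + v k" q' r V] r pos by simp
    qed
    then obtain s' where s': "\<And>k. k \<in> J \<Longrightarrow> {s' k..s' k + r} \<subseteq> {q + v k - r..q + v k + r} \<inter> {q' - V..q' + V}"
      by metis
    define S where "S k = {s k..s k + \<alpha>} \<times> {s' k..s' k + r}" for k
    define B where "B i = rectangle (P i) (\<rho> i * a) (R i) (\<rho> i * b)" for i
    have J_int: "J \<subseteq> integer_points" by (auto simp: J_def lattice_box_def)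
    have S_cover: "S k \<subseteq> (\<Union>i\<in>I. B i)" if "k \<in> J" for k
    proof -
      have "S k \<subseteq> rectangle (p + u k) r (q + v k) r" "S k \<subseteq> rectangle p' (\<delta> * a) q' (\<delta> * b)"
        unfolding S_def using s[OF that] s'[OF that] by (auto simp: V_def)
      then show ?thesis using cover J_int that unfolding B_def by blast
    qed
    have S_area: "emeasure ?M (S k) = ennreal (\<alpha> * r)" for k
      using pos r by (simp add: S_def lborel.emeasure_pair_measure_Times ennreal_mult)
    have "ennreal (card J * (\<alpha> * r)) = (\<Sum>k\<in>J. emeasure ?M (S k))"
      using pos r by (simp add: S_area ennreal_mult ennreal_of_nat_eq_real_of_nat)
    also have "\<dots> \<le> (\<Sum>k\<in>J. infsum (\<lambda>i. emeasure ?M (S k \<inter> B i)) I)"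
      using S_cover by (intro sum_mono emeasure_le_infsum_Int) (auto simp: S_def B_def)
    also have "\<dots> = infsum (\<lambda>i. \<Sum>k\<in>J. emeasure ?M (S k \<inter> B i)) I"
      by (rule infsum_ennreal_finite_swap[OF J])
    also have "\<dots> \<le> infsum (\<lambda>i. ennreal 288 * ennreal (min (\<rho> i * a) r * min (\<rho> i * b) r + (\<rho> i)\<^sup>2 * (a * b * r\<^sup>2))) I"
    proof (intro infsum_mono ennreal_summable_on)
      fix i assume i: "i \<in> I"
      define g where "g = \<rho> i * a"
      define h where "h = \<rho> i * b"
      have gh: "0 < g" "0 < h" using \<rho>[OF i] a b by (auto simp: g_def h_def)
      define H where "H = {k\<in>J. S k \<inter> B i \<noteq> {}}"
      have H_sub: "H \<subseteq> lattice_box (P i - p) (g + r) (R i - q) (h + r)"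
      proof
        fix k assume "k \<in> H"
        then have k: "k \<in> J" and ne: "S k \<inter> B i \<noteq> {}" by (auto simp: H_def)
        from ne obtain w w' where w: "(w, w') \<in> S k" "(w, w') \<in> B i" by auto
        then have "w \<in> {s k..s k + \<alpha>}" "w' \<in> {s' k..s' k + r}" by (auto simp: S_def)
        then have "w \<in> {p + u k - r..p + u k + r}" "w' \<in> {q + v k - r..q + v k + r}"
          using s[OF k] s'[OF k] by blast+
        moreover have "w \<in> {P i - g..P i + g}" "w' \<in> {R i - h..R i + h}"
          using w(2) by (auto simp: B_def g_def h_def)
        ultimately show "k \<in> lattice_box (P i - p) (g + r) (R i - q) (h + r)"
          using k J_int by (auto simp: lattice_box_def abs_le_iff)
      qed
      have "real (card H) \<le> real (card (lattice_box (P i - p) (g + r) (R i - q) (h + r)))"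
        using H_sub gh r by (intro of_nat_mono card_mono lattice_box_finite_card(1)) auto
      also have "\<dots> \<le> 18 * (1 + (g + r) * (h + r))"
        using gh r by (intro lattice_box_finite_card(2)) auto
      finally have card_H: "real (card H) \<le> 18 * (1 + (g + r) * (h + r))" .
      have "(\<Sum>k\<in>J. emeasure ?M (S k \<inter> B i)) = (\<Sum>k\<in>H. emeasure ?M (S k \<inter> B i))"
        using J by (intro sum.mono_neutral_right) (auto simp: H_def)
      also have "\<dots> \<le> (\<Sum>k\<in>H. ennreal (min r (2 * g) * min r (2 * h)))"
      proof (intro sum_mono)
        fix k
        have "emeasure ?M (S k \<inter> B i) \<le> ennreal (min \<alpha> (2 * g) * min r (2 * h))"
          unfolding S_def B_def g_def[symmetric] h_def[symmetric]
          using pos r gh by (intro emeasure_box_Int_le) auto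
        also have "\<dots> \<le> ennreal (min r (2 * g) * min r (2 * h))"
          using \<alpha>r r gh by (intro ennreal_leI mult_right_mono) auto
        finally show "emeasure ?M (S k \<inter> B i) \<le> ennreal (min r (2 * g) * min r (2 * h))" .
      qed
      also have "\<dots> = ennreal (card H * (min r (2 * g) * min r (2 * h)))"
        using r gh by (simp add: ennreal_mult ennreal_of_nat_eq_real_of_nat)
      also have "\<dots> \<le> ennreal ((18 * (1 + (g + r) * (h + r))) * (min r (2 * g) * min r (2 * h)))"
        using card_H r gh by (intro ennreal_leI mult_right_mono) auto
      also have "\<dots> \<le> ennreal (288 * (min g r * min h r + g * h * r\<^sup>2))"
        using r gh by (intro ennreal_leI count_times_overlap_le)
      also have "g * h * r\<^sup>2 = (\<rho> i)\<^sup>2 * (a * b * r\<^sup>2)"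
        by (simp add: g_def h_def power2_eq_square)
      also have "ennreal (288 * (min g r * min h r + (\<rho> i)\<^sup>2 * (a * b * r\<^sup>2)))
          = ennreal 288 * ennreal (min g r * min h r + (\<rho> i)\<^sup>2 * (a * b * r\<^sup>2))"
        using r gh a b by (intro ennreal_mult) auto
      finally show "(\<Sum>k\<in>J. emeasure ?M (S k \<inter> B i))
        \<le> ennreal 288 * ennreal (min (\<rho> i * a) r * min (\<rho> i * b) r + (\<rho> i)\<^sup>2 * (a * b * r\<^sup>2))"
        unfolding g_def h_def .
    qed
    also have "\<dots> = ennreal 288 * infsum (\<lambda>i. ennreal (min (\<rho> i * a) r * min (\<rho> i * b) r + (\<rho> i)\<^sup>2 * (a * b * r\<^sup>2))) I"
      by (rule infsum_ennreal_cmult)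
    finally have main: "ennreal (card J * (\<alpha> * r)) \<le> ennreal 288 * infsum (\<lambda>i. ennreal (min (\<rho> i * a) r * min (\<rho> i * b) r + (\<rho> i)\<^sup>2 * (a * b * r\<^sup>2))) I" .
    have "?c * \<delta>\<^sup>2 * (a * b * r\<^sup>2) = (1 / 288) * ((U * V / C0) * (\<alpha> * r))"
    proof -
      have "(U * V / C0) * (\<alpha> * r) = (\<alpha> * U) * V * r / C0" by (simp add: ac_simps)
      also have "\<dots> = r * (\<delta> * a) * (\<delta> * b) * r / C0" unfolding \<alpha>U V_def by simp
      finally have "(U * V / C0) * (\<alpha> * r) = r * (\<delta> * a) * (\<delta> * b) * r / C0" .
      then show ?thesis by (simp only:) (simp add: power2_eq_square)
    qed
    also have "\<dots> \<le> (1 / 288) * (card J * (\<alpha> * r))"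
      using card_J C0(1) pos r by (intro mult_left_mono mult_right_mono) (auto simp: field_simps)
    finally have "ennreal (?c * \<delta>\<^sup>2 * (a * b * r\<^sup>2)) \<le> ennreal (1 / 288) * ennreal (card J * (\<alpha> * r))"
      using pos r by (simp add: ennreal_leI flip: ennreal_mult)
    also have "\<dots> \<le> ennreal (1 / 288) * (ennreal 288 * infsum (\<lambda>i. ennreal (min (\<rho> i * a) r * min (\<rho> i * b) r + (\<rho> i)\<^sup>2 * (a * b * r\<^sup>2))) I)"
      using main by (intro mult_left_mono) auto
    also have "\<dots> = infsum (\<lambda>i. ennreal (min (\<rho> i * a) r * min (\<rho> i * b) r + (\<rho> i)\<^sup>2 * (a * b * r\<^sup>2))) I"
      by (subst mult.assoc[symmetric], subst ennreal_mult[symmetric]) auto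
    finally show "ennreal (?c * \<delta>\<^sup>2 * (a * b * r\<^sup>2)) \<le>
        infsum (\<lambda>i. ennreal (min (\<rho> i * a) r * min (\<rho> i * b) r + (\<rho> i)\<^sup>2 * (a * b * r\<^sup>2))) I" .
  qed
qed

end

section \<open>Lifting from the torus to Euclidean space\<close>

lemma dist_to_torus_le: "dist (to_torus x) (to_torus y) \<le> dist x y"
  unfolding dist_torus_def by (rule setdist_le_dist) simp_all

lemma dist_torus_lift:
  assumes "dist (to_torus a) q < e"
  obtains y where "to_torus y = q" "dist a y < e"
proof -
  have "to_torus -` {to_torus a} \<noteq> {}" "to_torus -` {q} \<noteq> {}"
    using to_torus_surj[of q] by auto
  then obtain x y where xy: "x \<in> to_torus -` {to_torus a}" "y \<in> to_torus -` {q}" "dist x y < e"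
    using assms setdist_ltE[of "to_torus -` {to_torus a}" "to_torus -` {q}" e]
    unfolding dist_torus_def by blast
  have "lattice_rel a x" using xy(1) by (simp flip: to_torus_eq_iff)
  then have "to_torus (a + (y - x)) = to_torus y"
    by (simp add: to_torus_eq_iff lattice_rel_def)
  moreover have "dist a (a + (y - x)) = dist x y"
    by (simp add: dist_norm norm_minus_commute)
  ultimately show thesis using that[of "a + (y - x)"] xy by simp
qed

text \<open>The metric on the torus induces the quotient topology.\<close>

lemma open_torus_iff: "open U \<longleftrightarrow> open (to_torus -` U)"
proof
  assume "open U"
  have "continuous_on UNIV (to_torus :: real^'a \<Rightarrow> _)"
    unfolding continuous_on_iff using dist_to_torus_le by (metis order_le_less_trans)
  then show "open (to_torus -` U)" using \<open>open U\<close> by (simp add: open_vimage)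
next
  assume *: "open (to_torus -` U)"
  show "open U"
    unfolding open_dist
  proof
    fix p assume "p \<in> U"
    obtain a where a: "to_torus a = p" using to_torus_surj by blast
    then obtain e where e: "0 < e" "\<And>y. dist y a < e \<Longrightarrow> y \<in> to_torus -` U"
      using * \<open>p \<in> U\<close> unfolding open_dist by auto
    have "q \<in> U" if "dist q p < e" for q
    proof -
      have "dist (to_torus a) q < e" using that a by (simp add: dist_commute)
      then obtain y where "to_torus y = q" "dist a y < e" by (rule dist_torus_lift)
      then show ?thesis using e(2)[of y] by (auto simp: dist_commute)
    qed
    then show "\<exists>e>0. \<forall>q. dist q p < e \<longrightarrow> q \<in> U" using e(1) by blast
  qed
qed

lemma torus_map_to_torus: "torus_map A (to_torus x) = to_torus (map_matrix real_of_int A *v x)"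
  by (rule torus_map.abs_eq)

lemma torus_map_power_to_torus:
  "(torus_map A ^^ n) (to_torus x) = to_torus (((\<lambda>x. map_matrix real_of_int A *v x) ^^ n) x)"
  by (induction n) (simp_all add: torus_map_to_torus)

lemma unit_lift:
  obtains x where "to_torus x = p" "\<forall>i. 0 \<le> x $ i \<and> x $ i < 1"
proof -
  obtain y where y: "to_torus y = p" using to_torus_surj by blast
  have "lattice_rel (\<chi> i. frac (y $ i)) y"
    by (auto simp: lattice_rel_def frac_def)
  then have "to_torus (\<chi> i. frac (y $ i)) = p" using y by (simp flip: to_torus_eq_iff)
  then show thesis by (intro that) (auto simp: frac_lt_1)
qed

lemma to_torus_inj_unit:
  assumes "to_torus x = to_torus y" "\<forall>i. 0 \<le> x $ i \<and> x $ i < 1" "\<forall>i. 0 \<le> y $ i \<and> y $ i < 1"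
  shows "x = y"
proof -
  have "x $ i = y $ i" for i
  proof -
    have "x $ i - y $ i \<in> \<int>" using assms(1) by (auto simp: to_torus_eq_iff lattice_rel_def)
    moreover have "\<bar>x $ i - y $ i\<bar> < 1" using assms(2,3) by (smt (verit))
    ultimately show ?thesis using Ints_nonzero_abs_less1 by fastforce
  qed
  then show ?thesis by (simp add: vec_eq_iff)
qed

lemma dyadic_cube_eq: "dyadic_cube D = to_torus ` half_open_cube D"
  by (simp add: dyadic_cube_def half_open_cube_def split: prod.splits)

lemma to_torus_in_dyadic_cube_iff:
  assumes "D \<in> dyadic_indices" "\<forall>i. 0 \<le> x $ i \<and> x $ i < 1"
  shows "to_torus x \<in> dyadic_cube D \<longleftrightarrow> x \<in> half_open_cube D"
proof
  assume "to_torus x \<in> dyadic_cube D"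
  then obtain y where y: "y \<in> half_open_cube D" "to_torus x = to_torus y"
    unfolding dyadic_cube_eq by blast
  then have "x = y" using to_torus_inj_unit assms(2) half_open_cube_unit[OF assms(1)] by blast
  then show "x \<in> half_open_cube D" using y by simp
qed (simp add: dyadic_cube_eq)

section \<open>Preimages of the targets and their dyadic covers\<close>

text \<open>The left-hand side is at most each of \<open>\<rho>\<^sup>2 * a * b\<close>, \<open>\<rho> * a * r\<close> and \<open>r\<^sup>2\<close>. A weighted geometric mean of the
first two, respectively of the last two, has exactly the power \<open>\<rho> powr t\<close>.\<close>

lemma min_product_le:
  fixes \<rho> a b r t :: real
  assumes "0 < \<rho>" "0 < a" "0 < b" "0 < r" "0 < t" "t < 2"
  shows "1 \<le> t \<Longrightarrow> min (\<rho> * a) r * min (\<rho> * b) r \<le> \<rho> powr t * (a * b powr (t - 1) * r powr (2 - t))"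
    and "t \<le> 1 \<Longrightarrow> min (\<rho> * a) r * min (\<rho> * b) r \<le> \<rho> powr t * (a powr t * r powr (2 - t))"
proof -
  define L where "L = min (\<rho> * a) r * min (\<rho> * b) r"
  have L: "0 < L" using assms by (simp add: L_def)
  have x: "L \<le> \<rho> * a * (\<rho> * b)" and y: "L \<le> \<rho> * a * r" and z: "L \<le> r * r"
    unfolding L_def using assms by (auto intro!: mult_mono)
  have split: "L = L powr \<theta> * L powr (1 - \<theta>)" for \<theta>
    using L by (simp flip: powr_add)
  { assume t: "1 \<le> t"
    have "L = L powr (t - 1) * L powr (2 - t)" using split[of "t - 1"] by simp
    also have "\<dots> \<le> (\<rho> * a * (\<rho> * b)) powr (t - 1) * (\<rho> * a * r) powr (2 - t)"
      using x y L t assms by (intro mult_mono powr_mono2) auto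
    also have "\<dots> = (\<rho> powr (t - 1) * \<rho> powr (t - 1) * \<rho> powr (2 - t)) * ((a powr (t - 1) * a powr (2 - t)) * b powr (t - 1) * r powr (2 - t))"
      using assms by (simp add: powr_mult)
    also have "\<dots> = \<rho> powr t * (a * b powr (t - 1) * r powr (2 - t))"
      using assms by (simp flip: powr_add)
    finally show "min (\<rho> * a) r * min (\<rho> * b) r \<le> \<rho> powr t * (a * b powr (t - 1) * r powr (2 - t))"
      unfolding L_def . }
  { assume t: "t \<le> 1"
    have "L = L powr t * L powr (1 - t)" by (rule split)
    also have "\<dots> \<le> (\<rho> * a * r) powr t * (r * r) powr (1 - t)"
      using y z L t assms by (intro mult_mono powr_mono2) auto
    also have "\<dots> = \<rho> powr t * (a powr t * (r powr t * r powr (1 - t) * r powr (1 - t)))"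
      using assms by (simp add: powr_mult)
    also have "r powr t * r powr (1 - t) * r powr (1 - t) = r powr (2 - t)"
      by (simp only: powr_add[symmetric]) simp
    finally show "min (\<rho> * a) r * min (\<rho> * b) r \<le> \<rho> powr t * (a powr t * r powr (2 - t))"
      unfolding L_def . }
qed

text \<open>The shrinking target problem in the eigencoordinates; \<open>l1\<close> and \<open>l2\<close> are the Lyapunov exponents.\<close>

locale shrinking_target = hyperbolic_matrix A \<mu> \<nu>
  for A :: "int^2^2" and \<mu> \<nu> :: real +
  fixes z :: "nat \<Rightarrow> 2 torus" and \<tau> l1 l2 :: real
  assumes l1: "l1 = ln \<bar>\<mu>\<bar>" and l2: "l2 = ln \<bar>\<nu>\<bar>" and \<tau>_pos: "0 < \<tau>" and \<tau>_ne: "\<tau> \<noteq> - l1"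
begin

lemma l1_neg: "l1 < 0" and l2_pos: "0 < l2" and l_sum: "0 \<le> l1 + l2"
proof -
  show "l1 < 0" "0 < l2" using contracting expanding by (auto simp: l1 l2 ln_less_zero_iff)
  have "l1 + l2 = ln \<bar>\<mu> * \<nu>\<bar>" using contracting expanding by (simp add: l1 l2 ln_mult abs_mult)
  then show "0 \<le> l1 + l2" using det_ge_1 by simp
qed

lemma abs_eigenvalue_power: "\<bar>\<mu>\<bar> ^ n = exp (real n * l1)" "\<bar>\<nu>\<bar> ^ n = exp (real n * l2)"
  using contracting expanding by (auto simp: l1 l2 exp_of_nat_mult)

text \<open>The radius of the \<open>n\<close>-th target, and the factors by which the \<open>n\<close>-th power of the matrix
scales the coordinates \<open>u\<close> and \<open>v\<close>. The preimage of a target under that power consists of pieces with half axes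
of the order \<open>r n / a n\<close> and \<open>r n / b n\<close>.\<close>

definition r :: "nat \<Rightarrow> real" where "r n = exp (- real n * \<tau>)"
definition a :: "nat \<Rightarrow> real" where "a n = exp (real n * l1)"
definition b :: "nat \<Rightarrow> real" where "b n = exp (real n * l2)"

lemma rab_pos: "0 < r n" "0 < a n" "0 < b n"
  and r_le_1: "r n \<le> 1" and a_le_1: "a n \<le> 1" and b_ge_1: "1 \<le> b n" and ab_ge_1: "1 \<le> a n * b n"
proof -
  show "0 < r n" "0 < a n" "0 < b n" "r n \<le> 1" "a n \<le> 1" "1 \<le> b n"
    using \<tau>_pos l1_neg l2_pos by (auto simp: r_def a_def b_def mult_nonneg_nonpos)
  have "a n * b n = exp (real n * (l1 + l2))" by (simp add: a_def b_def algebra_simps flip: exp_add)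
  then show "1 \<le> a n * b n" using l_sum by simp
qed

abbreviation s :: real where "s \<equiv> shrinking_target_dim l1 l2 \<tau>"

lemma s_le: "s \<le> 2 * l2 / (\<tau> + l2)" and s_lt_2: "s < 2"
proof -
  show 1: "s \<le> 2 * l2 / (\<tau> + l2)" by (simp add: shrinking_target_dim_def)
  have "2 * l2 / (\<tau> + l2) < 2" using \<tau>_pos l2_pos by (simp add: field_simps)
  then show "s < 2" using 1 by linarith
qed

text \<open>This is where the dimension formula comes from. Relative to the normalising area \<open>a n * b n * (r n)\<^sup>2\<close>, the
left-hand side measures how much of one piece of the preimage of the \<open>n\<close>-th target fits into a cube of side \<open>\<rho>\<close>. It is at most
\<open>\<rho> powr t\<close> times an exponentially small factor: for \<open>t \<ge> 1\<close> this needs \<open>t * (\<tau> + l2) < 2 * l2\<close>,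
for \<open>t < 1\<close> it needs \<open>t * (\<tau> + l1) < l1 + l2\<close>.\<close>

lemma decay:
  assumes t: "0 < t" "t < s"
  obtains \<eta> where "0 < \<eta>" "\<And>n \<rho>. 0 < \<rho> \<Longrightarrow>
    min (\<rho> * a n) (r n) * min (\<rho> * b n) (r n) \<le> exp (- \<eta>) ^ n * (a n * b n * (r n)\<^sup>2) * \<rho> powr t"
proof (cases "1 \<le> t")
  case True
  define \<eta> where "\<eta> = 2 * l2 - t * (\<tau> + l2)"
  have "t < 2 * l2 / (\<tau> + l2)" using t s_le by linarith
  then have "0 < \<eta>" using \<tau>_pos l2_pos by (simp add: \<eta>_def field_simps)
  moreover have "min (\<rho> * a n) (r n) * min (\<rho> * b n) (r n) \<le> exp (- \<eta>) ^ n * (a n * b n * (r n)\<^sup>2) * \<rho> powr t"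
    if "0 < \<rho>" for n \<rho>
  proof -
    have "a n * b n powr (t - 1) * r n powr (2 - t) = exp (- \<eta>) ^ n * (a n * b n * (r n)\<^sup>2)"
      by (simp add: a_def b_def r_def \<eta>_def powr_def power2_eq_square algebra_simps flip: exp_add exp_of_nat_mult)
    moreover have "min (\<rho> * a n) (r n) * min (\<rho> * b n) (r n) \<le> \<rho> powr t * (a n * b n powr (t - 1) * r n powr (2 - t))"
      using that rab_pos t s_lt_2 True by (intro min_product_le(1)) auto
    ultimately show ?thesis by (simp only: mult.commute)
  qed
  ultimately show thesis by (rule that)
next
  case False
  define \<eta> where "\<eta> = l1 + l2 - t * (\<tau> + l1)"
  have "0 < \<eta>"
  proof (cases "\<tau> < - l1")
    case True
    then have "t * (\<tau> + l1) < 0" using t by (simp add: mult_pos_neg)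
    then show ?thesis using l_sum by (simp add: \<eta>_def)
  next
    case False
    then have "0 < \<tau> + l1" using \<tau>_ne by simp
    moreover have "t < (l1 + l2) / (\<tau> + l1)" using t False by (simp add: shrinking_target_dim_def)
    ultimately show ?thesis by (simp add: \<eta>_def field_simps)
  qed
  moreover have "min (\<rho> * a n) (r n) * min (\<rho> * b n) (r n) \<le> exp (- \<eta>) ^ n * (a n * b n * (r n)\<^sup>2) * \<rho> powr t"
    if "0 < \<rho>" for n \<rho>
  proof -
    have "a n powr t * r n powr (2 - t) = exp (- \<eta>) ^ n * (a n * b n * (r n)\<^sup>2)"
      by (simp add: a_def b_def r_def \<eta>_def powr_def power2_eq_square algebra_simps flip: exp_add exp_of_nat_mult)
    moreover have "min (\<rho> * a n) (r n) * min (\<rho> * b n) (r n) \<le> \<rho> powr t * (a n powr t * r n powr (2 - t))"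
      using that rab_pos t s_lt_2 False by (intro min_product_le(2)) auto
    ultimately show ?thesis by (simp only: mult.commute)
  qed
  ultimately show thesis by (rule that)
qed

definition hit :: "nat \<Rightarrow> (real^2) set" where
  "hit n = {x. (torus_map A ^^ n) (to_torus x) \<in> ball (z n) (r n)}"

lemma open_hit: "open (hit n)"
proof -
  have "continuous_on UNIV ((A_real ^^ n) :: real^2 \<Rightarrow> real^2)"
  proof (induction n)
    case (Suc n)
    have "continuous_on UNIV (\<lambda>x. A_real ((A_real ^^ n) x))"
      using Suc by (intro continuous_on_compose2[OF matrix_vector_mult_linear_continuous_on[of UNIV]]) auto
    then show ?case by (simp add: o_def)
  qed (simp add: continuous_on_id id_def)
  moreover have "open (to_torus -` ball (z n) (r n))" by (simp flip: open_torus_iff)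
  moreover have "hit n = (A_real ^^ n) -` (to_torus -` ball (z n) (r n))"
    by (auto simp: hit_def torus_map_power_to_torus)
  ultimately show ?thesis by (simp add: open_vimage)
qed

definition lift_z :: "nat \<Rightarrow> real^2" where
  "lift_z n = (SOME y. to_torus y = z n)"

lemma to_torus_lift_z: "to_torus (lift_z n) = z n"
  unfolding lift_z_def by (rule someI_ex) (rule to_torus_surj)

lemma hitI:
  assumes "k \<in> integer_points" "dist ((A_real ^^ n) x) (lift_z n + k) < r n"
  shows "x \<in> hit n"
proof -
  have "to_torus (lift_z n + k) = z n"
    using assms(1) by (simp add: to_torus_lift_z[symmetric] to_torus_eq_iff lattice_rel_def integer_points_def)
  then have "dist (z n) (to_torus ((A_real ^^ n) x)) < r n"
    using dist_to_torus_le[of "lift_z n + k" "(A_real ^^ n) x"] assms(2) by (simp add: dist_commute)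
  then show ?thesis by (simp add: hit_def torus_map_power_to_torus)
qed

lemma hitE:
  assumes "x \<in> hit n"
  obtains k where "k \<in> integer_points" "dist ((A_real ^^ n) x) (lift_z n + k) < r n"
proof -
  have "dist (to_torus ((A_real ^^ n) x)) (z n) < r n"
    using assms by (simp add: hit_def torus_map_power_to_torus dist_commute)
  then obtain y where y: "to_torus y = z n" "dist ((A_real ^^ n) x) y < r n" by (rule dist_torus_lift)
  then have "lattice_rel y (lift_z n)" by (simp add: to_torus_lift_z flip: to_torus_eq_iff)
  then have "y - lift_z n \<in> integer_points" by (simp add: integer_points_def lattice_rel_def)
  then show thesis using that[of "y - lift_z n"] y(2) by simp
qed

end

context shrinking_target
begin

definition cube_centre :: "nat \<times> (2 \<Rightarrow> nat) \<Rightarrow> real^2" where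
  "cube_centre D = (\<chi> i. (real (snd D i) + 1/2) / 2 ^ fst D)"

lemma half_open_cube_near_centre:
  assumes "x \<in> half_open_cube D"
  shows "\<bar>(x - cube_centre D) $ i\<bar> \<le> side_length D"
proof -
  obtain k m where [simp]: "D = (k, m)" by (cases D)
  have "real (m i) / 2 ^ k \<le> x $ i" "x $ i < (real (m i) + 1) / 2 ^ k"
    using assms by (auto simp: half_open_cube_def)
  moreover have "(real (m i) + 1/2) / 2 ^ k = real (m i) / 2 ^ k + 1/2 * (1 / 2 ^ k)"
    by (simp add: add_divide_distrib)
  moreover have "(real (m i) + 1) / 2 ^ k = real (m i) / 2 ^ k + 1 / 2 ^ k"
    by (simp add: add_divide_distrib)
  moreover have "0 < (1::real) / 2 ^ k" by simp
  ultimately show ?thesis by (simp add: cube_centre_def side_length_eq abs_le_iff)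
qed

lemma near_centre_open_cube:
  assumes "\<And>i. \<bar>(x - cube_centre D) $ i\<bar> < side_length D / 2"
  shows "x \<in> open_cube D"
proof -
  obtain k m where [simp]: "D = (k, m)" by (cases D)
  have "real (m i) / 2 ^ k < x $ i \<and> x $ i < (real (m i) + 1) / 2 ^ k" for i
  proof -
    have "\<bar>x $ i - (real (m i) + 1/2) / 2 ^ k\<bar> < 1 / 2 ^ k / 2"
      using assms[of i] by (simp add: cube_centre_def side_length_eq)
    moreover have "(real (m i) + 1/2) / 2 ^ k = real (m i) / 2 ^ k + 1/2 * (1 / 2 ^ k)"
      by (simp add: add_divide_distrib)
    moreover have "(real (m i) + 1) / 2 ^ k = real (m i) / 2 ^ k + 1 / 2 ^ k"
      by (simp add: add_divide_distrib)
    ultimately show ?thesis by (simp add: abs_less_iff)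
  qed
  then show ?thesis by (simp add: open_cube_def)
qed

lemma powers_eq: "\<bar>\<mu> ^ n\<bar> = a n" "\<bar>\<nu> ^ n\<bar> = b n"
  by (simp_all add: power_abs abs_eigenvalue_power a_def b_def)

text \<open>The mass estimate in dynamical form. A cover of \<open>hit n\<close> inside a dyadic cube is mapped by the \<open>n\<close>-th power of
the matrix to a cover, by rectangles with side ratio \<open>a n : b n\<close>, of a thickening of the integer points. The
constant \<open>\<kappa>\<close> shrinks boxes in eigencoordinates so that they fit into Euclidean balls and cubes.\<close>

lemma hit_content_at_level:
  obtains c \<kappa> C0 where "0 < c" "0 < \<kappa>" "\<kappa> \<le> 1" "1 \<le> C0"
    "\<And>n D C. D \<in> dyadic_indices \<Longrightarrow> r n \<le> side_length D * b n \<Longrightarrow>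
      C0 \<le> \<kappa> * max (r n) (side_length D * a n) * (\<kappa> * side_length D * b n) \<Longrightarrow>
      hit n \<inter> open_cube D \<subseteq> (\<Union>E\<in>C. half_open_cube E) \<Longrightarrow>
      ennreal (c * (side_length D)\<^sup>2 * (a n * b n * (r n)\<^sup>2)) \<le>
        infsum (\<lambda>E. ennreal (min (side_length E * a n) (r n) * min (side_length E * b n) (r n)
          + (side_length E)\<^sup>2 * (a n * b n * (r n)\<^sup>2))) C"
proof -
  obtain L where L: "1 \<le> L" "\<And>x e i. \<bar>u x\<bar> \<le> e \<Longrightarrow> \<bar>v x\<bar> \<le> e \<Longrightarrow> \<bar>x $ i\<bar> \<le> L * e"
    by (rule coordinates_le_forms) blast
  obtain c0 C0 where c0: "0 < c0" "1 \<le> C0" and mass: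
    "\<And>r \<delta> a b p q p' q' \<rho> P R (I :: (nat \<times> (2 \<Rightarrow> nat)) set).
      0 < r \<Longrightarrow> 0 < \<delta> \<Longrightarrow> 0 < a \<Longrightarrow> 0 < b \<Longrightarrow> max r (\<delta> * a) \<le> 1 \<Longrightarrow> r \<le> \<delta> * b \<Longrightarrow>
      C0 \<le> max r (\<delta> * a) * (\<delta> * b) \<Longrightarrow> (\<And>i. i \<in> I \<Longrightarrow> 0 < \<rho> i) \<Longrightarrow>
      {w. \<exists>k\<in>integer_points. w \<in> rectangle (p + u k) r (q + v k) r} \<inter> rectangle p' (\<delta> * a) q' (\<delta> * b)
        \<subseteq> (\<Union>i\<in>I. rectangle (P i) (\<rho> i * a) (R i) (\<rho> i * b)) \<Longrightarrow>
      ennreal (c0 * \<delta>\<^sup>2 * (a * b * r\<^sup>2)) \<le>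
        infsum (\<lambda>i. ennreal (min (\<rho> i * a) r * min (\<rho> i * b) r + (\<rho> i)\<^sup>2 * (a * b * r\<^sup>2))) I"
    by (rule mass_estimate) blast
  define \<kappa> where "\<kappa> = 1 / (4 * L)"
  have \<kappa>: "0 < \<kappa>" "\<kappa> \<le> 1" "L * \<kappa> = 1/4" using L(1) by (auto simp: \<kappa>_def)
  define c where "c = c0 * \<kappa> ^ 4 / K\<^sup>2"
  have c: "0 < c" using c0 \<kappa> K_ge_1 by (simp add: c_def)
  show thesis
  proof (rule that[OF c \<kappa>(1,2) c0(2)])
    fix n and D :: "nat \<times> (2 \<Rightarrow> nat)" and C
    assume D: "D \<in> dyadic_indices" and rb: "r n \<le> side_length D * b n"
      and big: "C0 \<le> \<kappa> * max (r n) (side_length D * a n) * (\<kappa> * side_length D * b n)"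
      and cover: "hit n \<inter> open_cube D \<subseteq> (\<Union>E\<in>C. half_open_cube E)"
    define q where "q = side_length D"
    have q: "0 < q" "q \<le> 1" by (auto simp: q_def side_length_pos side_length_eq)
    note pos = rab_pos[of n]
    let ?x = "cube_centre D"
    have max_eq: "max (\<kappa> * r n) (\<kappa> * q * a n) = \<kappa> * max (r n) (q * a n)"
      using \<kappa>(1) by (simp add: max_mult_distrib_left mult.assoc)
    have "q * a n \<le> 1 * 1" using q a_le_1 pos by (intro mult_mono) auto
    then have max1: "max (\<kappa> * r n) (\<kappa> * q * a n) \<le> 1"
      unfolding max_eq using r_le_1[of n] \<kappa>(1,2) mult_le_one[of \<kappa> "max (r n) (q * a n)"] pos by auto
    have "ennreal (c0 * (\<kappa> * q)\<^sup>2 * (a n * b n * (\<kappa> * r n)\<^sup>2)) \<le>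
      infsum (\<lambda>E. ennreal (min (K * side_length E * a n) (\<kappa> * r n) * min (K * side_length E * b n) (\<kappa> * r n)
        + (K * side_length E)\<^sup>2 * (a n * b n * (\<kappa> * r n)\<^sup>2))) C"
    proof (rule mass[where p = "u (lift_z n)" and q = "v (lift_z n)" and p' = "\<mu> ^ n * u ?x" and q' = "\<nu> ^ n * v ?x"
          and P = "\<lambda>E. \<mu> ^ n * u (cube_centre E)" and R = "\<lambda>E. \<nu> ^ n * v (cube_centre E)"])
      show "0 < \<kappa> * r n" "0 < \<kappa> * q" "0 < a n" "0 < b n" using pos \<kappa> q by auto
      show "max (\<kappa> * r n) (\<kappa> * q * a n) \<le> 1" by (rule max1)
      show "\<kappa> * r n \<le> \<kappa> * q * b n" using rb \<kappa>(1) by (simp add: q_def)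
      show "C0 \<le> max (\<kappa> * r n) (\<kappa> * q * a n) * (\<kappa> * q * b n)" using big unfolding max_eq by (simp add: q_def)
      show "0 < K * side_length E" for E :: "nat \<times> (2 \<Rightarrow> nat)" using K_ge_1 side_length_pos[of E] by simp
      show "{w. \<exists>k\<in>integer_points. w \<in> rectangle (u (lift_z n) + u k) (\<kappa> * r n) (v (lift_z n) + v k) (\<kappa> * r n)} \<inter>
        rectangle (\<mu> ^ n * u ?x) (\<kappa> * q * a n) (\<nu> ^ n * v ?x) (\<kappa> * q * b n)
        \<subseteq> (\<Union>E\<in>C. rectangle (\<mu> ^ n * u (cube_centre E)) (K * side_length E * a n)
            (\<nu> ^ n * v (cube_centre E)) (K * side_length E * b n))"
      proof clarify
        fix w w' k
        assume k: "k \<in> integer_points"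
          and w1: "w \<in> {u (lift_z n) + u k - \<kappa> * r n..u (lift_z n) + u k + \<kappa> * r n}"
            "w' \<in> {v (lift_z n) + v k - \<kappa> * r n..v (lift_z n) + v k + \<kappa> * r n}"
          and w2: "w \<in> {\<mu> ^ n * u ?x - \<kappa> * q * a n..\<mu> ^ n * u ?x + \<kappa> * q * a n}"
            "w' \<in> {\<nu> ^ n * v ?x - \<kappa> * q * b n..\<nu> ^ n * v ?x + \<kappa> * q * b n}"
        have nz: "\<mu> ^ n \<noteq> 0" "\<nu> ^ n \<noteq> 0" using contracting expanding by auto
        obtain x where x: "u x = w / \<mu> ^ n" "v x = w' / \<nu> ^ n" using forms_surjective by blast
        have uy: "u ((A_real ^^ n) x) = w" and vy: "v ((A_real ^^ n) x) = w'"
          using nz by (simp_all add: u_A_power v_A_power x)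
        let ?d = "(A_real ^^ n) x - (lift_z n + k)"
        have "\<bar>u ?d\<bar> \<le> \<kappa> * r n" "\<bar>v ?d\<bar> \<le> \<kappa> * r n"
          using w1 by (auto simp: u_diff v_diff u_add v_add uy vy abs_le_iff algebra_simps)
        then have "\<bar>?d $ i\<bar> \<le> r n / 4" for i using L(2)[of ?d "\<kappa> * r n" i] \<kappa>(3) by (simp flip: mult.assoc)
        then have "(\<Sum>i\<in>UNIV. \<bar>?d $ i\<bar>) \<le> r n / 4 + r n / 4" unfolding sum_2 by (intro add_mono) auto
        then have "norm ?d < r n" using norm_le_l1_cart[of ?d] pos by linarith
        then have hit: "x \<in> hit n" by (intro hitI[OF k]) (simp add: dist_norm)
        have "a n * \<bar>u (x - ?x)\<bar> = \<bar>w - \<mu> ^ n * u ?x\<bar>"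
          using uy unfolding u_A_power by (simp add: u_diff right_diff_distrib flip: powers_eq abs_mult)
        also have "\<dots> \<le> a n * (\<kappa> * q)" using w2(1) by (simp add: abs_le_iff algebra_simps)
        finally have ux: "\<bar>u (x - ?x)\<bar> \<le> \<kappa> * q" using pos by simp
        have "b n * \<bar>v (x - ?x)\<bar> = \<bar>w' - \<nu> ^ n * v ?x\<bar>"
          using vy unfolding v_A_power by (simp add: v_diff right_diff_distrib flip: powers_eq abs_mult)
        also have "\<dots> \<le> b n * (\<kappa> * q)" using w2(2) by (simp add: abs_le_iff algebra_simps)
        finally have vx: "\<bar>v (x - ?x)\<bar> \<le> \<kappa> * q" using pos by simp
        have "\<bar>(x - ?x) $ i\<bar> < side_length D / 2" for i
        proof -
          have "\<bar>(x - ?x) $ i\<bar> \<le> (L * \<kappa>) * q" using L(2)[OF ux vx, of i] by (simp only: mult.assoc)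
          then show ?thesis using \<kappa>(3) q by (simp add: q_def)
        qed
        then have "x \<in> open_cube D" by (rule near_centre_open_cube)
        then obtain E where E: "E \<in> C" "x \<in> half_open_cube E" using hit cover by blast
        have "\<bar>u (x - cube_centre E)\<bar> \<le> K * side_length E" "\<bar>v (x - cube_centre E)\<bar> \<le> K * side_length E"
          using half_open_cube_near_centre[OF E(2)] by (auto intro: forms_le)
        then have "a n * \<bar>u (x - cube_centre E)\<bar> \<le> a n * (K * side_length E)"
          "b n * \<bar>v (x - cube_centre E)\<bar> \<le> b n * (K * side_length E)" using pos by auto
        then have "\<bar>w - \<mu> ^ n * u (cube_centre E)\<bar> \<le> K * side_length E * a n"
          "\<bar>w' - \<nu> ^ n * v (cube_centre E)\<bar> \<le> K * side_length E * b n"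
          using uy vy unfolding u_A_power v_A_power
          by (simp_all add: u_diff v_diff right_diff_distrib ac_simps flip: powers_eq abs_mult)
        then show "(w, w') \<in> (\<Union>E\<in>C. rectangle (\<mu> ^ n * u (cube_centre E)) (K * side_length E * a n)
            (\<nu> ^ n * v (cube_centre E)) (K * side_length E * b n))"
          using E(1) by (auto simp: abs_le_iff algebra_simps intro!: bexI[of _ E])
      qed
    qed
    also have "\<dots> \<le> infsum (\<lambda>E. ennreal (K\<^sup>2) * ennreal (min (side_length E * a n) (r n) * min (side_length E * b n) (r n)
          + (side_length E)\<^sup>2 * (a n * b n * (r n)\<^sup>2))) C"
    proof (intro infsum_mono ennreal_summable_on)
      fix E :: "nat \<times> (2 \<Rightarrow> nat)"
      let ?q = "side_length E"
      have q': "0 < ?q" by (rule side_length_pos)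
      have m: "min (K * ?q * g) (\<kappa> * r n) \<le> K * min (?q * g) (r n)" for g
      proof -
        have "\<kappa> * r n \<le> K * r n" using \<kappa>(2) K_ge_1 pos by (intro mult_right_mono) auto
        then have "min (K * ?q * g) (\<kappa> * r n) \<le> min (K * (?q * g)) (K * r n)" by (auto simp: min_def mult.assoc)
        also have "\<dots> = K * min (?q * g) (r n)" using K_ge_1 by (simp add: min_mult_distrib_left)
        finally show ?thesis .
      qed
      have "min (K * ?q * a n) (\<kappa> * r n) * min (K * ?q * b n) (\<kappa> * r n)
        \<le> (K * min (?q * a n) (r n)) * (K * min (?q * b n) (r n))"
        using pos q' \<kappa> K_ge_1 by (intro mult_mono m) auto
      moreover have "(K * ?q)\<^sup>2 * (a n * b n * (\<kappa> * r n)\<^sup>2) \<le> (K * ?q)\<^sup>2 * (a n * b n * (1 * r n)\<^sup>2)"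
        using pos \<kappa> by (intro mult_left_mono power_mono mult_right_mono) auto
      ultimately have "min (K * ?q * a n) (\<kappa> * r n) * min (K * ?q * b n) (\<kappa> * r n)
          + (K * ?q)\<^sup>2 * (a n * b n * (\<kappa> * r n)\<^sup>2)
        \<le> K\<^sup>2 * (min (?q * a n) (r n) * min (?q * b n) (r n) + ?q\<^sup>2 * (a n * b n * (r n)\<^sup>2))"
        by (simp add: power_mult_distrib power2_eq_square algebra_simps)
      then show "ennreal (min (K * ?q * a n) (\<kappa> * r n) * min (K * ?q * b n) (\<kappa> * r n)
          + (K * ?q)\<^sup>2 * (a n * b n * (\<kappa> * r n)\<^sup>2))
        \<le> ennreal (K\<^sup>2) * ennreal (min (?q * a n) (r n) * min (?q * b n) (r n) + ?q\<^sup>2 * (a n * b n * (r n)\<^sup>2))"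
        using pos q' by (subst ennreal_mult[symmetric]) (auto intro: ennreal_leI)
    qed
    also have "\<dots> = ennreal (K\<^sup>2) * infsum (\<lambda>E. ennreal (min (side_length E * a n) (r n) * min (side_length E * b n) (r n)
          + (side_length E)\<^sup>2 * (a n * b n * (r n)\<^sup>2))) C" (is "_ = _ * ?S")
      by (rule infsum_ennreal_cmult)
    finally have "ennreal (1 / K\<^sup>2) * ennreal (c0 * (\<kappa> * q)\<^sup>2 * (a n * b n * (\<kappa> * r n)\<^sup>2))
        \<le> ennreal (1 / K\<^sup>2) * (ennreal (K\<^sup>2) * ?S)" by (rule mult_left_mono) simp
    also have "\<dots> = ?S" using K_ge_1 by (subst mult.assoc[symmetric], subst ennreal_mult[symmetric]) auto
    also have "ennreal (1 / K\<^sup>2) * ennreal (c0 * (\<kappa> * q)\<^sup>2 * (a n * b n * (\<kappa> * r n)\<^sup>2))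
        = ennreal (c * q\<^sup>2 * (a n * b n * (r n)\<^sup>2))"
    proof -
      have "1 / K\<^sup>2 * (c0 * (\<kappa> * q)\<^sup>2 * (a n * b n * (\<kappa> * r n)\<^sup>2)) = c * q\<^sup>2 * (a n * b n * (r n)\<^sup>2)"
        by (simp add: c_def power2_eq_square power4_eq_xxxx)
      then show ?thesis using c0 pos by (subst ennreal_mult[symmetric]) auto
    qed
    finally show "ennreal (c * (side_length D)\<^sup>2 * (a n * b n * (r n)\<^sup>2)) \<le> ?S" by (simp add: q_def)
  qed
qed

text \<open>The box of integer points used in the mass estimate must have large area. If \<open>\<tau> < l2\<close> the area is at least a
multiple of \<open>r n * b n\<close>, which grows. Otherwise \<open>\<tau> \<ge> - l1\<close>, and then \<open>s > 0\<close> forces \<open>l1 + l2 > 0\<close>, so that \<open>a n * b n\<close> grows.\<close>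

lemma eventually_big:
  assumes "0 < s" "0 < \<kappa>" "0 < q"
  shows "\<forall>\<^sub>F n in sequentially. r n \<le> q * b n \<and> C0 \<le> \<kappa> * max (r n) (q * a n) * (\<kappa> * q * b n)"
proof -
  have exp_top: "\<forall>\<^sub>F n in sequentially. M \<le> exp (real n * l)" if "0 < l" for l M
  proof -
    have "filterlim (\<lambda>n. exp (real n * l)) at_top sequentially"
      using that by (intro filterlim_compose[OF exp_at_top] filterlim_tendsto_pos_mult_at_top[where c = l and f = "\<lambda>_. l", unfolded mult.commute[of l]] filterlim_real_sequentially) auto
    then show ?thesis by (simp add: filterlim_at_top)
  qed
  have "\<forall>\<^sub>F n in sequentially. 1 / q \<le> b n" unfolding b_def by (rule exp_top[OF l2_pos])
  then have 1: "\<forall>\<^sub>F n in sequentially. r n \<le> q * b n"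
  proof eventually_elim
    case (elim n)
    then have "1 \<le> q * b n" using assms by (simp add: field_simps)
    then show ?case using r_le_1[of n] by linarith
  qed
  have 2: "\<forall>\<^sub>F n in sequentially. C0 \<le> \<kappa> * max (r n) (q * a n) * (\<kappa> * q * b n)"
  proof (cases "\<tau> < l2")
    case True
    have "r n * b n = exp (real n * (l2 - \<tau>))" for n by (simp add: r_def b_def algebra_simps flip: exp_add)
    then have "\<forall>\<^sub>F n in sequentially. C0 / (\<kappa> * \<kappa> * q) \<le> r n * b n" using exp_top[of "l2 - \<tau>"] True by simp
    then show ?thesis
    proof eventually_elim
      case (elim n)
      then have "C0 \<le> \<kappa> * r n * (\<kappa> * q * b n)" using assms by (simp add: field_simps)
      also have "\<dots> \<le> \<kappa> * max (r n) (q * a n) * (\<kappa> * q * b n)"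
        using assms rab_pos[of n] by (intro mult_right_mono mult_left_mono) auto
      finally show ?case .
    qed
  next
    case False
    then have not_lt: "\<not> \<tau> < - l1" using l_sum by linarith
    then have "s \<le> (l1 + l2) / (\<tau> + l1)" by (simp add: shrinking_target_dim_def)
    then have "0 < l1 + l2" using assms(1) l_sum by (cases "l1 + l2 = 0") auto
    moreover have "a n * b n = exp (real n * (l1 + l2))" for n by (simp add: a_def b_def algebra_simps flip: exp_add)
    ultimately have "\<forall>\<^sub>F n in sequentially. C0 / (\<kappa> * \<kappa> * q * q) \<le> a n * b n" using exp_top[of "l1 + l2"] by simp
    then show ?thesis
    proof eventually_elim
      case (elim n)
      then have "C0 \<le> \<kappa> * (q * a n) * (\<kappa> * q * b n)" using assms by (simp add: field_simps)
      also have "\<dots> \<le> \<kappa> * max (r n) (q * a n) * (\<kappa> * q * b n)"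
        using assms rab_pos[of n] by (intro mult_right_mono mult_left_mono) auto
      finally show ?case .
    qed
  qed
  from 1 2 show ?thesis by eventually_elim simp
qed

text \<open>For a fixed cube of side \<open>q\<close> and large \<open>n\<close>, the exponentially small factor in \<open>decay\<close> is below \<open>q powr (2 - t)\<close>.
Then, up to the common factor \<open>a n * b n * (r n)\<^sup>2\<close>, both terms in the mass estimate are at most \<open>q powr (2 - t)\<close> times the cost of a cube of the cover. After
division by \<open>q powr (2 - t)\<close>, the left-hand side scales exactly like the cost of the given cube. Hence the constant is the same for all cubes.\<close>

lemma hits_content_lower_bound:
  assumes t: "0 < t" "t < s"
  obtains c where "0 < c" "\<And>N. content_lower_bound t (\<Union>n\<in>{N..}. hit n) c"
proof -
  obtain c \<kappa> C0 where c: "0 < c" "0 < \<kappa>" "\<kappa> \<le> 1" "1 \<le> C0" and content: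
    "\<And>n D C. D \<in> dyadic_indices \<Longrightarrow> r n \<le> side_length D * b n \<Longrightarrow>
      C0 \<le> \<kappa> * max (r n) (side_length D * a n) * (\<kappa> * side_length D * b n) \<Longrightarrow>
      hit n \<inter> open_cube D \<subseteq> (\<Union>E\<in>C. half_open_cube E) \<Longrightarrow>
      ennreal (c * (side_length D)\<^sup>2 * (a n * b n * (r n)\<^sup>2)) \<le>
        infsum (\<lambda>E. ennreal (min (side_length E * a n) (r n) * min (side_length E * b n) (r n)
          + (side_length E)\<^sup>2 * (a n * b n * (r n)\<^sup>2))) C"
    by (rule hit_content_at_level) blast
  obtain \<eta> where \<eta>: "0 < \<eta>" "\<And>n \<rho>. 0 < \<rho> \<Longrightarrow>
    min (\<rho> * a n) (r n) * min (\<rho> * b n) (r n) \<le> exp (- \<eta>) ^ n * (a n * b n * (r n)\<^sup>2) * \<rho> powr t"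
    using decay[OF t] by blast
  show thesis
  proof (rule that[of "min 1 (c / 2)"])
    show "0 < min 1 (c / 2)" using c by simp
    fix N
    show "content_lower_bound t (\<Union>n\<in>{N..}. hit n) (min 1 (c / 2))"
      unfolding content_lower_bound_def
    proof (intro ballI allI impI)
      fix D :: "nat \<times> (2 \<Rightarrow> nat)" and C
      assume D: "D \<in> dyadic_indices" and C: "C \<subseteq> dyadic_indices"
        and cover: "(\<Union>n\<in>{N..}. hit n) \<inter> open_cube D \<subseteq> (\<Union>E\<in>C. half_open_cube E)"
      define q where "q = side_length D"
      have q: "0 < q" "q \<le> 1" by (auto simp: q_def side_length_pos side_length_eq)
      have t2: "t < 2" using t s_lt_2 by linarith
      show "ennreal (min 1 (c / 2) * side_length D powr t) \<le> cost t C"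
      proof (cases "\<exists>E\<in>C. fst E \<le> fst D")
        case True
        then obtain E where "E \<in> C" "fst E \<le> fst D" by blast
        then have "ennreal (side_length D powr t) \<le> cost t C" by (rule cost_ge_larger_cube[OF _ _ t(1)])
        moreover have "min 1 (c / 2) * side_length D powr t \<le> side_length D powr t"
          using mult_right_mono[of "min 1 (c / 2)" 1 "side_length D powr t"] by simp
        ultimately show ?thesis by (meson ennreal_leI order_trans)
      next
        case False
        have "(\<lambda>n. exp (- \<eta>) ^ n) \<longlonglongrightarrow> 0" using \<eta>(1) by (intro LIMSEQ_realpow_zero) auto
        then have "\<forall>\<^sub>F n in sequentially. exp (- \<eta>) ^ n < q powr (2 - t)"
          using q by (intro order_tendstoD(2)) auto
        moreover have "0 < s" using t by linarith
        then have "\<forall>\<^sub>F n in sequentially. r n \<le> q * b n \<and> C0 \<le> \<kappa> * max (r n) (q * a n) * (\<kappa> * q * b n)"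
          using c(2) q(1) by (intro eventually_big)
        moreover have "\<forall>\<^sub>F n in sequentially. N \<le> n" by (rule eventually_ge_at_top)
        ultimately have "\<forall>\<^sub>F n in sequentially. exp (- \<eta>) ^ n < q powr (2 - t) \<and> r n \<le> q * b n
          \<and> C0 \<le> \<kappa> * max (r n) (q * a n) * (\<kappa> * q * b n) \<and> N \<le> n"
          by eventually_elim simp
        then obtain n where n: "exp (- \<eta>) ^ n < q powr (2 - t)" "r n \<le> q * b n"
          "C0 \<le> \<kappa> * max (r n) (q * a n) * (\<kappa> * q * b n)" "N \<le> n"
          unfolding eventually_sequentially by blast
        define X where "X = a n * b n * (r n)\<^sup>2"
        have X: "0 < X" using rab_pos[of n] by (simp add: X_def)
        have "hit n \<inter> open_cube D \<subseteq> (\<Union>E\<in>C. half_open_cube E)" using cover n(4) by blast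
        then have "ennreal (c * q\<^sup>2 * X) \<le>
          infsum (\<lambda>E. ennreal (min (side_length E * a n) (r n) * min (side_length E * b n) (r n) + (side_length E)\<^sup>2 * X)) C"
          unfolding X_def q_def using D n by (intro content) (auto simp: q_def)
        also have "\<dots> \<le> infsum (\<lambda>E. ennreal (2 * X * q powr (2 - t)) * ennreal (side_length E powr t)) C"
        proof (intro infsum_mono ennreal_summable_on)
          fix E assume E: "E \<in> C"
          let ?e = "side_length E"
          have e: "0 < ?e" by (rule side_length_pos)
          have "fst D \<le> fst E" using False E by force
          then have eq: "?e \<le> q" unfolding q_def by (rule side_length_antimono)
          have "min (?e * a n) (r n) * min (?e * b n) (r n) \<le> exp (- \<eta>) ^ n * X * ?e powr t"
            unfolding X_def by (rule \<eta>(2)[OF e])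
          also have "\<dots> \<le> q powr (2 - t) * X * ?e powr t"
            using n(1) X by (intro mult_right_mono) auto
          finally have 1: "min (?e * a n) (r n) * min (?e * b n) (r n) \<le> q powr (2 - t) * X * ?e powr t" .
          have "?e\<^sup>2 = ?e powr (2 - t) * ?e powr t" using e by (simp flip: powr_add powr_numeral)
          also have "\<dots> \<le> q powr (2 - t) * ?e powr t"
            using e eq t2 by (intro mult_right_mono powr_mono2) auto
          finally have "?e\<^sup>2 * X \<le> q powr (2 - t) * ?e powr t * X" using X by (intro mult_right_mono) auto
          with 1 have "min (?e * a n) (r n) * min (?e * b n) (r n) + ?e\<^sup>2 * X \<le> 2 * X * q powr (2 - t) * ?e powr t"
            by (simp add: algebra_simps)
          then show "ennreal (min (?e * a n) (r n) * min (?e * b n) (r n) + ?e\<^sup>2 * X)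
            \<le> ennreal (2 * X * q powr (2 - t)) * ennreal (?e powr t)"
            using X by (subst ennreal_mult[symmetric]) (auto intro: ennreal_leI)
        qed
        also have "\<dots> = ennreal (2 * X * q powr (2 - t)) * cost t C" by (rule infsum_ennreal_cmult)
        finally have "ennreal (1 / (2 * X * q powr (2 - t))) * ennreal (c * q\<^sup>2 * X)
          \<le> ennreal (1 / (2 * X * q powr (2 - t))) * (ennreal (2 * X * q powr (2 - t)) * cost t C)"
          by (rule mult_left_mono) simp
        also have "\<dots> = cost t C"
          using X q by (subst mult.assoc[symmetric], subst ennreal_mult[symmetric]) auto
        also have "ennreal (1 / (2 * X * q powr (2 - t))) * ennreal (c * q\<^sup>2 * X) = ennreal (c / 2 * q powr t)"
        proof -
          have "q\<^sup>2 = q powr t * q powr (2 - t)" using q by (simp flip: powr_add powr_numeral)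
          then have "1 / (2 * X * q powr (2 - t)) * (c * q\<^sup>2 * X) = c / 2 * q powr t"
            using X q by simp
          then show ?thesis using X c q by (subst ennreal_mult[symmetric]) auto
        qed
        finally have "ennreal (c / 2 * q powr t) \<le> cost t C" .
        moreover have "min 1 (c / 2) * q powr t \<le> c / 2 * q powr t" by (intro mult_right_mono) auto
        ultimately show ?thesis unfolding q_def by (meson ennreal_leI order_trans)
      qed
    qed
  qed
qed

lemma to_torus_in_target_iff:
  "to_torus x \<in> shrinking_target_set A z \<tau> \<longleftrightarrow> x \<in> (\<Inter>N. \<Union>n\<in>{N..}. hit n)"
  by (auto simp: shrinking_target_set_def hit_def r_def INFM_nat_le)

lemma gdelta_target: "gdelta (shrinking_target_set A z \<tau>)"
proof -
  let ?F = "\<lambda>N. \<Union>n\<in>{N..}. {p. (torus_map A ^^ n) p \<in> ball (z n) (r n)}"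
  have "to_torus -` ?F N = (\<Union>n\<in>{N..}. hit n)" for N by (auto simp: hit_def)
  moreover have "open (\<Union>n\<in>{N..}. hit n)" for N by (intro open_UN ballI open_hit)
  ultimately have "open (?F N)" for N using open_torus_iff[of "?F N"] by metis
  moreover have "shrinking_target_set A z \<tau> = (\<Inter>N. ?F N)"
    by (auto simp: shrinking_target_set_def r_def INFM_nat_le)
  ultimately show ?thesis using gdelta.intros[of ?F] by simp
qed

text \<open>The shrinking target set is the intersection of the open sets \<open>\<Union>n\<in>{N..}. hit n\<close>, so the lower bound for
covers of these sets passes to it.\<close>

lemma target_cover_cost:
  assumes t: "0 < t" "t < s" and D: "D \<in> dyadic_indices" and C: "C \<subseteq> dyadic_indices"
    and cover: "shrinking_target_set A z \<tau> \<inter> dyadic_cube D \<subseteq> (\<Union>E\<in>C. dyadic_cube E)"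
  shows "ennreal (side_length D powr t) \<le> cost t C"
proof -
  obtain c where c: "0 < c" "\<And>N. content_lower_bound t (\<Union>n\<in>{N..}. hit n) c"
    using hits_content_lower_bound[OF t] by blast
  show ?thesis
  proof (rule cost_ge_Inter_of_open[OF t(1) _ c(1) _ c(2) D C])
    show "t < real CARD(2)" using t s_lt_2 by simp
    show "open (\<Union>n\<in>{N..}. hit n)" for N using open_hit by blast
    show "(\<Inter>N. \<Union>n\<in>{N..}. hit n) \<inter> half_open_cube D \<subseteq> (\<Union>E\<in>C. half_open_cube E)"
    proof
      fix x assume x: "x \<in> (\<Inter>N. \<Union>n\<in>{N..}. hit n) \<inter> half_open_cube D"
      then have unit: "\<forall>i. 0 \<le> x $ i \<and> x $ i < 1" using half_open_cube_unit[OF D] by blast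
      have "to_torus x \<in> shrinking_target_set A z \<tau> \<inter> dyadic_cube D"
        using x by (simp add: to_torus_in_target_iff dyadic_cube_eq)
      then obtain E where E: "E \<in> C" "to_torus x \<in> dyadic_cube E" using cover by blast
      then have "x \<in> half_open_cube E" using to_torus_in_dyadic_cube_iff[of E x] unit C by blast
      then show "x \<in> (\<Union>E\<in>C. half_open_cube E)" using E(1) by blast
    qed
  qed
qed

theorem target_in_large_intersection_class:
  "shrinking_target_set A z \<tau> \<in> large_intersection_class s"
  unfolding large_intersection_class_def
proof (intro CollectI conjI gdelta_target allI impI ballI)
  fix t and D :: "nat \<times> (2 \<Rightarrow> nat)"
  assume t: "0 < t \<and> t < s" and D: "D \<in> dyadic_indices"
  let ?W = "shrinking_target_set A z \<tau> \<inter> dyadic_cube D"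
  have "net_content t (dyadic_cube D) \<le> cost t {D}"
    unfolding net_content_def using D by (intro INF_lower) auto
  also have "\<dots> = ennreal (side_length D powr t)" by simp
  also have "\<dots> \<le> net_content t ?W"
    unfolding net_content_def using target_cover_cost t D by (intro INF_greatest) auto
  finally have "net_content t (dyadic_cube D) \<le> net_content t ?W" .
  moreover have "net_content t ?W \<le> net_content t (dyadic_cube D)"
    unfolding net_content_def by (intro INF_superset_mono) auto
  ultimately show "net_content t ?W = net_content t (dyadic_cube D)" by (rule antisym[rotated])
qed

end

section \<open>Hausdorff null sets\<close>

lemma hausdorff_premeasure_le_cover:
  fixes E :: "'a::metric_space set"
  assumes "E \<subseteq> (\<Union>i. U i)" "\<And>i. bounded (U i) \<and> diameter (U i) \<le> \<delta>"
  shows "hausdorff_premeasure t \<delta> E \<le> (\<Sum>i. ennreal (diameter (U i) powr t))"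
  unfolding hausdorff_premeasure_def using assms by (intro INF_lower) auto

text \<open>The convergence part of the Borel--Cantelli argument: the covers of all \<open>E n\<close> with \<open>n \<ge> N\<close> together
cover the limsup set, and their cost is the tail of a convergent series.\<close>

lemma hausdorff_measure_limsup_null:
  fixes E :: "nat \<Rightarrow> 'a::metric_space set" and \<U> :: "nat \<Rightarrow> 'a set set"
  assumes t: "0 < t"
    and fin: "\<And>n. finite (\<U> n)" and card: "\<And>n. real (card (\<U> n)) \<le> M n"
    and cover: "\<And>n. E n \<subseteq> \<Union>(\<U> n)"
    and small: "\<And>n U. U \<in> \<U> n \<Longrightarrow> bounded U \<and> diameter U \<le> d n"
    and d: "d \<longlonglongrightarrow> 0" and summable: "summable (\<lambda>n. M n * d n powr t)"
  shows "hausdorff_measure t {x. \<exists>\<^sub>\<infinity>n. x \<in> E n} = 0"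
proof -
  let ?W = "{x. \<exists>\<^sub>\<infinity>n. x \<in> E n}"
  have M: "0 \<le> M n" for n using card[of n] by linarith
  have "hausdorff_premeasure t \<delta> ?W \<le> ennreal e" if \<delta>: "0 < \<delta>" and e: "0 < e" for \<delta> e
  proof -
    obtain N1 where N1: "\<And>n. N1 \<le> n \<Longrightarrow> norm (\<Sum>i. M (i + n) * d (i + n) powr t) < e"
      using suminf_exist_split[OF e summable] by blast
    obtain N2 where N2: "\<And>n. N2 \<le> n \<Longrightarrow> d n < \<delta>"
      using order_tendstoD(2)[OF d \<delta>] unfolding eventually_sequentially by blast
    define N where "N = max N1 N2"
    have "\<exists>f. bij_betw f {0..<card (\<U> n)} (\<U> n)" for n
      using fin by (rule ex_bij_betw_nat_finite)
    then obtain f where f: "\<And>n. bij_betw (f n) {0..<card (\<U> n)} (\<U> n)" by metis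
    define V where "V = (\<lambda>(n, j). if j < card (\<U> (n + N)) then f (n + N) j else {})"
    have V_in: "f n j \<in> \<U> n" if "j < card (\<U> n)" for n j
      using f[of n] that by (auto simp: bij_betw_def)
    have "?W \<subseteq> (\<Union>i. V (prod_decode i))"
    proof
      fix x assume "x \<in> ?W"
      then obtain n where n: "N \<le> n" "x \<in> E n" by (auto simp: INFM_nat_le)
      then obtain U where U: "U \<in> \<U> n" "x \<in> U" using cover by blast
      then have "U \<in> f n ` {0..<card (\<U> n)}" using f[of n] by (simp add: bij_betw_def)
      then obtain j where "j < card (\<U> n)" "x \<in> f n j" using U(2) by auto
      then have "x \<in> V (n - N, j)" using n by (simp add: V_def)
      then have "x \<in> V (prod_decode (prod_encode (n - N, j)))" by simp
      then show "x \<in> (\<Union>i. V (prod_decode i))" by blast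
    qed
    moreover have "bounded (V p) \<and> diameter (V p) \<le> \<delta>" for p
    proof (cases p)
      case (Pair n j)
      have "N2 \<le> n + N" by (simp add: N_def)
      then have "d (n + N) \<le> \<delta>" using N2 by (simp add: less_imp_le)
      then show ?thesis using small[OF V_in] \<delta> Pair by (auto simp: V_def intro: order_trans)
    qed
    ultimately have "hausdorff_premeasure t \<delta> ?W \<le> (\<Sum>i. ennreal (diameter (V (prod_decode i)) powr t))"
      by (intro hausdorff_premeasure_le_cover) auto
    also have "\<dots> = (\<Sum>n. \<Sum>j. ennreal (diameter (V (n, j)) powr t))"
      by (rule suminf_ennreal_2dimen[of _ "\<lambda>p. ennreal (diameter (V p) powr t)"]) simp
    also have "\<dots> \<le> (\<Sum>n. ennreal (M (n + N) * d (n + N) powr t))"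
    proof (intro suminf_le)
      fix n
      let ?c = "card (\<U> (n + N))"
      have "(\<Sum>j. ennreal (diameter (V (n, j)) powr t)) = (\<Sum>j<?c. ennreal (diameter (V (n, j)) powr t))"
        using t by (intro suminf_finite) (auto simp: V_def)
      also have "\<dots> \<le> (\<Sum>j<?c. ennreal (d (n + N) powr t))"
      proof (intro sum_mono ennreal_leI powr_mono2)
        fix j assume "j \<in> {..<?c}"
        then show "diameter (V (n, j)) \<le> d (n + N)" "0 \<le> diameter (V (n, j))"
          using small[OF V_in] by (auto simp: V_def intro: diameter_ge_0)
      qed (use t in simp)
      also have "\<dots> = ennreal (?c * d (n + N) powr t)"
        by (simp add: ennreal_mult ennreal_of_nat_eq_real_of_nat)
      also have "\<dots> \<le> ennreal (M (n + N) * d (n + N) powr t)"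
        by (intro ennreal_leI mult_right_mono card) auto
      finally show "(\<Sum>j. ennreal (diameter (V (n, j)) powr t)) \<le> ennreal (M (n + N) * d (n + N) powr t)" .
    qed auto
    also have "\<dots> = ennreal (\<Sum>n. M (n + N) * d (n + N) powr t)"
      using M summable summable_iff_shift[of "\<lambda>n. M n * d n powr t" N] by (intro suminf_ennreal2) auto
    also have "\<dots> \<le> ennreal e"
      using N1[of N] by (intro ennreal_leI) (auto simp: N_def)
    finally show ?thesis .
  qed
  then have "hausdorff_premeasure t \<delta> ?W = 0" if "0 < \<delta>" for \<delta>
    using that by (metis ennreal_le_epsilon add_0 le_zero_eq)
  then show ?thesis unfolding hausdorff_measure_def by (simp add: SUP_eq_const)
qed

text \<open>In each coordinate, a point of \<open>U\<close> is in the same dyadic interval as a fixed point of \<open>U\<close> or in one of the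
two neighbouring intervals, where positions are taken modulo \<open>2 ^ k\<close>.\<close>

lemma small_set_dyadic_cover:
  fixes U :: "'n::finite torus set"
  assumes "bounded U" "diameter U < 1 / 2 ^ k"
  obtains C :: "(nat \<times> ('n \<Rightarrow> nat)) set" where "finite C" "card C \<le> 3 ^ CARD('n)" "C \<subseteq> dyadic_indices"
    "\<And>E. E \<in> C \<Longrightarrow> fst E = k" "U \<subseteq> (\<Union>E\<in>C. dyadic_cube E)"
proof (cases "U = {}")
  case True
  then show thesis using that[of "{}"] by simp
next
  case False
  then obtain p where p: "p \<in> U" by blast
  obtain x where x: "to_torus x = p" using to_torus_surj by blast
  define M where "M i = \<lfloor>2 ^ k * x $ i\<rfloor>" for i
  define P where "P = PiE UNIV (\<lambda>i. {M i - 1, M i, M i + 1})"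
  define g where "g = (\<lambda>N :: 'n \<Rightarrow> int. (k, \<lambda>i. nat (N i mod 2 ^ k)))"
  have P: "finite P" unfolding P_def by (intro finite_PiE) auto
  have "card P = (\<Prod>i\<in>(UNIV::'n set). card {M i - 1, M i, M i + 1})"
    unfolding P_def by (rule card_PiE) simp
  also have "\<dots> = (\<Prod>i\<in>(UNIV::'n set). 3)" by (rule prod.cong) auto
  also have "\<dots> = 3 ^ CARD('n)" by (rule prod_constant)
  finally have card_P: "card P = 3 ^ CARD('n)" .
  show thesis
  proof (rule that[of "g ` P"])
    show "finite (g ` P)" using P by simp
    show "card (g ` P) \<le> 3 ^ CARD('n)" using card_image_le[OF P, of g] card_P by simp
    show "g ` P \<subseteq> dyadic_indices" by (auto simp: g_def dyadic_indices_def nat_less_iff)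
    show "fst E = k" if "E \<in> g ` P" for E using that by (auto simp: g_def)
    show "U \<subseteq> (\<Union>E\<in>g ` P. dyadic_cube E)"
    proof
      fix q assume "q \<in> U"
      then have "dist (to_torus x) q < 1 / 2 ^ k"
        using diameter_bounded_bound[OF assms(1) p \<open>q \<in> U\<close>] assms(2) x by simp
      then obtain y where y: "to_torus y = q" "dist x y < 1 / 2 ^ k" by (rule dist_torus_lift)
      define N where "N i = \<lfloor>2 ^ k * y $ i\<rfloor>" for i
      have "N i \<in> {M i - 1, M i, M i + 1}" for i
      proof -
        have "\<bar>x $ i - y $ i\<bar> < 1 / 2 ^ k"
          using dist_vec_nth_le[of x i y] y(2) by (simp add: dist_real_def)
        then have "2 ^ k * \<bar>x $ i - y $ i\<bar> < 1" by (simp add: field_simps)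
        moreover have "\<bar>2 ^ k * x $ i - 2 ^ k * y $ i\<bar> = 2 ^ k * \<bar>x $ i - y $ i\<bar>"
          by (simp add: abs_mult flip: right_diff_distrib)
        ultimately have "\<bar>2 ^ k * x $ i - 2 ^ k * y $ i\<bar> < 1" by simp
        then have "M i - 1 \<le> N i" "N i \<le> M i + 1" unfolding M_def N_def by linarith+
        then show ?thesis by auto
      qed
      then have "N \<in> P" unfolding P_def by (intro PiE_I) auto
      moreover have "(\<chi> i. frac (y $ i)) \<in> half_open_cube (g N)"
      proof -
        have "\<lfloor>2 ^ k * frac (y $ i)\<rfloor> = N i mod 2 ^ k" for i
        proof -
          have "2 ^ k * frac (y $ i) = 2 ^ k * y $ i - real_of_int (2 ^ k * \<lfloor>y $ i\<rfloor>)"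
            by (simp add: frac_def algebra_simps)
          then have "\<lfloor>2 ^ k * frac (y $ i)\<rfloor> = N i - 2 ^ k * \<lfloor>y $ i\<rfloor>"
            by (simp only: N_def floor_diff_of_int)
          moreover have "\<lfloor>y $ i\<rfloor> = N i div 2 ^ k"
            using floor_dyadic_coarsen[of 0 k "y $ i"] by (simp add: N_def)
          ultimately show ?thesis by (simp add: minus_mult_div_eq_mod)
        qed
        then show ?thesis by (simp add: g_def half_open_cube_iff_floor)
      qed
      moreover have "to_torus (\<chi> i. frac (y $ i)) = q"
      proof -
        have "lattice_rel (\<chi> i. frac (y $ i)) y" by (auto simp: lattice_rel_def frac_def)
        then show ?thesis using y(1) by (simp flip: to_torus_eq_iff)
      qed
      ultimately show "q \<in> (\<Union>E\<in>g ` P. dyadic_cube E)" unfolding dyadic_cube_eq by blast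
    qed
  qed
qed

text \<open>The summand \<open>e\<close> serves sets of diameter \<open>0\<close>, which must be covered by cubes of positive side length.\<close>

lemma dyadic_cover_of_small_set:
  fixes U :: "'n::finite torus set"
  assumes "bounded U" "diameter U \<le> 1 / 2" and t: "0 < t" and e: "0 < e"
  shows "\<exists>C. C \<subseteq> dyadic_indices \<and> U \<subseteq> (\<Union>E\<in>C. dyadic_cube E) \<and>
    cost t C \<le> ennreal (3 ^ CARD('n) * 2 powr t * diameter U powr t) + ennreal e"
proof -
  let ?d = "diameter U" and ?c = "3 ^ CARD('n) :: real"
  have d0: "0 \<le> ?d" using assms(1) by (rule diameter_ge_0)
  obtain k where k: "?d < 1 / 2 ^ k" "?c * (1 / 2 ^ k) powr t \<le> ?c * 2 powr t * ?d powr t + e"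
  proof (cases "?d = 0")
    case True
    have "(\<lambda>k. ?c * (1 / 2 ^ k) powr t) \<longlonglongrightarrow> ?c * 0 powr t"
      using t by (intro tendsto_mult tendsto_const tendsto_powr') (auto intro: LIMSEQ_divide_realpow_zero)
    then have "(\<lambda>k. ?c * (1 / 2 ^ k) powr t) \<longlonglongrightarrow> 0" using t by simp
    then have "\<forall>\<^sub>F k in sequentially. ?c * (1 / 2 ^ k) powr t < e" using e by (rule order_tendstoD(2))
    then obtain k where "?c * (1 / 2 ^ k) powr t < e" by (auto simp: eventually_sequentially)
    then show thesis using True by (intro that[of k]) auto
  next
    case False
    then have d: "0 < ?d" using d0 by simp
    obtain n where "(1/2) ^ n < ?d" using real_arch_pow_inv[OF d, of "1/2"] by auto
    then have "\<exists>n. 1 / 2 ^ n \<le> ?d" by (auto simp: power_one_over intro: less_imp_le)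
    then obtain n where n: "1 / 2 ^ n \<le> ?d" "\<And>m. m < n \<Longrightarrow> \<not> 1 / 2 ^ m \<le> ?d"
      using exists_least_iff[of "\<lambda>n. 1 / 2 ^ n \<le> ?d"] by blast
    have "n \<noteq> 0" using n(1) assms(2) by (cases n) auto
    then obtain m where m: "n = Suc m" by (cases n) auto
    have "1 / 2 ^ m \<le> 2 * ?d" using n(1) m by simp
    then have "(1 / 2 ^ m) powr t \<le> (2 * ?d) powr t" using t by (intro powr_mono2) auto
    then have "?c * (1 / 2 ^ m) powr t \<le> ?c * (2 * ?d) powr t" by (intro mult_left_mono) auto
    also have "\<dots> = ?c * 2 powr t * ?d powr t" using d by (simp add: powr_mult)
    finally have "?c * (1 / 2 ^ m) powr t \<le> ?c * 2 powr t * ?d powr t + e" using e by linarith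
    then show thesis using n(2)[of m] m by (intro that[of m]) (auto simp: not_le)
  qed
  obtain C :: "(nat \<times> ('n \<Rightarrow> nat)) set" where C: "finite C" "card C \<le> 3 ^ CARD('n)" "C \<subseteq> dyadic_indices"
    "\<And>E. E \<in> C \<Longrightarrow> fst E = k" "U \<subseteq> (\<Union>E\<in>C. dyadic_cube E)"
    using small_set_dyadic_cover[OF assms(1) k(1)] by blast
  have "cost t C = (\<Sum>E\<in>C. ennreal ((1 / 2 ^ k) powr t))"
    using C(1,4) by (simp add: side_length_eq)
  also have "\<dots> = ennreal (real (card C) * (1 / 2 ^ k) powr t)"
    by (simp add: ennreal_mult ennreal_of_nat_eq_real_of_nat)
  also have "\<dots> \<le> ennreal (?c * (1 / 2 ^ k) powr t)"
    using of_nat_mono[OF C(2), where 'a = real] by (intro ennreal_leI mult_right_mono) auto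
  also have "\<dots> \<le> ennreal (?c * 2 powr t * ?d powr t + e)" by (rule ennreal_leI[OF k(2)])
  also have "\<dots> = ennreal (?c * 2 powr t * ?d powr t) + ennreal e" using e by (intro ennreal_plus) auto
  finally show ?thesis using C(3,5) by blast
qed

text \<open>Replacing each set of a cover by dyadic cubes of comparable size changes the cost by a bounded factor.\<close>

lemma hausdorff_null_imp_net_content_null:
  fixes E :: "'n::finite torus set"
  assumes t: "0 < t" and null: "hausdorff_measure t E = 0"
  shows "net_content t E = 0"
proof -
  let ?c = "3 ^ CARD('n) * 2 powr t :: real"
  have "net_content t E \<le> ennreal e" if e: "0 < e" for e
  proof -
    define e' where "e' = e / (?c + 1)"
    have c: "0 < ?c" by simp
    have c1: "0 < ?c + 1" using c by linarith
    then have e': "0 < e'" using e unfolding e'_def by (rule divide_pos_pos[rotated])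
    have "hausdorff_premeasure t (1/2) E \<le> hausdorff_measure t E"
      unfolding hausdorff_measure_def by (rule SUP_upper) simp
    then have "hausdorff_premeasure t (1/2) E < ennreal e'" using null e' by simp
    then obtain U where U: "E \<subseteq> (\<Union>i. U i)" "\<And>i. bounded (U i) \<and> diameter (U i) \<le> 1/2"
      "(\<Sum>i. ennreal (diameter (U i) powr t)) < ennreal e'"
      unfolding hausdorff_premeasure_def INF_less_iff by blast
    have "\<exists>C. C \<subseteq> dyadic_indices \<and> U i \<subseteq> (\<Union>E\<in>C. dyadic_cube E) \<and>
      cost t C \<le> ennreal (?c * diameter (U i) powr t) + ennreal (e' * (1/2) ^ Suc i)" for i
      using dyadic_cover_of_small_set[of "U i" t "e' * (1/2) ^ Suc i"] U(2)[of i] t e' by simp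
    then obtain C where C: "\<And>i. C i \<subseteq> dyadic_indices" "\<And>i. U i \<subseteq> (\<Union>E\<in>C i. dyadic_cube E)"
      "\<And>i. cost t (C i) \<le> ennreal (?c * diameter (U i) powr t) + ennreal (e' * (1/2) ^ Suc i)"
      by metis
    have "E \<subseteq> (\<Union>E\<in>(\<Union>i. C i). dyadic_cube E)" using U(1) C(2) by blast
    then have "net_content t E \<le> cost t (\<Union>i. C i)"
      unfolding net_content_def using C(1) by (intro INF_lower) auto
    also have "\<dots> \<le> (\<Sum>i. cost t (C i))" by (rule infsum_ennreal_UN_le)
    also have "\<dots> \<le> (\<Sum>i. ennreal (?c * diameter (U i) powr t) + ennreal (e' * (1/2) ^ Suc i))"
      by (intro suminf_le C(3)) auto
    also have "\<dots> = (\<Sum>i. ennreal (?c * diameter (U i) powr t)) + (\<Sum>i. ennreal (e' * (1/2) ^ Suc i))"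
      by (rule suminf_add[symmetric]) auto
    also have "(\<Sum>i. ennreal (?c * diameter (U i) powr t)) = ennreal ?c * (\<Sum>i. ennreal (diameter (U i) powr t))"
      by (simp only: ennreal_mult[OF less_imp_le[OF c] powr_ge_zero] ennreal_suminf_cmult)
    also have "(\<Sum>i. ennreal (e' * (1/2) ^ Suc i)) = ennreal e'"
    proof -
      have "(\<lambda>i. e' * (1/2) ^ Suc i) sums (e' * 1)" by (intro sums_mult power_half_series)
      then show ?thesis using e' by (subst suminf_ennreal2) (auto simp: sums_iff)
    qed
    also have "ennreal ?c * (\<Sum>i. ennreal (diameter (U i) powr t)) + ennreal e' \<le> ennreal ?c * ennreal e' + ennreal e'"
      using U(3) by (intro add_right_mono mult_left_mono) auto
    also have "\<dots> = ennreal (?c * e' + e')" using c e' by (simp add: ennreal_mult ennreal_plus)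
    also have "?c * e' + e' = e"
    proof -
      have "?c * e' + e' = (?c + 1) * e'" by (simp add: algebra_simps)
      also have "\<dots> = e" using less_imp_neq[OF c1] by (simp only: e'_def nonzero_mult_div_cancel_left times_divide_eq_right less_imp_neq[symmetric] not_False_eq_True)
      finally show ?thesis .
    qed
    finally show ?thesis .
  qed
  then show ?thesis by (metis ennreal_le_epsilon add_0 le_zero_eq)
qed

section \<open>The Hausdorff dimension of the shrinking target set\<close>

context shrinking_target
begin

definition target :: "nat \<Rightarrow> 2 torus set" where
  "target n = {p. (torus_map A ^^ n) p \<in> ball (z n) (r n)}"

lemma card_int_interval_le:
  fixes x L h :: real
  assumes "0 \<le> L" "0 < h"
  shows "real (card {\<lfloor>x / h\<rfloor>..\<lfloor>(x + L) / h\<rfloor>}) \<le> L / h + 2"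
proof -
  have "(x + L) / h = x / h + L / h" "0 \<le> L / h" using assms by (auto simp: add_divide_distrib)
  then show ?thesis by simp linarith
qed

text \<open>In the eigencoordinates, \<open>target n\<close> consists of pieces of height of order \<open>r n / b n\<close>, one for each integer
point in a box, and each piece has width at most of order \<open>min (r n / a n) 1\<close> in the unit square. Cutting these pieces into parts of width
\<open>h \<ge> r n / b n\<close> yields sets of diameter of order \<open>h\<close>.\<close>

lemma target_cover:
  obtains d0 where "0 < d0"
    "\<And>n h. 0 < h \<Longrightarrow> r n / b n \<le> h \<Longrightarrow> \<exists>\<U>. finite \<U> \<and>
      real (card \<U>) \<le> 18 * (1 + (K * (a n + r n)) * (K * (b n + r n))) * (2 * K * min (r n / a n) 1 / h + 2) \<and>
      target n \<subseteq> \<Union>\<U> \<and> (\<forall>U\<in>\<U>. bounded U \<and> diameter U \<le> d0 * h)"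
proof -
  obtain L where L: "1 \<le> L" "\<And>x e i. \<bar>u x\<bar> \<le> e \<Longrightarrow> \<bar>v x\<bar> \<le> e \<Longrightarrow> \<bar>x $ i\<bar> \<le> L * e"
    by (rule coordinates_le_forms) blast
  have K: "1 \<le> K" by (rule K_ge_1)
  show thesis
  proof (rule that[of "4 * L * K"])
    show "0 < 4 * L * K" using L K by simp
    fix n and h :: real assume h: "0 < h" and hb: "r n / b n \<le> h"
    note pos = rab_pos[of n]
    define J where "J = lattice_box (- u (lift_z n)) (K * (a n + r n)) (- v (lift_z n)) (K * (b n + r n))"
    have U0: "0 < K * (a n + r n)" "0 < K * (b n + r n)" using K pos by (auto intro!: mult_pos_pos add_pos_pos)
    have J: "finite J" "real (card J) \<le> 18 * (1 + (K * (a n + r n)) * (K * (b n + r n)))"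
      unfolding J_def by (rule lattice_box_finite_card[OF U0])+
    define w where "w k = u (lift_z n) + u k" for k
    define w' where "w' k = v (lift_z n) + v k" for k
    define len where "len = 2 * K * min (r n / a n) 1"
    define start where "start k = (if r n \<le> a n then w k / \<mu> ^ n - K * (r n / a n) else - K)" for k
    define cells where "cells k = {\<lfloor>start k / h\<rfloor>..\<lfloor>(start k + len) / h\<rfloor>}" for k
    define piece where "piece = (\<lambda>(k, j). to_torus ` {x. \<lfloor>u x / h\<rfloor> = j \<and> \<bar>\<nu> ^ n * v x - w' k\<bar> \<le> K * r n})"
    define I where "I = Sigma J cells"
    have len: "0 \<le> len" using K pos by (simp add: len_def)
    have finI: "finite I" unfolding I_def using J by (auto simp: cells_def)
    have "real (card I) = (\<Sum>k\<in>J. real (card (cells k)))"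
      unfolding I_def using J by (subst card_SigmaI) (auto simp: cells_def)
    also have "\<dots> \<le> (\<Sum>k\<in>J. len / h + 2)"
      unfolding cells_def by (intro sum_mono card_int_interval_le len h)
    also have "\<dots> = real (card J) * (len / h + 2)" by simp
    also have "\<dots> \<le> 18 * (1 + (K * (a n + r n)) * (K * (b n + r n))) * (len / h + 2)"
      using J(2) len h by (intro mult_right_mono) auto
    finally have card_I: "real (card I) \<le> \<dots>" .
    have "target n \<subseteq> (\<Union>i\<in>I. piece i)"
    proof
      fix p assume p: "p \<in> target n"
      obtain x where x: "to_torus x = p" and unit: "\<forall>i. 0 \<le> x $ i \<and> x $ i < 1" by (rule unit_lift)
      have "x \<in> hit n" using p x by (simp add: hit_def target_def)
      then obtain k where k: "k \<in> integer_points" "dist ((A_real ^^ n) x) (lift_z n + k) < r n" by (rule hitE)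
      let ?d = "(A_real ^^ n) x - (lift_z n + k)"
      have "\<bar>?d $ i\<bar> \<le> r n" for i using component_le_norm_cart[of ?d i] k(2) by (simp add: dist_norm)
      then have "\<bar>u ?d\<bar> \<le> K * r n" "\<bar>v ?d\<bar> \<le> K * r n" by (auto intro: forms_le)
      then have du: "\<bar>\<mu> ^ n * u x - w k\<bar> \<le> K * r n" and dv: "\<bar>\<nu> ^ n * v x - w' k\<bar> \<le> K * r n"
        by (simp_all add: u_diff v_diff u_add v_add u_A_power v_A_power w_def w'_def)
      have "\<bar>x $ i\<bar> \<le> 1" for i using unit by (simp add: less_imp_le)
      then have ux: "\<bar>u x\<bar> \<le> K * 1" and vx: "\<bar>v x\<bar> \<le> K * 1" by (rule forms_le)+
      have "\<bar>\<mu> ^ n * u x\<bar> \<le> a n * K" "\<bar>\<nu> ^ n * v x\<bar> \<le> b n * K"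
        using ux vx pos by (simp_all add: abs_mult powers_eq mult_left_mono)
      then have "k \<in> J" using k(1) du dv unfolding J_def lattice_box_def w_def w'_def
        by (auto simp: algebra_simps abs_le_iff)
      moreover have "start k \<le> u x \<and> u x \<le> start k + len"
      proof (cases "r n \<le> a n")
        case True
        have nz: "\<mu> ^ n \<noteq> 0" using contracting by simp
        have "a n * \<bar>u x - w k / \<mu> ^ n\<bar> = \<bar>\<mu> ^ n * u x - w k\<bar>"
          using nz by (simp add: right_diff_distrib flip: powers_eq abs_mult)
        then have "\<bar>u x - w k / \<mu> ^ n\<bar> \<le> K * r n / a n" using du pos by (simp add: field_simps)
        moreover have "min (r n / a n) 1 = r n / a n" using True pos by (simp add: min_def)
        then have "start k = w k / \<mu> ^ n - K * r n / a n" "start k + len = w k / \<mu> ^ n + K * r n / a n"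
          using True by (simp_all add: start_def len_def)
        ultimately show ?thesis unfolding abs_le_iff by linarith
      next
        case False
        then have "min (r n / a n) 1 = 1" using pos by (simp add: min_def field_simps)
        then show ?thesis using ux False by (simp add: start_def len_def abs_le_iff)
      qed
      then have "\<lfloor>u x / h\<rfloor> \<in> cells k" using h by (auto simp: cells_def intro!: floor_mono divide_right_mono)
      ultimately have "(k, \<lfloor>u x / h\<rfloor>) \<in> I" by (simp add: I_def)
      moreover have "p \<in> piece (k, \<lfloor>u x / h\<rfloor>)" using x dv by (auto simp: piece_def)
      ultimately show "p \<in> (\<Union>i\<in>I. piece i)" by blast
    qed
    moreover have "bounded (piece i) \<and> diameter (piece i) \<le> 4 * L * K * h" for i
    proof -
      have dist: "dist p q \<le> 4 * L * K * h" if pq: "p \<in> piece i" "q \<in> piece i" for p q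
      proof -
        obtain k j where i: "i = (k, j)" by (cases i)
        have lift: "\<exists>x. p' = to_torus x \<and> \<lfloor>u x / h\<rfloor> = j \<and> \<bar>\<nu> ^ n * v x - w' k\<bar> \<le> K * r n"
          if "p' \<in> piece i" for p'
          using that unfolding piece_def i by auto
        obtain x y where xy: "p = to_torus x" "q = to_torus y" "\<lfloor>u x / h\<rfloor> = j" "\<lfloor>u y / h\<rfloor> = j"
          "\<bar>\<nu> ^ n * v x - w' k\<bar> \<le> K * r n" "\<bar>\<nu> ^ n * v y - w' k\<bar> \<le> K * r n"
          using lift[OF pq(1)] lift[OF pq(2)] by blast
        have "\<bar>u x / h - u y / h\<bar> \<le> 1" using xy(3,4) by linarith
        then have "\<bar>u x - u y\<bar> / h \<le> 1" using h by (simp flip: diff_divide_distrib)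
        then have "\<bar>u (x - y)\<bar> \<le> 1 * h" using h by (simp add: u_diff pos_divide_le_eq)
        also have "\<dots> \<le> 2 * K * h" using K h by (intro mult_right_mono) auto
        finally have 1: "\<bar>u (x - y)\<bar> \<le> 2 * K * h" .
        have "\<bar>\<nu> ^ n * v x - \<nu> ^ n * v y\<bar> \<le> 2 * (K * r n)" using xy(5,6) by linarith
        then have "b n * \<bar>v (x - y)\<bar> \<le> 2 * (K * r n)" by (simp add: v_diff right_diff_distrib flip: powers_eq abs_mult)
        then have "\<bar>v (x - y)\<bar> \<le> 2 * K * (r n / b n)" using pos by (simp add: field_simps)
        also have "\<dots> \<le> 2 * K * h" using hb K by (intro mult_left_mono) auto
        finally have 2: "\<bar>v (x - y)\<bar> \<le> 2 * K * h" .
        have "dist p q \<le> dist x y" unfolding xy(1,2) by (rule dist_to_torus_le)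
        also have "\<dots> \<le> (\<Sum>i\<in>UNIV. \<bar>(x - y) $ i\<bar>)" unfolding dist_norm by (rule norm_le_l1_cart)
        also have "\<dots> \<le> L * (2 * K * h) + L * (2 * K * h)"
          unfolding sum_2 by (intro add_mono L(2)[OF 1 2])
        finally show ?thesis by (simp add: ac_simps)
      qed
      have "0 \<le> 4 * L * K * h" using L K h by simp
      then have "diameter (piece i) \<le> 4 * L * K * h"
        using dist by (auto simp: diameter_def intro!: cSUP_least)
      moreover have "bounded (piece i)" using dist unfolding bounded_two_points by blast
      ultimately show ?thesis by blast
    qed
    ultimately show "\<exists>\<U>. finite \<U> \<and>
      real (card \<U>) \<le> 18 * (1 + (K * (a n + r n)) * (K * (b n + r n))) * (2 * K * min (r n / a n) 1 / h + 2) \<and>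
      target n \<subseteq> \<Union>\<U> \<and> (\<forall>U\<in>\<U>. bounded U \<and> diameter U \<le> 4 * L * K * h)"
      using finI card_I of_nat_mono[OF card_image_le[OF finI, of piece], where 'a = real]
      by (intro exI[of _ "piece ` I"]) (auto simp: len_def intro: order_trans)
  qed
qed

lemma target_null_if:
  assumes t: "0 < t" and \<gamma>: "0 < \<gamma>" and \<beta>: "\<beta> < \<gamma> * t"
    and h: "\<And>n. r n / b n \<le> exp (- real n * \<gamma>)"
    and count: "\<And>n. 18 * (1 + (K * (a n + r n)) * (K * (b n + r n))) * (2 * K * min (r n / a n) 1 / exp (- real n * \<gamma>) + 2)
      \<le> B * exp (real n * \<beta>)"
  shows "hausdorff_measure t (shrinking_target_set A z \<tau>) = 0"
proof -
  obtain d0 where d0: "0 < d0"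
    "\<And>n h. 0 < h \<Longrightarrow> r n / b n \<le> h \<Longrightarrow> \<exists>\<U>. finite \<U> \<and>
      real (card \<U>) \<le> 18 * (1 + (K * (a n + r n)) * (K * (b n + r n))) * (2 * K * min (r n / a n) 1 / h + 2) \<and>
      target n \<subseteq> \<Union>\<U> \<and> (\<forall>U\<in>\<U>. bounded U \<and> diameter U \<le> d0 * h)"
    by (rule target_cover) blast
  let ?h = "\<lambda>n. exp (- real n * \<gamma>)"
  have "\<exists>\<U>. finite \<U> \<and> real (card \<U>) \<le> B * exp (real n * \<beta>) \<and>
      target n \<subseteq> \<Union>\<U> \<and> (\<forall>U\<in>\<U>. bounded U \<and> diameter U \<le> d0 * ?h n)" for n
    using d0(2)[OF _ h[of n]] count[of n] by (fastforce intro: order_trans)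
  then obtain \<U> where \<U>: "\<And>n. finite (\<U> n)" "\<And>n. real (card (\<U> n)) \<le> B * exp (real n * \<beta>)"
    "\<And>n. target n \<subseteq> \<Union>(\<U> n)" "\<And>n U. U \<in> \<U> n \<Longrightarrow> bounded U \<and> diameter U \<le> d0 * ?h n"
    by metis
  have h_power: "?h n = exp (- \<gamma>) ^ n" for n by (simp flip: exp_of_nat_mult)
  have "(\<lambda>n. d0 * exp (- \<gamma>) ^ n) \<longlonglongrightarrow> d0 * 0"
    using \<gamma> by (intro tendsto_mult tendsto_const LIMSEQ_realpow_zero) auto
  then have lim: "(\<lambda>n. d0 * ?h n) \<longlonglongrightarrow> 0" by (simp only: h_power mult_zero_right)
  have "B * exp (real n * \<beta>) * (d0 * ?h n) powr t = B * d0 powr t * exp (\<beta> - \<gamma> * t) ^ n" for n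
  proof -
    have "(d0 * ?h n) powr t = d0 powr t * exp (- real n * \<gamma> * t)"
    proof -
      have "(d0 * ?h n) powr t = d0 powr t * ?h n powr t" using d0(1) by (simp add: powr_mult)
      moreover have "?h n powr t = exp (- real n * \<gamma> * t)" by (simp add: powr_def)
      ultimately show ?thesis by simp
    qed
    moreover have "exp (real n * \<beta>) * exp (- real n * \<gamma> * t) = exp (\<beta> - \<gamma> * t) ^ n"
      by (simp add: algebra_simps flip: exp_add exp_of_nat_mult)
    ultimately show ?thesis by (simp add: ac_simps)
  qed
  moreover have "summable (\<lambda>n. B * d0 powr t * exp (\<beta> - \<gamma> * t) ^ n)"
    using \<beta> by (intro summable_mult summable_geometric) auto
  ultimately have "summable (\<lambda>n. B * exp (real n * \<beta>) * (d0 * ?h n) powr t)" by (simp only:)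
  then have "hausdorff_measure t {p. \<exists>\<^sub>\<infinity>n. p \<in> target n} = 0"
    using \<U> lim
    by (intro hausdorff_measure_limsup_null[OF t, where \<U> = \<U> and d = "\<lambda>n. d0 * ?h n"
        and M = "\<lambda>n. B * exp (real n * \<beta>)"]) blast+
  then show ?thesis by (simp add: shrinking_target_set_def target_def r_def)
qed

lemma lattice_count_le:
  "18 * (1 + (K * (a n + r n)) * (K * (b n + r n))) \<le> 90 * K\<^sup>2 * (max (a n) (r n) * b n)"
proof -
  note pos = rab_pos[of n]
  have K: "1 \<le> K\<^sup>2" using K_ge_1 by (simp add: one_le_power)
  have rb: "r n \<le> b n" using r_le_1[of n] b_ge_1[of n] by linarith
  have "a n * b n \<le> max (a n) (r n) * b n" using pos by (intro mult_right_mono) auto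
  then have m: "1 \<le> max (a n) (r n) * b n" using ab_ge_1[of n] by linarith
  have "(a n + r n) * (b n + r n) \<le> (2 * max (a n) (r n)) * (2 * b n)"
    using rb pos by (intro mult_mono) auto
  then have "K\<^sup>2 * ((a n + r n) * (b n + r n)) \<le> K\<^sup>2 * (4 * (max (a n) (r n) * b n))"
    by (intro mult_left_mono) auto
  moreover have "1 * 1 \<le> K\<^sup>2 * (max (a n) (r n) * b n)" using K m by (intro mult_mono) auto
  ultimately show ?thesis by (simp add: power2_eq_square algebra_simps)
qed

text \<open>Cover by about \<open>(b n)\<^sup>2\<close> sets whose diameter is the short side \<open>r n / b n\<close> of the pieces. There are at most of the
order of \<open>max (a n) (r n) * b n\<close> pieces, each of which is cut into at most of the order of \<open>b n / max (a n) (r n)\<close> parts.\<close>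

lemma target_null_short_sides:
  assumes t: "0 < t" "2 * l2 / (\<tau> + l2) < t"
  shows "hausdorff_measure t (shrinking_target_set A z \<tau>) = 0"
proof (rule target_null_if[OF t(1)])
  show "0 < \<tau> + l2" using \<tau>_pos l2_pos by simp
  then show "2 * l2 < (\<tau> + l2) * t" using t(2) by (simp add: field_simps)
  fix n
  note pos = rab_pos[of n]
  let ?m = "max (a n) (r n)"
  have h: "exp (- real n * (\<tau> + l2)) = r n / b n"
    by (simp add: r_def b_def algebra_simps flip: exp_diff)
  then show "r n / b n \<le> exp (- real n * (\<tau> + l2))" by simp
  have m: "0 < ?m" "?m \<le> 1" using pos a_le_1[of n] r_le_1[of n] by auto
  have eq: "min (r n / a n) 1 / (r n / b n) = b n / ?m" using pos by (auto simp: min_def max_def field_simps)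
  have "2 \<le> 2 * (b n / ?m)" using m b_ge_1[of n] by (simp add: field_simps)
  then have le: "2 * K * min (r n / a n) 1 / (r n / b n) + 2 \<le> (2 * K + 2) * (b n / ?m)"
    unfolding times_divide_eq_right[symmetric, of "2 * K"] eq distrib_right by linarith
  have "18 * (1 + (K * (a n + r n)) * (K * (b n + r n))) * (2 * K * min (r n / a n) 1 / (r n / b n) + 2)
    \<le> (90 * K\<^sup>2 * (?m * b n)) * ((2 * K + 2) * (b n / ?m))"
    using K_ge_1 pos m by (intro mult_mono lattice_count_le le) auto
  also have "\<dots> = (90 * K\<^sup>2 * (2 * K + 2)) * (b n * b n)" using m by simp
  also have "b n * b n = exp (real n * (2 * l2))" by (simp add: b_def algebra_simps flip: exp_add)
  finally show "18 * (1 + (K * (a n + r n)) * (K * (b n + r n))) *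
      (2 * K * min (r n / a n) 1 / exp (- real n * (\<tau> + l2)) + 2)
    \<le> (90 * K\<^sup>2 * (2 * K + 2)) * exp (real n * (2 * l2))" unfolding h .
qed

text \<open>If \<open>- l1 < \<tau>\<close>, the pieces are short enough to be covered whole: about \<open>a n * b n\<close> sets of diameter \<open>r n / a n\<close>.\<close>

lemma target_null_long_sides:
  assumes \<tau>: "- l1 < \<tau>" and t: "0 < t" "(l1 + l2) / (\<tau> + l1) < t"
  shows "hausdorff_measure t (shrinking_target_set A z \<tau>) = 0"
proof (rule target_null_if[OF t(1)])
  show "0 < \<tau> + l1" using \<tau> by simp
  then show "l1 + l2 < (\<tau> + l1) * t" using t(2) by (simp add: field_simps)
  fix n
  note pos = rab_pos[of n]
  have h: "exp (- real n * (\<tau> + l1)) = r n / a n"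
    by (simp add: r_def a_def algebra_simps flip: exp_diff)
  have ab: "a n \<le> b n" using a_le_1[of n] b_ge_1[of n] by linarith
  show "r n / b n \<le> exp (- real n * (\<tau> + l1))" unfolding h using pos ab by (intro divide_left_mono) auto
  have "exp (- real n * (\<tau> + l1)) \<le> 1" using \<tau> by (simp add: mult_nonneg_nonneg)
  then have ra: "r n / a n \<le> 1" unfolding h .
  then have m: "max (a n) (r n) = a n" using pos by (simp add: field_simps)
  have "min (r n / a n) 1 = r n / a n" using ra by simp
  then have len: "2 * K * min (r n / a n) 1 / (r n / a n) + 2 = 2 * K + 2" using pos by simp
  have "18 * (1 + (K * (a n + r n)) * (K * (b n + r n))) * (2 * K + 2) \<le> (90 * K\<^sup>2 * (a n * b n)) * (2 * K + 2)"
    using K_ge_1 lattice_count_le[of n] unfolding m by (intro mult_right_mono) auto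
  also have "\<dots> = (90 * K\<^sup>2 * (2 * K + 2)) * (a n * b n)" by simp
  also have "a n * b n = exp (real n * (l1 + l2))" by (simp add: a_def b_def algebra_simps flip: exp_add)
  finally show "18 * (1 + (K * (a n + r n)) * (K * (b n + r n))) *
      (2 * K * min (r n / a n) 1 / exp (- real n * (\<tau> + l1)) + 2)
    \<le> (90 * K\<^sup>2 * (2 * K + 2)) * exp (real n * (l1 + l2))" unfolding h len .
qed

lemma hausdorff_measure_target_null:
  assumes "0 < t" "s < t"
  shows "hausdorff_measure t (shrinking_target_set A z \<tau>) = 0"
proof (cases "2 * l2 / (\<tau> + l2) < t")
  case True
  then show ?thesis using assms(1) by (intro target_null_short_sides)
next
  case False
  then have "\<not> \<tau> < - l1 \<and> (l1 + l2) / (\<tau> + l1) < t"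
    using assms(2) by (auto simp: shrinking_target_dim_def min_less_iff_disj split: if_splits)
  then show ?thesis using \<tau>_ne assms(1) by (intro target_null_long_sides) auto
qed

lemma hausdorff_measure_target_nonzero:
  assumes "0 < t" "t < s"
  shows "hausdorff_measure t (shrinking_target_set A z \<tau>) \<noteq> 0"
proof
  let ?W = "shrinking_target_set A z \<tau>"
  let ?D = "(0, \<lambda>_. 0) :: nat \<times> (2 \<Rightarrow> nat)"
  assume "hausdorff_measure t ?W = 0"
  then have "net_content t ?W = 0" using hausdorff_null_imp_net_content_null assms(1) by blast
  moreover have "ennreal (side_length ?D powr t) \<le> net_content t ?W"
    unfolding net_content_def
  proof (intro INF_greatest)
    fix C assume "C \<in> {C. C \<subseteq> dyadic_indices \<and> ?W \<subseteq> (\<Union>D\<in>C. dyadic_cube D)}"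
    then show "ennreal (side_length ?D powr t) \<le> cost t C"
      by (intro target_cover_cost[OF assms]) (auto simp: dyadic_indices_def)
  qed
  ultimately show False by (simp add: side_length_eq)
qed

theorem hausdorff_dim_target: "hausdorff_dim (shrinking_target_set A z \<tau>) = ereal s"
proof (rule antisym)
  have s0: "0 \<le> s"
    using \<tau>_pos \<tau>_ne l2_pos l_sum by (auto simp: shrinking_target_dim_def not_less)
  let ?S = "{t. 0 < t \<and> hausdorff_measure t (shrinking_target_set A z \<tau>) = 0}"
  show "hausdorff_dim (shrinking_target_set A z \<tau>) \<le> ereal s"
  proof (rule ereal_le_epsilon2)
    fix e :: real assume e: "0 < e"
    have "s + e \<in> ?S" using e s0 hausdorff_measure_target_null[of "s + e"] by simp
    then have "hausdorff_dim (shrinking_target_set A z \<tau>) \<le> ereal (s + e)"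
      unfolding hausdorff_dim_def by (rule INF_lower)
    then show "hausdorff_dim (shrinking_target_set A z \<tau>) \<le> ereal s + ereal e" by simp
  qed
  show "ereal s \<le> hausdorff_dim (shrinking_target_set A z \<tau>)"
    unfolding hausdorff_dim_def
  proof (rule INF_greatest)
    fix t assume "t \<in> ?S"
    then show "ereal s \<le> ereal t" using hausdorff_measure_target_nonzero[of t] by (simp add: not_less[symmetric]) blast
  qed
qed

end

section \<open>Eigenvalues of the matrix\<close>

lemma eigenvalue_of_characteristic:
  fixes A :: "int^2^2"
  assumes "eigenvalue_of A c"
  shows "c\<^sup>2 - of_int (A $ 1 $ 1 + A $ 2 $ 2) * c + of_int (A $ 1 $ 1 * A $ 2 $ 2 - A $ 1 $ 2 * A $ 2 $ 1) = 0"
proof -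
  obtain x :: "complex^2" where x: "x \<noteq> 0" "map_matrix of_int A *v x = c *s x"
    using assms by (auto simp: eigenvalue_of_def)
  have "(map_matrix of_int A *v x) $ i = c * x $ i" for i using x(2) by simp
  from this[of 1] this[of 2]
  have eq: "of_int (A $ 1 $ 1) * x $ 1 + of_int (A $ 1 $ 2) * x $ 2 = c * x $ 1"
    "of_int (A $ 2 $ 1) * x $ 1 + of_int (A $ 2 $ 2) * x $ 2 = c * x $ 2"
    by (simp_all add: matrix_vector_mult_def sum_2)
  let ?P = "c\<^sup>2 - of_int (A $ 1 $ 1 + A $ 2 $ 2) * c + of_int (A $ 1 $ 1 * A $ 2 $ 2 - A $ 1 $ 2 * A $ 2 $ 1)"
  have "?P * x $ 1 = (c - of_int (A $ 2 $ 2)) * (c * x $ 1 - (of_int (A $ 1 $ 1) * x $ 1 + of_int (A $ 1 $ 2) * x $ 2))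
      + of_int (A $ 1 $ 2) * (c * x $ 2 - (of_int (A $ 2 $ 1) * x $ 1 + of_int (A $ 2 $ 2) * x $ 2))"
    by (simp add: power2_eq_square algebra_simps)
  also have "\<dots> = 0" unfolding eq by simp
  finally have 1: "?P * x $ 1 = 0" .
  have "?P * x $ 2 = (c - of_int (A $ 1 $ 1)) * (c * x $ 2 - (of_int (A $ 2 $ 1) * x $ 1 + of_int (A $ 2 $ 2) * x $ 2))
      + of_int (A $ 2 $ 1) * (c * x $ 1 - (of_int (A $ 1 $ 1) * x $ 1 + of_int (A $ 1 $ 2) * x $ 2))"
    by (simp add: power2_eq_square algebra_simps)
  also have "\<dots> = 0" unfolding eq by simp
  finally have 2: "?P * x $ 2 = 0" .
  have "x $ 1 \<noteq> 0 \<or> x $ 2 \<noteq> 0" using x(1) by (auto simp: vec_eq_iff forall_2)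
  then show ?thesis using 1 2 by auto
qed

text \<open>The two eigenvalues have different absolute values, so they are distinct and hence both roots of the characteristic
polynomial, and they are not complex conjugates of each other.\<close>

lemma hyperbolic_eigenvalues_real:
  fixes A :: "int^2^2"
  assumes "eigenvalue_of A ev1" "eigenvalue_of A ev2" "cmod ev1 < cmod ev2"
  shows "Im ev1 = 0" "Im ev2 = 0"
    "Re ev1 + Re ev2 = real_of_int (A $ 1 $ 1 + A $ 2 $ 2)"
    "Re ev1 * Re ev2 = real_of_int (A $ 1 $ 1 * A $ 2 $ 2 - A $ 1 $ 2 * A $ 2 $ 1)"
proof -
  define t where "t = A $ 1 $ 1 + A $ 2 $ 2"
  define d where "d = A $ 1 $ 1 * A $ 2 $ 2 - A $ 1 $ 2 * A $ 2 $ 1"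
  have root: "ev1\<^sup>2 - of_int t * ev1 + of_int d = 0" "ev2\<^sup>2 - of_int t * ev2 + of_int d = 0"
    using assms(1,2) by (auto dest: eigenvalue_of_characteristic simp: t_def d_def)
  have ne: "ev1 \<noteq> ev2" using assms(3) by auto
  have "(ev1 - ev2) * (ev1 + ev2 - of_int t) = (ev1\<^sup>2 - of_int t * ev1 + of_int d) - (ev2\<^sup>2 - of_int t * ev2 + of_int d)"
    by (simp add: power2_eq_square algebra_simps)
  then have sum: "ev1 + ev2 = of_int t" using root ne by simp
  have "of_int d = ev1 * (of_int t - ev1)" using root(1) by (simp add: power2_eq_square algebra_simps)
  also have "\<dots> = ev1 * ev2" by (simp flip: sum)
  finally have prod: "ev1 * ev2 = of_int d" by simp
  have "Im ev1 + Im ev2 = 0" "Re ev1 + Re ev2 = t" using sum by (auto simp: complex_eq_iff)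
  moreover have "Re ev1 * Im ev2 + Im ev1 * Re ev2 = 0" "Re ev1 * Re ev2 - Im ev1 * Im ev2 = d"
    using prod by (auto simp: complex_eq_iff)
  moreover have im: "Im ev1 = 0"
  proof (rule ccontr)
    assume "Im ev1 \<noteq> 0"
    have "Im ev2 = - Im ev1" using \<open>Im ev1 + Im ev2 = 0\<close> by simp
    then have "Im ev1 * (Re ev2 - Re ev1) = 0"
      using \<open>Re ev1 * Im ev2 + Im ev1 * Re ev2 = 0\<close> by (simp add: algebra_simps)
    then have "Re ev2 = Re ev1" using \<open>Im ev1 \<noteq> 0\<close> by simp
    then have "cmod ev1 = cmod ev2" using \<open>Im ev2 = - Im ev1\<close> by (simp add: cmod_def)
    then show False using assms(3) by simp
  qed
  ultimately show "Im ev1 = 0" "Im ev2 = 0" "Re ev1 + Re ev2 = real_of_int (A $ 1 $ 1 + A $ 2 $ 2)"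
    "Re ev1 * Re ev2 = real_of_int (A $ 1 $ 1 * A $ 2 $ 2 - A $ 1 $ 2 * A $ 2 $ 1)"
    by (simp_all add: t_def d_def)
qed

theorem theorem2p1:
  fixes A :: "int^2^2" and ev1 ev2 :: complex and l1 l2 \<tau> :: real and z :: "nat \<Rightarrow> 2 torus"
  assumes "eigenvalue_of A ev1" and "eigenvalue_of A ev2"
    and "0 < cmod ev1" and "cmod ev1 < 1" and "1 < cmod ev2"
    and "l1 = ln (cmod ev1)" and "l2 = ln (cmod ev2)"
    and "0 < \<tau>" and "\<tau> \<noteq> - l1"
  shows "hausdorff_dim (shrinking_target_set A z \<tau>) = ereal (shrinking_target_dim l1 l2 \<tau>)
    \<and> shrinking_target_set A z \<tau> \<in> large_intersection_class (shrinking_target_dim l1 l2 \<tau>)"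
proof -
  have "cmod ev1 < cmod ev2" using assms(4,5) by linarith
  note ev = hyperbolic_eigenvalues_real[OF assms(1,2) this]
  have mod: "cmod ev1 = \<bar>Re ev1\<bar>" "cmod ev2 = \<bar>Re ev2\<bar>" using ev(1,2) by (simp_all add: cmod_eq_Re)
  interpret shrinking_target A "Re ev1" "Re ev2" z \<tau> l1 l2
    using ev(3,4) assms(3-9) by unfold_locales (auto simp: mod)
  show ?thesis using hausdorff_dim_target target_in_large_intersection_class by blast
qed

end
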